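(* Let $\{a_{m,n}\}_{m,n\in\mathbb{Z}_+}$ be a family of complex numbers and define $$s_{m,n}=\frac{1}{2^m(2i)^n}\sum_{k=0}^m\sum_{j=0}^n(-1)^{n-j}\binom{m}{k}\binom{n}{j}a_{k+j,\,m-k+n-j},\qquad m,n\in\mathbb{Z}_+,\qquad S=\{s_{m,n}\}_{m,n\in\mathbb{Z}_+}.$$ There exists a non-negative Borel measure $\sigma$ on $\mathbb{C}$ such that $$\int_{\mathbb{C}}z^m\overline{z}^n\,d\sigma=a_{m,n},\qquad m,n\in\mathbb{Z}_+,$$ if and only if all of the following conditions hold: (i) $\sum_{m,n,m',n'\in\mathbb{Z}_+}\alpha_{m,n}\overline{\alpha_{m',n'}}\,s_{m+m',n+n'}\ge0$ for all complex coefficients $\alpha_{m,n}$, all but finitely many of which are zero; (ii) for an arbitrarily chosen and fixed model space $\mathcal{H}$ with a family $\{h_{m,n}\}_{m,n\in\mathbb{Z}_+}$ satisfying $(h_{m,n},h_{m',n'})_{\mathcal{H}_0}=s_{m+m',n+n'}$, and fixed auxiliary choices as described in the context, those of the equations (E1)–(E10) of the context all of whose vectors belong to $\{h_{m,0,0;n,0,0}:\ m,n\in\mathbb{Z}_+\}$ are satisfied with $h_{m,0,0;n,0,0}:=h_{m,n}$, and $\mathbf{G}\neq\emptyset$, where $\mathbf{G}$ is the set produced by the algorithm described in the context; (iii) $\displaystyle a_{m,n}=\sum_{r=0}^m\sum_{l=0}^n\binom{m}{r}\binom{n}{l}(-1)^{n-l}\,i^{\,m-r+n-l}\,s_{r+l,\,m-r+n-l}$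 for all $m,n\in\mathbb{Z}_+$.
   Context: **Conventions.** $\mathbb{N}$ is the set of positive integers, $\mathbb{Z}_+$ the non-negative integers. Hilbert spaces are complex and separable, with scalar product linear in the first argument. A solution of a moment problem is a non-negative Borel measure for which all the integrals exist and have the prescribed values. The two-dimensional moment problem with moments $S=\{s_{m,n}\}$ is: find a non-negative Borel measure $\mu$ on $\mathbb{R}^2$ with $\int_{\mathbb{R}^2}x_1^mx_2^n\,d\mu=s_{m,n}$ for all $m,n\in\mathbb{Z}_+$. **Index sets.** $\Omega=\{(m,k,l;n,r,t):\ m,n\in\mathbb{Z}_+,\ k,l,r,t\in\mathbb{Z}\}$, $\Omega_0=\{(m,k,l;n,r,t)\in\Omega:\ k=l=r=t=0\}$, $\Omega'=\Omega\setminus\Omega_0$. Fix an arbitrary bijection $w:\mathbb{N}\to\Omega'$. **Model space.** For $\{s_{m,n}\}$ satisfying the positivity condition (i), there are a Hilbert space $\mathcal{H}_0$ and a family $\{h_{m,n}\}_{m,n\in\mathbb{Z}_+}$ with closed linear span $\mathcal{H}_0$ such that $(h_{m,n},h_{m',n'})_{\mathcal{H}_0}=s_{m+m',n+n'}$. A model space is $\mathcal{H}=\mathcal{H}_0\oplus\big(\bigoplus_{j=1}^\infty\mathcal{H}_j\big)$ with arbitrary one-dimensional Hilbert spaces $\mathcal{H}_j$; $e_j\in\mathcal{H}_j$ are arbitrary fixed unit vectors. $\{g_n\}_{n\ge1}$ is the orthonormal basis of $\mathcal{H}_0$ obtained by Gram–Schmidt orthogonalization from $\{h_{m,n}\}$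 arranged in a single sequence (if $\dim\mathcal{H}_0<\infty$, the index $n$ of $g_n$ below runs only over $1,\dots,\dim\mathcal{H}_0$). **Equations.** For a family $\{h_{m,k,l;n,r,t}\}$ in $\mathcal{H}$ consider, for all indices in $\Omega$: (E1) $(h_{m+1,k,l;n,r,t}+ih_{m,k,l;n,r,t},h_{a,b,c;d,e,f})=(h_{m,k+1,l;n,r,t},h_{a,b,c;d,e,f})$; (E2) $(h_{m+1,k,l;n,r,t}-ih_{m,k,l;n,r,t},h_{a,b,c;d,e,f})=(h_{m,k,l+1;n,r,t},h_{a,b,c;d,e,f})$; (E3) $(h_{m,k,l;n+1,r,t}+ih_{m,k,l;n,r,t},h_{a,b,c;d,e,f})=(h_{m,k,l;n,r+1,t},h_{a,b,c;d,e,f})$; (E4) $(h_{m,k,l;n+1,r,t}-ih_{m,k,l;n,r,t},h_{a,b,c;d,e,f})=(h_{m,k,l;n,r,t+1},h_{a,b,c;d,e,f})$; (E5) $(h_{m,k,l;n,r,t},h_{m',k',l';n',r',t'})=(h_{\widetilde m,k,l;n,r,t},h_{\widetilde m',k',l';n',r',t'})$ if $m+m'=\widetilde m+\widetilde m'$; (E6) $(h_{m,k,l;n,r,t},h_{m',k',l';n',r',t'})=(h_{m,\widetilde k,l;n,r,t},h_{m',k',\widetilde l';n',r',t'})$ if $k+l'=\widetilde k+\widetilde l'$; (E7) $(h_{m,k,l;n,r,t},h_{m',k',l';n',r',t'})=(h_{m,k,\widetilde l;n,r,t},h_{m',\widetilde k',l';n',r',t'})$ if $l+k'=\widetilde l+\widetilde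 k'$; (E8) $(h_{m,k,l;n,r,t},h_{m',k',l';n',r',t'})=(h_{m,k,l;\widetilde n,r,t},h_{m',k',l';\widetilde n',r',t'})$ if $n+n'=\widetilde n+\widetilde n'$; (E9) $(h_{m,k,l;n,r,t},h_{m',k',l';n',r',t'})=(h_{m,k,l;n,\widetilde r,t},h_{m',k',l';n',r',\widetilde t'})$ if $r+t'=\widetilde r+\widetilde t'$; (E10) $(h_{m,k,l;n,r,t},h_{m',k',l';n',r',t'})=(h_{m,k,l;n,r,\widetilde t},h_{m',k',l';n',\widetilde r',t'})$ if $t+r'=\widetilde t+\widetilde r'$. **Constants.** For each $j\in\mathbb{N}$, with $w(j)=(m,k,l;n,r,t)$, $M_j=M_j(S)>0$ is a fixed constant depending only on the prescribed moments such that $\int_{\mathbb{R}^2}x_1^{2m}(x_1^2+1)^{k+l}x_2^{2n}(x_2^2+1)^{r+t}\,d\mu\le M_j$ for every solution $\mu$ of the two-dimensional moment problem with moments $S$. **Algorithm.** Step 0: set $h_{m,0,0;n,0,0}=h_{m,n}$, and check those equations (E1)–(E10) that involve only these vectors (if they fail, stop: no solution). Step $q$ ($q\ge1$): seek $h_{w(q)}=\sum_n\alpha_{q;n}g_n+\sum_{j=1}^{q}\beta_{q;j}e_j$ with complex coefficients. Given $(h_{w(1)},\dots,h_{w(q-1)})\in G_{q-1}$ (no such parameters when $q=1$), let $L_q$ be the set of those equations (E1)–(E10) that involve $h_{w(q)}$ and otherwise only the vectors $h_{m,0,0;n,0,0}$ and $h_{w(1)},\dots,h_{w(q-1)}$.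 Writing $d_q$ for $(h_{w(q)},h_{w(q)})$, the equations in $L_q$ are regarded as equations in the unknowns $\alpha_{q;n}$ (all $n$), $\beta_{q;j}$ ($1\le j\le q-1$) and $d_q$ (the coefficient $\beta_{q;q}$ enters only through $d_q$). Let $S_q$ be the set of all $(\alpha_{q;n},\ \text{all }n;\ \beta_{q;j},\ 1\le j\le q-1;\ d_q;\ h_{w(1)},\dots,h_{w(q-1)})$ such that $(h_{w(1)},\dots,h_{w(q-1)})\in G_{q-1}$ and the equations $L_q$ with these parameters are satisfied. Let $\widehat S_q$ be the subset of $S_q$ given by $\sum_n|\alpha_{q;n}|^2+\sum_{j=1}^{q-1}|\beta_{q;j}|^2\le d_q$ and $d_q\le M_q$. Let $G_q$ be the set of all tuples $$\Big(h_{w(1)},\dots,h_{w(q-1)},\ \sum_n\alpha_{q;n}g_n+\sum_{j=1}^{q-1}\beta_{q;j}e_j+\Big(d_q-\sum_n|\alpha_{q;n}|^2-\sum_{j=1}^{q-1}|\beta_{q;j}|^2\Big)^{1/2}e_q\Big)$$ with $(\alpha_{q;n};\beta_{q;j};d_q;h_{w(1)},\dots,h_{w(q-1)})\in\widehat S_q$ (possibly $G_q=\emptyset$). Final step: let $\mathbf{H}$ be the space of sequences $\mathbf{h}=(h_1,h_2,\dots)$ in $\mathcal{H}$ with $\|\mathbf{h}\|_{\mathbf{H}}=\sup_{q}M_q^{-1/2}\|h_q\|_{\mathcal{H}}<\infty$. Let $\mathbf{G}_q\subset\mathbf{H}$ be the set of all sequences $(h_1,\dots,h_q,v_{q+1},v_{q+2},\dots)$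 with $(h_1,\dots,h_q)\in G_q$ and $v_j\in\mathcal{H}$, $\|v_j\|_{\mathcal{H}}\le\sqrt{M_j}$ for $j>q$ ($\mathbf{G}_q=\emptyset$ if $G_q=\emptyset$). Put $\mathbf{G}=\bigcap_{q=1}^\infty\mathbf{G}_q$. *)

theory Defs
  imports "HOL-Analysis.Analysis"
begin

section \<open>Complex Hilbert spaces\<close>

text \<open>The scalar product is linear in its first argument. The last axiom also encodes
  positive definiteness.\<close>

class chilbert_space = banach +
  fixes scaleC :: "complex \<Rightarrow> 'a \<Rightarrow> 'a" (infixr "*\<^sub>C" 75)
    and cinner :: "'a \<Rightarrow> 'a \<Rightarrow> complex"
  assumes scaleC_add_right: "c *\<^sub>C (x + y) = c *\<^sub>C x + c *\<^sub>C y"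
    and scaleC_add_left: "(c + d) *\<^sub>C x = c *\<^sub>C x + d *\<^sub>C x"
    and scaleC_scaleC: "c *\<^sub>C d *\<^sub>C x = (c * d) *\<^sub>C x"
    and scaleC_one: "1 *\<^sub>C x = x"
    and scaleC_of_real: "complex_of_real r *\<^sub>C x = r *\<^sub>R x"
    and cinner_add_left: "cinner (x + y) z = cinner x z + cinner y z"
    and cinner_scaleC_left: "cinner (c *\<^sub>C x) y = c * cinner x y"
    and cinner_commute: "cinner x y = cnj (cinner y x)"
    and cinner_self: "cinner x x = complex_of_real ((norm x)\<^sup>2)"

global_interpretation complex_vector: vector_space "scaleC :: complex \<Rightarrow> 'a \<Rightarrow> 'a::chilbert_space"
  defines csubspace = complex_vector.subspace
    and cspan = complex_vector.span
    and cdim = complex_vector.dim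
  by unfold_locales
    (simp_all add: scaleC_add_right scaleC_add_left scaleC_scaleC scaleC_one)


section \<open>Moment problems\<close>

definition complex_moment_solution :: "(nat \<Rightarrow> nat \<Rightarrow> complex) \<Rightarrow> complex measure \<Rightarrow> bool" where
  "complex_moment_solution a \<sigma> \<longleftrightarrow> sets \<sigma> = sets borel \<and>
     (\<forall>m n. integrable \<sigma> (\<lambda>z. z ^ m * cnj z ^ n) \<and> (\<integral>z. z ^ m * cnj z ^ n \<partial>\<sigma>) = a m n)"

definition plane_moment_solution ::
  "(nat \<Rightarrow> nat \<Rightarrow> complex) \<Rightarrow> (real \<times> real) measure \<Rightarrow> bool" where
  "plane_moment_solution s \<mu> \<longleftrightarrow> sets \<mu> = sets borel \<and>
     (\<forall>m n. integrable \<mu> (\<lambda>(x1, x2). x1 ^ m * x2 ^ n) \<and>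
            complex_of_real (\<integral>(x1, x2). x1 ^ m * x2 ^ n \<partial>\<mu>) = s m n)"

definition plane_moments :: "(nat \<Rightarrow> nat \<Rightarrow> complex) \<Rightarrow> nat \<Rightarrow> nat \<Rightarrow> complex" where
  "plane_moments a m n = 1 / (2 ^ m * (2 * \<i>) ^ n) *
     (\<Sum>k=0..m. \<Sum>j=0..n. (-1) ^ (n - j) * of_nat (m choose k) * of_nat (n choose j) *
        a (k + j) ((m - k) + (n - j)))"

definition positivity_condition :: "(nat \<Rightarrow> nat \<Rightarrow> complex) \<Rightarrow> bool" where
  "positivity_condition s \<longleftrightarrow>
     (\<forall>\<alpha> :: nat \<Rightarrow> nat \<Rightarrow> complex. finite {(m, n). \<alpha> m n \<noteq> 0} \<longrightarrow>
        (\<Sum>(m, n) \<in> {(m, n). \<alpha> m n \<noteq> 0}. \<Sum>(m', n') \<in> {(m, n). \<alpha> m n \<noteq> 0}.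
           \<alpha> m n * cnj (\<alpha> m' n') * s (m + m') (n + n')) \<in> \<real>\<^sub>\<ge>\<^sub>0)"


section \<open>Index sets and the equations\<close>

text \<open>The tuple \<open>(m, k, l, n, r, t)\<close> stands for the index \<open>(m,k,l;n,r,t)\<close>, so the index set
  \<open>\<Omega>\<close> is the whole type.\<close>

type_synonym idx = "nat \<times> int \<times> int \<times> nat \<times> int \<times> int"

definition Omega0 :: "idx set" where
  "Omega0 = {(m, k, l, n, r, t). k = 0 \<and> l = 0 \<and> r = 0 \<and> t = 0}"

definition Omega' :: "idx set" where
  "Omega' = UNIV - Omega0"

text \<open>Which vectors an equation involves is a property of the formal equation, so equations are
  represented syntactically: \<open>Eqn us v us' v'\<close> is the equation
  \<open>(\<Sum>(c,u)\<leftarrow>us. c h\<^sub>u, h\<^sub>v) = (\<Sum>(c,u)\<leftarrow>us'. c h\<^sub>u, h\<^sub>v\<^sub>')\<close>.\<close>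

datatype eqn = Eqn "(complex \<times> idx) list" idx "(complex \<times> idx) list" idx

fun eqn_vectors :: "eqn \<Rightarrow> idx set" where
  "eqn_vectors (Eqn us v us' v') = snd ` set us \<union> {v} \<union> snd ` set us' \<union> {v'}"

text \<open>Truth of an equation when \<open>sp u v\<close> is the value of the scalar product \<open>(h\<^sub>u, h\<^sub>v)\<close>.\<close>

fun eqn_holds :: "(idx \<Rightarrow> idx \<Rightarrow> complex) \<Rightarrow> eqn \<Rightarrow> bool" where
  "eqn_holds sp (Eqn us v us' v') \<longleftrightarrow>
     (\<Sum>(c, u)\<leftarrow>us. c * sp u v) = (\<Sum>(c, u)\<leftarrow>us'. c * sp u v')"

inductive_set equations :: "eqn set" where
  E1: "Eqn [(1, (m + 1, k, l, n, r, t)), (\<i>, (m, k, l, n, r, t))] v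
           [(1, (m, k + 1, l, n, r, t))] v \<in> equations"
| E2: "Eqn [(1, (m + 1, k, l, n, r, t)), (- \<i>, (m, k, l, n, r, t))] v
           [(1, (m, k, l + 1, n, r, t))] v \<in> equations"
| E3: "Eqn [(1, (m, k, l, n + 1, r, t)), (\<i>, (m, k, l, n, r, t))] v
           [(1, (m, k, l, n, r + 1, t))] v \<in> equations"
| E4: "Eqn [(1, (m, k, l, n + 1, r, t)), (- \<i>, (m, k, l, n, r, t))] v
           [(1, (m, k, l, n, r, t + 1))] v \<in> equations"
| E5: "m + m' = mt + mt' \<Longrightarrow>
       Eqn [(1, (m, k, l, n, r, t))] (m', k', l', n', r', t')
           [(1, (mt, k, l, n, r, t))] (mt', k', l', n', r', t') \<in> equations"
| E6: "k + l' = kt + lt' \<Longrightarrow>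
       Eqn [(1, (m, k, l, n, r, t))] (m', k', l', n', r', t')
           [(1, (m, kt, l, n, r, t))] (m', k', lt', n', r', t') \<in> equations"
| E7: "l + k' = lt + kt' \<Longrightarrow>
       Eqn [(1, (m, k, l, n, r, t))] (m', k', l', n', r', t')
           [(1, (m, k, lt, n, r, t))] (m', kt', l', n', r', t') \<in> equations"
| E8: "n + n' = nt + nt' \<Longrightarrow>
       Eqn [(1, (m, k, l, n, r, t))] (m', k', l', n', r', t')
           [(1, (m, k, l, nt, r, t))] (m', k', l', nt', r', t') \<in> equations"
| E9: "r + t' = rt + tt' \<Longrightarrow>
       Eqn [(1, (m, k, l, n, r, t))] (m', k', l', n', r', t')
           [(1, (m, k, l, n, rt, t))] (m', k', l', n', r', tt') \<in> equations"
| E10: "t + r' = tt + rt' \<Longrightarrow>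
       Eqn [(1, (m, k, l, n, r, t))] (m', k', l', n', r', t')
           [(1, (m, k, l, n, r, tt))] (m', k', l', n', rt', t') \<in> equations"


section \<open>Model space and auxiliary choices\<close>

text \<open>The orthogonal sum is internal: \<open>H0\<close> and the \<open>Hs j\<close> are subspaces of the ambient
  Hilbert space. Only the indices \<open>j \<ge> 1\<close> of \<open>Hs\<close> and \<open>e\<close> are used.\<close>

definition model_space ::
  "(nat \<Rightarrow> nat \<Rightarrow> complex) \<Rightarrow> 'h::chilbert_space set \<Rightarrow> (nat \<Rightarrow> 'h set) \<Rightarrow>
   (nat \<Rightarrow> nat \<Rightarrow> 'h) \<Rightarrow> (nat \<Rightarrow> 'h) \<Rightarrow> bool" where
  "model_space s H0 Hs h e \<longleftrightarrow>
     H0 = closure (cspan {h m n | m n. True}) \<and>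
     (\<forall>m n m' n'. cinner (h m n) (h m' n') = s (m + m') (n + n')) \<and>
     (\<forall>j\<ge>1. csubspace (Hs j) \<and> cdim (Hs j) = 1) \<and>
     (\<forall>j\<ge>1. \<forall>x\<in>H0. \<forall>y\<in>Hs j. cinner x y = 0) \<and>
     (\<forall>i\<ge>1. \<forall>j\<ge>1. i \<noteq> j \<longrightarrow> (\<forall>x\<in>Hs i. \<forall>y\<in>Hs j. cinner x y = 0)) \<and>
     closure (cspan (H0 \<union> (\<Union>j\<in>{1..}. Hs j))) = UNIV \<and>
     (\<forall>j\<ge>1. e j \<in> Hs j \<and> norm (e j) = 1)"

text \<open>Gram--Schmidt process for a sequence \<open>x\<close>. The value is \<open>0\<close> where \<open>x i\<close> depends linearly on
  its predecessors (\<open>sgn u\<close> is \<open>u / \<parallel>u\<parallel>\<close>, and \<open>0\<close> for \<open>u = 0\<close>); such entries contribute nothing to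
  later sums.\<close>

function gram_schmidt_raw :: "(nat \<Rightarrow> 'h::chilbert_space) \<Rightarrow> nat \<Rightarrow> 'h" where
  "gram_schmidt_raw x i =
     sgn (x i - (\<Sum>j\<in>{..<i}. cinner (x i) (gram_schmidt_raw x j) *\<^sub>C gram_schmidt_raw x j))"
  by pat_completeness auto
termination by (relation "Wellfounded.measure snd") auto
declare gram_schmidt_raw.simps [simp del]

definition gs_support :: "(nat \<Rightarrow> 'h::chilbert_space) \<Rightarrow> nat set" where
  "gs_support x = {i. gram_schmidt_raw x i \<noteq> 0}"

text \<open>The resulting orthonormal basis \<open>g\<^sub>1, g\<^sub>2, \<dots>\<close>, with the zero entries dropped, and its index
  set \<open>{1..dim}\<close> or \<open>{1..}\<close>; the dimension is the number of nonzero entries.\<close>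

definition gs_basis :: "(nat \<Rightarrow> 'h::chilbert_space) \<Rightarrow> nat \<Rightarrow> 'h" where
  "gs_basis x n = gram_schmidt_raw x (enumerate (gs_support x) (n - 1))"

definition gs_index :: "(nat \<Rightarrow> 'h::chilbert_space) \<Rightarrow> nat set" where
  "gs_index x = {n. 1 \<le> n \<and> (finite (gs_support x) \<longrightarrow> n \<le> card (gs_support x))}"

text \<open>The bounds \<open>M\<^sub>j\<close>. The integral is the extended nonnegative one, so that the bound
  entails its existence.\<close>

definition moment_bounds :: "(nat \<Rightarrow> nat \<Rightarrow> complex) \<Rightarrow> (nat \<Rightarrow> idx) \<Rightarrow> (nat \<Rightarrow> real) \<Rightarrow> bool" where
  "moment_bounds s w M \<longleftrightarrow>
     (\<forall>j\<ge>1. M j > 0 \<and>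
       (case w j of (m, k, l, n, r, t) \<Rightarrow>
         \<forall>\<mu>. plane_moment_solution s \<mu> \<longrightarrow>
           (\<integral>\<^sup>+(x1, x2). ennreal (x1 ^ (2 * m) * (x1\<^sup>2 + 1) powi (k + l) *
                                x2 ^ (2 * n) * (x2\<^sup>2 + 1) powi (r + t)) \<partial>\<mu>) \<le> ennreal (M j)))"


section \<open>The algorithm\<close>

text \<open>Throughout, \<open>w\<close> is the enumeration of \<open>Omega'\<close>, \<open>h\<close> the given family in \<open>H0\<close>, \<open>p\<close> the arrangement
  of its index pairs in a single sequence, \<open>e\<close> the unit vectors and \<open>M\<close> the bounds.
  A tuple \<open>(x\<^sub>1, \<dots>, x\<^sub>q)\<close> is an element of \<open>{1..q} \<rightarrow>\<^sub>E UNIV\<close>.\<close>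

fun initial_vec :: "(nat \<Rightarrow> nat \<Rightarrow> 'h) \<Rightarrow> idx \<Rightarrow> 'h" where
  "initial_vec h (m, k, l, n, r, t) = h m n"

definition step0_check :: "(nat \<Rightarrow> nat \<Rightarrow> 'h::chilbert_space) \<Rightarrow> bool" where
  "step0_check h \<longleftrightarrow> (\<forall>E\<in>equations. eqn_vectors E \<subseteq> Omega0 \<longrightarrow>
     eqn_holds (\<lambda>u v. cinner (initial_vec h u) (initial_vec h v)) E)"

definition algorithm_vec ::
  "(nat \<Rightarrow> idx) \<Rightarrow> (nat \<Rightarrow> nat \<Rightarrow> 'h) \<Rightarrow> (nat \<Rightarrow> 'h) \<Rightarrow> idx \<Rightarrow> 'h" where
  "algorithm_vec w h hs v =
     (if v \<in> Omega0 then initial_vec h v else hs (the_inv_into {1..} w v))"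

definition step_equations :: "(nat \<Rightarrow> idx) \<Rightarrow> nat \<Rightarrow> eqn set" where
  "step_equations w q =
     {E \<in> equations. w q \<in> eqn_vectors E \<and> eqn_vectors E \<subseteq> Omega0 \<union> w ` {1..q}}"

text \<open>Scalar products at step \<open>q\<close> in terms of the unknowns: \<open>y\<close> is \<open>h\<^bsub>w(q)\<^esub>\<close> without its \<open>e\<^sub>q\<close>-component,
  which is orthogonal to all earlier vectors and enters only through \<open>d\<close>, the value of
  \<open>(h\<^bsub>w(q)\<^esub>, h\<^bsub>w(q)\<^esub>)\<close>.\<close>

definition step_sprod ::
  "(nat \<Rightarrow> idx) \<Rightarrow> (nat \<Rightarrow> nat \<Rightarrow> 'h::chilbert_space) \<Rightarrow> nat \<Rightarrow> (nat \<Rightarrow> 'h) \<Rightarrow> 'h \<Rightarrow> real \<Rightarrow>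
   idx \<Rightarrow> idx \<Rightarrow> complex" where
  "step_sprod w h q hs y d u v =
     (if u = w q \<and> v = w q then complex_of_real d
      else cinner (algorithm_vec w h (hs(q := y)) u) (algorithm_vec w h (hs(q := y)) v))"

definition h_sequence :: "(nat \<Rightarrow> nat \<Rightarrow> 'h) \<Rightarrow> (nat \<Rightarrow> nat \<times> nat) \<Rightarrow> nat \<Rightarrow> 'h" where
  "h_sequence h p i = (case p i of (m, n) \<Rightarrow> h m n)"

definition partial_vec ::
  "(nat \<Rightarrow> nat \<Rightarrow> 'h::chilbert_space) \<Rightarrow> (nat \<Rightarrow> nat \<times> nat) \<Rightarrow> (nat \<Rightarrow> 'h) \<Rightarrow> nat \<Rightarrow>
   (nat \<Rightarrow> complex) \<Rightarrow> (nat \<Rightarrow> complex) \<Rightarrow> 'h" where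
  "partial_vec h p e q \<alpha> \<beta> =
     (\<Sum>\<^sub>\<infinity>n\<in>gs_index (h_sequence h p). \<alpha> n *\<^sub>C gs_basis (h_sequence h p) n) +
     (\<Sum>j\<in>{1..<q}. \<beta> j *\<^sub>C e j)"

definition coeff_norm2 ::
  "(nat \<Rightarrow> nat \<Rightarrow> 'h::chilbert_space) \<Rightarrow> (nat \<Rightarrow> nat \<times> nat) \<Rightarrow> nat \<Rightarrow>
   (nat \<Rightarrow> complex) \<Rightarrow> (nat \<Rightarrow> complex) \<Rightarrow> real" where
  "coeff_norm2 h p q \<alpha> \<beta> =
     (\<Sum>\<^sub>\<infinity>n\<in>gs_index (h_sequence h p). (cmod (\<alpha> n))\<^sup>2) + (\<Sum>j\<in>{1..<q}. (cmod (\<beta> j))\<^sup>2)"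

text \<open>\<open>S_set w h p e q G\<close> is \<open>S\<^sub>q\<close> when \<open>G\<close> is \<open>G\<^bsub>q-1\<^esub>\<close>. Square summability of \<open>\<alpha>\<close> is what makes
  \<open>\<Sum>\<^sub>n \<alpha>\<^sub>n g\<^sub>n\<close> a vector.\<close>

definition S_set ::
  "(nat \<Rightarrow> idx) \<Rightarrow> (nat \<Rightarrow> nat \<Rightarrow> 'h::chilbert_space) \<Rightarrow> (nat \<Rightarrow> nat \<times> nat) \<Rightarrow> (nat \<Rightarrow> 'h) \<Rightarrow>
   nat \<Rightarrow> (nat \<Rightarrow> 'h) set \<Rightarrow> ((nat \<Rightarrow> complex) \<times> (nat \<Rightarrow> complex) \<times> real \<times> (nat \<Rightarrow> 'h)) set" where
  "S_set w h p e q G =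
     {(\<alpha>, \<beta>, d, hs).
        \<alpha> \<in> gs_index (h_sequence h p) \<rightarrow>\<^sub>E UNIV \<and>
        (\<lambda>n. (cmod (\<alpha> n))\<^sup>2) summable_on gs_index (h_sequence h p) \<and>
        \<beta> \<in> {1..<q} \<rightarrow>\<^sub>E UNIV \<and>
        hs \<in> G \<and>
        (\<forall>E\<in>step_equations w q. eqn_holds (step_sprod w h q hs (partial_vec h p e q \<alpha> \<beta>) d) E)}"

definition S_hat ::
  "(nat \<Rightarrow> idx) \<Rightarrow> (nat \<Rightarrow> nat \<Rightarrow> 'h::chilbert_space) \<Rightarrow> (nat \<Rightarrow> nat \<times> nat) \<Rightarrow> (nat \<Rightarrow> 'h) \<Rightarrow>
   (nat \<Rightarrow> real) \<Rightarrow> nat \<Rightarrow> (nat \<Rightarrow> 'h) set \<Rightarrow>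
   ((nat \<Rightarrow> complex) \<times> (nat \<Rightarrow> complex) \<times> real \<times> (nat \<Rightarrow> 'h)) set" where
  "S_hat w h p e M q G =
     {(\<alpha>, \<beta>, d, hs) \<in> S_set w h p e q G. coeff_norm2 h p q \<alpha> \<beta> \<le> d \<and> d \<le> M q}"

text \<open>\<open>G_set w h p e M 0\<close> contains just the empty tuple.\<close>

primrec G_set ::
  "(nat \<Rightarrow> idx) \<Rightarrow> (nat \<Rightarrow> nat \<Rightarrow> 'h::chilbert_space) \<Rightarrow> (nat \<Rightarrow> nat \<times> nat) \<Rightarrow> (nat \<Rightarrow> 'h) \<Rightarrow>
   (nat \<Rightarrow> real) \<Rightarrow> nat \<Rightarrow> (nat \<Rightarrow> 'h) set" where
  "G_set w h p e M 0 = {1..0} \<rightarrow>\<^sub>E UNIV"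
| "G_set w h p e M (Suc q) =
     {hs(Suc q := partial_vec h p e (Suc q) \<alpha> \<beta> +
                  sqrt (d - coeff_norm2 h p (Suc q) \<alpha> \<beta>) *\<^sub>R e (Suc q)) | \<alpha> \<beta> d hs.
        (\<alpha>, \<beta>, d, hs) \<in> S_hat w h p e M (Suc q) (G_set w h p e M q)}"

text \<open>The space \<open>\<^bold>H\<close> of sequences \<open>(h\<^sub>1, h\<^sub>2, \<dots>)\<close> with finite norm, and the sets \<open>\<^bold>G\<^sub>q\<close> and \<open>\<^bold>G\<close>.\<close>

definition bold_H :: "(nat \<Rightarrow> real) \<Rightarrow> (nat \<Rightarrow> 'h::chilbert_space) set" where
  "bold_H M = {v \<in> {1..} \<rightarrow>\<^sub>E UNIV. bdd_above ((\<lambda>q. M q powr (- 1 / 2) * norm (v q)) ` {1..})}"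

definition bold_G_step ::
  "(nat \<Rightarrow> idx) \<Rightarrow> (nat \<Rightarrow> nat \<Rightarrow> 'h::chilbert_space) \<Rightarrow> (nat \<Rightarrow> nat \<times> nat) \<Rightarrow> (nat \<Rightarrow> 'h) \<Rightarrow>
   (nat \<Rightarrow> real) \<Rightarrow> nat \<Rightarrow> (nat \<Rightarrow> 'h) set" where
  "bold_G_step w h p e M q =
     {v \<in> bold_H M. restrict v {1..q} \<in> G_set w h p e M q \<and> (\<forall>j>q. norm (v j) \<le> sqrt (M j))}"

definition bold_G ::
  "(nat \<Rightarrow> idx) \<Rightarrow> (nat \<Rightarrow> nat \<Rightarrow> 'h::chilbert_space) \<Rightarrow> (nat \<Rightarrow> nat \<times> nat) \<Rightarrow> (nat \<Rightarrow> 'h) \<Rightarrow>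
   (nat \<Rightarrow> real) \<Rightarrow> (nat \<Rightarrow> 'h) set" where
  "bold_G w h p e M = (\<Inter>q\<in>{1..}. bold_G_step w h p e M q)"

end

theory Submission
  imports Defs "HOL-Probability.Probability" "HOL-Real_Asymp.Real_Asymp"
begin

text \<open>In the coordinates \<open>x\<^sub>1 = Re z\<close>, \<open>x\<^sub>2 = Im z\<close> the complex moment problem becomes the plane moment problem.
  If \<open>\<mu>\<close> solves the latter, let \<open>f\<close> with index \<open>(m,k,l;n,r,t)\<close> be the function
  \<open>x\<^sub>1\<^sup>m (x\<^sub>1 + i)\<^sup>k (x\<^sub>1 - i)\<^sup>l x\<^sub>2\<^sup>n (x\<^sub>2 + i)\<^sup>r (x\<^sub>2 - i)\<^sup>t\<close>; the Gram matrix of these functions in \<open>L\<^sup>2(\<mu>)\<close>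
  satisfies all the equations, and the algorithm can be run so as to produce vectors with the same Gram matrix:
  the component of the next vector along the earlier ones comes from the Riesz representation theorem.

  Conversely, vectors satisfying all the equations have scalar products that depend only on the sum
  of one index and the conjugate of the other, so that the vectors with \<open>m = n = 0\<close>, \<open>l = -k\<close>, \<open>t = -r\<close>, which
  correspond to the monomials in the Cayley transforms of \<open>x\<^sub>1\<close> and \<open>x\<^sub>2\<close>, define a positive definite function
  on \<open>\<int>\<^sup>2\<close>. It is the Fourier transform of a measure on the torus (a weak limit of discrete Fejer sums;
  the torus is covered by a curve, so that compactness is needed only on the line). As every vector lies in
  the range of \<open>1 - U\<close> for both Cayley transforms \<open>U\<close>, the mean ergodic theorem shows that the measure does
  not charge the points at infinity, and that the correspondence of vectors and functions extends from
  trigonometric polynomials to all indices.\<close>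

section \<open>A continuous map of the line covering the unit square\<close>

text \<open>With z = (x - i)/(x + i), a function of degree \<open>m + k + l\<close> at most 0 in x
  is a Laurent polynomial in z, so algebra alone carries the correspondence of vectors and functions
  that far. Functions of positive degree are unbounded, and their square integrability has to be
  proved. Moreover z = 1 stands for x = infinity, and a measure on the torus might have mass there.
  One identity settles both: 2i f = (x + i) f - (x - i) f. It makes every vector a difference v_0 -
  v_1 along an orbit v_j of constant norm, so that Cesaro means over the orbit telescope to 0. Hence
  the degree can be raised by one unit at a time, in one variable and then in the other.

  In the opposite direction one solution is fixed for the whole run. Any prefix with the Gram matrix
  of that solution can be continued: only scalar products with earlier vectors and the norm are
  prescribed, and the norm still missing is placed on the fresh axis e_q.\<close>

definition bdigit :: "nat \<Rightarrow> real \<Rightarrow> int" where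
  "bdigit i x = \<lfloor>2 ^ Suc i * x\<rfloor> mod 2"

lemma floor_pow2_Suc: "\<lfloor>2 ^ Suc i * x\<rfloor> = 2 * \<lfloor>2 ^ i * x\<rfloor> + bdigit i (x::real)"
proof -
  have "\<lfloor>2 * (2 ^ i * x)\<rfloor> div 2 = \<lfloor>2 ^ i * x\<rfloor>"
    using floor_divide_real_eq_div[of 2 "2 * (2 ^ i * x)"] by simp
  then show ?thesis unfolding bdigit_def
    by (metis mult.assoc mult_div_mod_eq power_Suc)
qed

text \<open>The first n digits rebuild the integer part of 2^n x, starting from 0 because the points
  lie in [0,1).\<close>

lemma bdigit_determines:
  assumes "x \<in> {0..<1}" "y \<in> {0..<1}" "\<And>i. i < n \<Longrightarrow> bdigit i x = bdigit i y"
  shows "\<bar>x - y\<bar> \<le> (1/2) ^ n"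
proof -
  have "\<lfloor>2 ^ n * x\<rfloor> = \<lfloor>2 ^ n * y\<rfloor>"
    using assms(3)
  proof (induction n)
    case 0
    have "\<lfloor>x\<rfloor> = 0" "\<lfloor>y\<rfloor> = 0" using assms(1,2) by (simp_all add: floor_eq_iff)
    then show ?case by simp
  next
    case (Suc n)
    then show ?case by (simp only: floor_pow2_Suc)
  qed
  then have "\<bar>2 ^ n * x - 2 ^ n * y\<bar> < 1" by linarith
  then have "2 ^ n * \<bar>x - y\<bar> \<le> 1"
    by (simp add: abs_mult flip: right_diff_distrib)
  then show ?thesis by (simp add: field_simps power_divide)
qed

text \<open>The base-four digits combining one binary digit of each coordinate are read in base eight; the
  gaps in the resulting Cantor set make the inverse map uniformly continuous.\<close>

definition interleave :: "real \<times> real \<Rightarrow> real" where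
  "interleave z = (\<Sum>i. of_int (bdigit i (fst z) + 2 * bdigit i (snd z)) / 8 ^ i)"

lemma digit_bounds: "0 \<le> bdigit i x + 2 * bdigit i y" "bdigit i x + 2 * bdigit i y \<le> 3"
proof -
  have "0 \<le> bdigit i x" "bdigit i x < 2" "0 \<le> bdigit i y" "bdigit i y < 2"
    unfolding bdigit_def by simp_all
  then show "0 \<le> bdigit i x + 2 * bdigit i y" "bdigit i x + 2 * bdigit i y \<le> 3" by linarith+
qed

lemma summable_8: "summable (\<lambda>i. of_int (bdigit i x + 2 * bdigit i y) / (8::real) ^ i)"
proof (rule summable_comparison_test')
  show "summable (\<lambda>i. 3 * (1/8::real) ^ i)"
    by (intro summable_mult summable_geometric) simp
  show "norm (of_int (bdigit i x + 2 * bdigit i y) / (8::real) ^ i) \<le> 3 * (1/8) ^ i" for i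
  proof -
    have "\<bar>of_int (bdigit i x + 2 * bdigit i y)\<bar> \<le> (3::real)"
      using digit_bounds[of i x y] by linarith
    then show ?thesis by (simp add: power_divide field_simps abs_mult)
  qed
qed

text \<open>The series is at most 3 * 8/7 = 24/7; the bound 4 is a rounding of it.\<close>

lemma interleave_range: "interleave z \<in> {0..4}"
proof -
  let ?f = "\<lambda>i. of_int (bdigit i (fst z) + 2 * bdigit i (snd z)) / (8::real) ^ i"
  have "0 \<le> suminf ?f"
    by (intro suminf_nonneg summable_8) (simp add: digit_bounds(1) flip: of_int_add of_int_mult del: of_int_add)
  moreover have "suminf ?f \<le> (\<Sum>i. 3 * (1/8::real) ^ i)"
  proof (intro suminf_le summable_8 summable_mult summable_geometric)
    fix i
    have "of_int (bdigit i (fst z) + 2 * bdigit i (snd z)) \<le> (3::real)"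
      using digit_bounds(2)[of i "fst z" "snd z"] by linarith
    then have "?f i \<le> 3 / 8 ^ i" by (intro divide_right_mono) auto
    then show "?f i \<le> 3 * (1/8) ^ i" by (simp add: power_divide)
  qed simp
  moreover have "(\<Sum>i. 3 * (1/8::real) ^ i) = 3 * (1 / (1 - 1/8))"
    by (subst suminf_mult) (auto simp: suminf_geometric)
  ultimately show ?thesis by (simp add: interleave_def)
qed

text \<open>The first nonzero term has size at least 1/8^n and the tail at most (3/7)/8^n, which
  leaves 4/7 > 1/2. In base four the tail could cancel the leading term completely, which is why
  base eight is used.\<close>

lemma octal_separation:
  fixes d :: "nat \<Rightarrow> int"
  assumes sm: "summable (\<lambda>i. of_int (d i) / (8::real) ^ i)"
    and bd: "\<And>i. \<bar>d i\<bar> \<le> 3" and z: "\<And>i. i < n \<Longrightarrow> d i = 0" and nz: "d n \<noteq> 0"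
  shows "\<bar>\<Sum>i. of_int (d i) / (8::real) ^ i\<bar> \<ge> (1/2) / 8 ^ n"
proof -
  let ?f = "\<lambda>i. of_int (d i) / (8::real) ^ i"
  have sm': "summable (\<lambda>i. ?f (i + Suc n))" using sm by (rule summable_ignore_initial_segment)
  have "suminf ?f = (\<Sum>i. ?f (i + Suc n)) + (\<Sum>i<Suc n. ?f i)"
    using suminf_split_initial_segment[OF sm] .
  also have "(\<Sum>i<Suc n. ?f i) = ?f n" using z by simp
  finally have 1: "suminf ?f = (\<Sum>i. ?f (i + Suc n)) + ?f n" .
  have b: "norm (?f (i + Suc n)) \<le> 3 / 8 ^ Suc n * (1/8) ^ i" for i
  proof -
    have "\<bar>of_int (d (i + Suc n))\<bar> \<le> (3::real)" using bd[of "i + Suc n"] by linarith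
    then show ?thesis by (simp add: power_divide field_simps power_add)
  qed
  have sg: "summable (\<lambda>i. 3 / 8 ^ Suc n * (1/8::real) ^ i)"
    by (intro summable_mult summable_geometric) simp
  have "norm (\<Sum>i. ?f (i + Suc n)) \<le> (\<Sum>i. norm (?f (i + Suc n)))"
    by (rule summable_norm, rule summable_comparison_test'[OF sg]) (use b in auto)
  also have "\<dots> \<le> (\<Sum>i. 3 / 8 ^ Suc n * (1/8::real) ^ i)"
    by (intro suminf_le b sg, rule summable_comparison_test'[OF sg]) (use b in auto)
  also have "\<dots> = 3 / 8 ^ Suc n * (1 / (1 - 1/8))"
    by (subst suminf_mult) (auto simp: suminf_geometric)
  finally have "\<bar>\<Sum>i. ?f (i + Suc n)\<bar> \<le> (3/7) / 8 ^ n" by simp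
  moreover have "\<bar>?f n\<bar> \<ge> 1 / 8 ^ n"
  proof -
    have "\<bar>of_int (d n)\<bar> \<ge> (1::real)" using nz by linarith
    then show ?thesis by (simp add: field_simps)
  qed
  ultimately have "\<bar>suminf ?f\<bar> \<ge> 1 / 8 ^ n - (3/7) / 8 ^ n" using 1 by linarith
  moreover have "1 / 8 ^ n - (3/7) / 8 ^ n = (4/7) / (8::real) ^ n" by (simp add: field_simps)
  moreover have "(4/7) / (8::real) ^ n \<ge> (1/2) / 8 ^ n" by (intro divide_right_mono) auto
  ultimately show ?thesis by linarith
qed

text \<open>Values closer than the gap of level n cannot differ in a digit before position n, so the
  first n bits of both coordinates agree. The two bits are the remainder and the quotient of the
  combined digit by 2.\<close>

lemma interleave_close:
  assumes "z \<in> {0..<1} \<times> {0..<1}" "z' \<in> {0..<1} \<times> {0..<1}"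
    "\<bar>interleave z - interleave z'\<bar> < (1/2) / 8 ^ n"
  shows "dist z z' \<le> 2 * (1/2) ^ n"
proof -
  let ?d = "\<lambda>z i. bdigit i (fst z) + 2 * bdigit i (snd z)"
  have eq: "?d z i = ?d z' i" if "i < n" for i
  proof (rule ccontr)
    assume "?d z i \<noteq> ?d z' i"
    define k where "k = (LEAST i. ?d z i - ?d z' i \<noteq> 0)"
    have k1: "?d z k - ?d z' k \<noteq> 0" unfolding k_def
      by (rule LeastI[of _ i]) (use \<open>?d z i \<noteq> ?d z' i\<close> in simp)
    have k2: "?d z j - ?d z' j = 0" if "j < k" for j
      using not_less_Least that unfolding k_def by blast
    have "k \<le> i" unfolding k_def by (rule Least_le) (use \<open>?d z i \<noteq> ?d z' i\<close> in simp)
    have sm: "summable (\<lambda>i. of_int (?d z i - ?d z' i) / (8::real) ^ i)"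
      using summable_diff[OF summable_8[of "fst z" "snd z"] summable_8[of "fst z'" "snd z'"]]
      by (simp add: diff_divide_distrib add_divide_distrib)
    have "(1/2) / 8 ^ k \<le> \<bar>\<Sum>i. of_int (?d z i - ?d z' i) / (8::real) ^ i\<bar>"
    proof (rule octal_separation[OF sm])
      show "\<bar>?d z i - ?d z' i\<bar> \<le> 3" for i
        using digit_bounds[of i "fst z" "snd z"] digit_bounds[of i "fst z'" "snd z'"] by linarith
    qed (use k1 k2 in auto)
    also have "(\<Sum>i. of_int (?d z i - ?d z' i) / (8::real) ^ i) = interleave z - interleave z'"
      unfolding interleave_def
      by (subst suminf_diff[OF summable_8 summable_8]) (simp add: diff_divide_distrib)
    finally have "(1/2) / 8 ^ k \<le> \<bar>interleave z - interleave z'\<bar>" .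
    moreover have "(1/2) / (8::real) ^ n \<le> (1/2) / 8 ^ k"
      using \<open>k \<le> i\<close> \<open>i < n\<close> by (intro divide_left_mono power_increasing) auto
    ultimately show False using assms(3) by linarith
  qed
  have m2: "bdigit i x = (bdigit i x + 2 * bdigit i y) mod 2"
    "bdigit i y = (bdigit i x + 2 * bdigit i y) div 2" for i x y
    by (auto simp: bdigit_def)
  have "\<bar>fst z - fst z'\<bar> \<le> (1/2) ^ n"
    by (rule bdigit_determines) (use assms eq m2 in \<open>auto, metis\<close>)
  moreover have "\<bar>snd z - snd z'\<bar> \<le> (1/2) ^ n"
    by (rule bdigit_determines) (use assms eq m2 in \<open>auto, metis\<close>)
  moreover have "dist z z' \<le> dist (fst z) (fst z') + dist (snd z) (snd z')"
    unfolding dist_prod_def by (rule sqrt_sum_squares_le_sum) auto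
  ultimately show ?thesis by (simp add: dist_real_def)
qed

lemma inj_on_interleave: "inj_on interleave ({0..<1} \<times> {0..<1})"
proof (rule inj_onI)
  fix z z' assume z: "z \<in> {0..<1::real} \<times> {0..<1::real}" "z' \<in> {0..<1} \<times> {0..<1}" and "interleave z = interleave z'"
  then have "dist z z' \<le> 2 * (1/2) ^ n" for n
    by (intro interleave_close) auto
  moreover have "(\<lambda>n. 2 * (1/2::real) ^ n) \<longlonglongrightarrow> 0"
    by (intro tendsto_mult_right_zero LIMSEQ_power_zero) simp
  ultimately have "dist z z' \<le> 0" by (meson LIMSEQ_le_const)
  then show "z = z'" by simp
qed

text \<open>The inverse of \<open>interleave\<close> is uniformly continuous on its image, so it
  extends to the closure, and from there to the line by Tietze. The half-open square is enough
  because its points will serve as pairs of angles modulo full turns.\<close>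

lemma continuous_cover_unit_square:
  obtains \<phi> :: "real \<Rightarrow> real \<times> real"
  where "continuous_on UNIV \<phi>" "\<And>z. z \<in> {0..<1} \<times> {0..<1} \<Longrightarrow> \<exists>t\<in>{0..4}. \<phi> t = z"
proof -
  let ?Q = "{0..<1::real} \<times> {0..<1::real}"
  let ?g = "the_inv_into ?Q interleave"
  have g: "?g (interleave z) = z" if "z \<in> ?Q" for z
    using the_inv_into_f_f[OF inj_on_interleave that] .
  have uc: "uniformly_continuous_on (interleave ` ?Q) ?g"
    unfolding uniformly_continuous_on_def
  proof (intro allI impI)
    fix \<epsilon> :: real assume "\<epsilon> > 0"
    then obtain n where n: "(1/2) ^ n < \<epsilon> / 2"
      using real_arch_pow_inv[of "\<epsilon> / 2" "1/2"] by auto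
    show "\<exists>d>0. \<forall>x\<in>interleave ` ?Q. \<forall>x'\<in>interleave ` ?Q. dist x' x < d \<longrightarrow> dist (?g x') (?g x) < \<epsilon>"
    proof (intro exI[of _ "(1/2) / 8 ^ n"] conjI ballI impI)
      fix x x' assume x: "x \<in> interleave ` ?Q" "x' \<in> interleave ` ?Q" and d: "dist x' x < (1/2) / 8 ^ n"
      obtain z z' where z: "z \<in> ?Q" "x = interleave z" "z' \<in> ?Q" "x' = interleave z'" using x by blast
      have "dist z' z \<le> 2 * (1/2) ^ n"
        by (rule interleave_close) (use z d in \<open>simp_all add: dist_real_def\<close>)
      with n show "dist (?g x') (?g x) < \<epsilon>" using z g by simp
    qed simp
  qed
  obtain g' where g': "uniformly_continuous_on (closure (interleave ` ?Q)) g'"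
    "\<And>x. x \<in> interleave ` ?Q \<Longrightarrow> ?g x = g' x"
    using uniformly_continuous_on_extension_on_closure[OF uc] by metis
  have "continuous_on (closure (interleave ` ?Q)) g'"
    using g'(1) uniformly_continuous_imp_continuous by blast
  then obtain \<phi> where \<phi>: "continuous_on UNIV \<phi>" "\<And>x. x \<in> closure (interleave ` ?Q) \<Longrightarrow> \<phi> x = g' x"
    by (rule Tietze_unbounded[of _ _ UNIV]) auto
  show ?thesis
  proof
    fix z assume z: "z \<in> ?Q"
    then have "\<phi> (interleave z) = z"
      using \<phi>(2)[of "interleave z"] g'(2)[of "interleave z"] g closure_subset by (metis image_eqI subsetD)
    then show "\<exists>t\<in>{0..4}. \<phi> t = z" using interleave_range by blast
  qed (fact \<phi>(1))
qed

section \<open>The trigonometric moment problem on the torus\<close>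

lemma sum_cis_roots:
  fixes d :: int
  assumes "\<bar>d\<bar> < int n"
  shows "(\<Sum>j<n. cis (2 * pi * real j * of_int d / n)) = (if d = 0 then of_nat n else 0)"
proof (cases "d = 0")
  case False
  have n: "n > 0" using assms by linarith
  let ?z = "cis (2 * pi * of_int d / n)"
  have "?z \<noteq> 1"
  proof
    assume "?z = 1"
    then obtain k :: int where "2 * pi * of_int d / n = of_int (2 * k) * pi"
      unfolding cis_conv_exp exp_eq_1 by auto
    then have "(2 * pi) * (of_int d / n) = (2 * pi) * of_int k" by simp
    then have "real_of_int d / n = of_int k" by (subst (asm) mult_cancel_left) simp
    then have "real_of_int d = of_int (k * int n)" using n by (simp add: divide_eq_eq)
    then have "d = k * int n" by (simp only: of_int_eq_iff)
    then have "int n dvd d" by simp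
    then show False using assms False zdvd_not_zless[of "\<bar>d\<bar>" "int n"] by auto
  qed
  moreover have "?z ^ n = 1"
  proof -
    have "?z ^ n = cis (2 * pi * of_int d)" using n by (simp add: Complex.DeMoivre)
    then show ?thesis by simp
  qed
  moreover have "(\<Sum>j<n. cis (2 * pi * real j * of_int d / n)) = (\<Sum>j<n. ?z ^ j)"
    by (intro sum.cong refl) (simp add: Complex.DeMoivre mult_ac)
  ultimately show ?thesis using False by (simp add: geometric_sum)
qed simp

text \<open>The Fejer coefficient: the number of ways to write s as a difference of two elements of
  {0..N-1}. Truncated subtraction gives the correct value 0 for |s| \<ge> N.\<close>

lemma card_int_diff_eq:
  fixes s :: int
  shows "(\<Sum>a<N. \<Sum>a'<N. if s = int a - int a' then 1 else (0::complex)) = of_nat (N - nat \<bar>s\<bar>)"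
proof -
  have "(\<Sum>a'<N. if s = int a - int a' then 1 else (0::complex)) =
     (if int a - s \<in> {0..<int N} then 1 else 0)" for a
  proof -
    have "(\<Sum>a'<N. if s = int a - int a' then 1 else (0::complex)) =
        (\<Sum>a'\<in>{..<N}. if a' = nat (int a - s) then (if s \<le> int a then 1 else 0) else 0)"
      by (intro sum.cong refl) auto
    then show ?thesis by (auto simp: sum.delta)
  qed
  then have "(\<Sum>a<N. \<Sum>a'<N. if s = int a - int a' then 1 else (0::complex))
      = of_nat (card {a\<in>{..<N}. int a - s \<in> {0..<int N}})"
    by (simp add: sum.If_cases Int_def)
  also have "{a\<in>{..<N}. int a - s \<in> {0..<int N}} = {nat s..<N - nat (- s)}" by auto
  also have "card \<dots> = N - nat \<bar>s\<bar>" by simp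
  finally show ?thesis .
qed

lemma sum_swap_pairs:
  "(\<Sum>j\<in>J. \<Sum>k\<in>K. \<Sum>a\<in>A. \<Sum>b\<in>B. \<Sum>a'\<in>A'. \<Sum>b'\<in>B'. (F j a a' * G k b b' * C a b a' b' :: complex)) =
   (\<Sum>a\<in>A. \<Sum>b\<in>B. \<Sum>a'\<in>A'. \<Sum>b'\<in>B'. (\<Sum>j\<in>J. F j a a') * (\<Sum>k\<in>K. G k b b') * C a b a' b')"
proof -
  have q: "(\<Sum>a\<in>A. \<Sum>b\<in>B. \<Sum>a'\<in>A'. \<Sum>b'\<in>B'. f a b a' b') = (\<Sum>(a,b,a',b')\<in>A\<times>B\<times>A'\<times>B'. f a b a' b')" for f :: "_ \<Rightarrow> _ \<Rightarrow> _ \<Rightarrow> _ \<Rightarrow> complex"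
    by (simp add: sum.cartesian_product split_def)
  have p: "(\<Sum>j\<in>J. \<Sum>k\<in>K. g j k) = (\<Sum>(j,k)\<in>J\<times>K. g j k)" for g :: "_ \<Rightarrow> _ \<Rightarrow> complex"
    by (simp add: sum.cartesian_product)
  have "(\<Sum>(j,k)\<in>J\<times>K. \<Sum>(a,b,a',b')\<in>A\<times>B\<times>A'\<times>B'. F j a a' * G k b b' * C a b a' b')
     = (\<Sum>(a,b,a',b')\<in>A\<times>B\<times>A'\<times>B'. \<Sum>(j,k)\<in>J\<times>K. F j a a' * G k b b' * C a b a' b')"
    unfolding split_def by (rule sum.swap)
  also have "\<dots> = (\<Sum>(a,b,a',b')\<in>A\<times>B\<times>A'\<times>B'. (\<Sum>j\<in>J. F j a a') * (\<Sum>k\<in>K. G k b b') * C a b a' b')"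
  proof (intro sum.cong refl, clarify)
    fix a b a' b'
    show "(\<Sum>(j,k)\<in>J\<times>K. F j a a' * G k b b' * C a b a' b')
       = (\<Sum>j\<in>J. F j a a') * (\<Sum>k\<in>K. G k b b') * C a b a' b'"
      unfolding sum_product by (simp only: sum_distrib_right flip: sum.cartesian_product)
  qed
  finally show ?thesis unfolding q p .
qed

text \<open>The weight of a grid point is, up to normalisation, the quadratic form of
  \<open>c\<close> evaluated on a character, hence non-negative. This samples the Fejer mean of the
  Fourier series with coefficients \<open>c\<close> at roots of unity. Taking 2N points per axis
  prevents aliasing: with |s| \<le> N and |a - a'| < N the frequency s - (a - a') stays below 2N in
  absolute value, so only frequency 0 survives summation.\<close>

lemma fejer_weights:
  fixes c :: "int \<Rightarrow> int \<Rightarrow> complex"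
  assumes pd: "\<And>N \<gamma>. (\<Sum>a<N. \<Sum>b<N. \<Sum>a'<N. \<Sum>b'<N.
      \<gamma> a b * cnj (\<gamma> a' b') * c (int a - int a') (int b - int b')) \<in> \<real>\<^sub>\<ge>\<^sub>0"
    and N: "N > 0"
  obtains p :: "nat \<times> nat \<Rightarrow> real"
  where "\<And>x. 0 \<le> p x"
    "\<And>s t. \<bar>s\<bar> \<le> int N \<Longrightarrow> \<bar>t\<bar> \<le> int N \<Longrightarrow>
      (\<Sum>x\<in>{..<2*N}\<times>{..<2*N}. p x *\<^sub>R (cis (2 * pi * real (fst x) * of_int s / (2*N)) * cis (2 * pi * real (snd x) * of_int t / (2*N))))
       = of_nat (N - nat \<bar>s\<bar>) * of_nat (N - nat \<bar>t\<bar>) / of_nat N ^ 2 * c s t"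
proof -
  let ?e = "\<lambda>(j::nat) (d::int). cis (2 * pi * real j * of_int d / (2*N))"
  define P where "P j k = (\<Sum>a<N. \<Sum>b<N. \<Sum>a'<N. \<Sum>b'<N.
     (?e j (- int a) * ?e k (- int b)) * cnj (?e j (- int a') * ?e k (- int b')) * c (int a - int a') (int b - int b'))" for j k
  have e: "?e j d * ?e j d' = ?e j (d + d')" "cnj (?e j d) = ?e j (- d)" for j d d'
    by (simp_all add: cis_mult cis_cnj algebra_simps add_divide_distrib)
  have P: "P j k \<in> \<real>\<^sub>\<ge>\<^sub>0" for j k unfolding P_def by (rule pd)
  have Pr: "of_real (Re (P j k)) = P j k" "Re (P j k) \<ge> 0" for j k
    using P[of j k] by (auto simp: complex_nonneg_Reals_iff complex_eq_iff)
  show ?thesis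
  proof
    \<comment> \<open>The factor 2N * 2N cancels the two sums over roots of unity; N^2 turns the
      counts N - |s| and N - |t| into Fejer factors.\<close>
    show "0 \<le> Re (P (fst x) (snd x)) / (2 * N * (2 * N) * N^2)" for x using Pr by simp
    fix s t :: int assume st: "\<bar>s\<bar> \<le> int N" "\<bar>t\<bar> \<le> int N"
    have "(\<Sum>j<2*N. \<Sum>k<2*N. P j k * (?e j s * ?e k t)) =
      (\<Sum>j<2*N. \<Sum>k<2*N. \<Sum>a<N. \<Sum>b<N. \<Sum>a'<N. \<Sum>b'<N.
         ?e j (s - (int a - int a')) * ?e k (t - (int b - int b')) * c (int a - int a') (int b - int b'))"
    proof -
      have "?e j (- int a) * ?e k (- int b) * cnj (?e j (- int a') * ?e k (- int b')) * C * (?e j s * ?e k t)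
         = ?e j (s - (int a - int a')) * ?e k (t - (int b - int b')) * C" for j k a b a' b' and C :: complex
      proof -
        have "?e j (- int a) * ?e k (- int b) * cnj (?e j (- int a') * ?e k (- int b')) * C * (?e j s * ?e k t)
          = (?e j (- int a) * ?e j (int a') * ?e j s) * (?e k (- int b) * ?e k (int b') * ?e k t) * C"
          unfolding complex_cnj_mult e(2) by (simp only: mult_ac minus_minus)
        moreover have "s - (int a - int a') = - int a + int a' + s" "t - (int b - int b') = - int b + int b' + t"
          by simp_all
        ultimately show ?thesis by (simp only: e(1))
      qed
      then show ?thesis unfolding P_def sum_distrib_right by (simp only:)
    qed
    also have "\<dots> = (\<Sum>a<N. \<Sum>b<N. \<Sum>a'<N. \<Sum>b'<N. (\<Sum>j<2*N. ?e j (s - (int a - int a'))) *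
        (\<Sum>k<2*N. ?e k (t - (int b - int b'))) * c (int a - int a') (int b - int b'))"
      by (rule sum_swap_pairs)
    also have "\<dots> = (\<Sum>a<N. \<Sum>b<N. \<Sum>a'<N. \<Sum>b'<N. (if s = int a - int a' then 1 else 0) *
        (if t = int b - int b' then 1 else 0) * (of_nat (2*N) * of_nat (2*N) * c s t))"
    proof (intro sum.cong refl)
      fix a b a' b' assume "a \<in> {..<N}" "b \<in> {..<N}" "a' \<in> {..<N}" "b' \<in> {..<N}"
      then have "\<bar>s - (int a - int a')\<bar> < int (2*N)" "\<bar>t - (int b - int b')\<bar> < int (2*N)" using st by auto
      note this[THEN sum_cis_roots]
      then show "(\<Sum>j<2*N. ?e j (s - (int a - int a'))) * (\<Sum>k<2*N. ?e k (t - (int b - int b'))) * c (int a - int a') (int b - int b')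
         = (if s = int a - int a' then 1 else 0) *
        (if t = int b - int b' then 1 else 0) * (of_nat (2*N) * of_nat (2*N) * c s t)" by simp
    qed
    also have "\<dots> = (\<Sum>a<N. \<Sum>a'<N. if s = int a - int a' then 1 else 0) *
       (\<Sum>b<N. \<Sum>b'<N. if t = int b - int b' then 1 else 0) * (of_nat (2*N) * of_nat (2*N) * c s t)"
      unfolding sum_product by (simp only: sum_distrib_right)
    also have "\<dots> = of_nat (N - nat \<bar>s\<bar>) * of_nat (N - nat \<bar>t\<bar>) * (of_nat (2*N) * of_nat (2*N) * c s t)"
      unfolding card_int_diff_eq ..
    finally have *: "(\<Sum>j<2*N. \<Sum>k<2*N. P j k * (?e j s * ?e k t)) = \<dots>" .
    have "(\<Sum>x\<in>{..<2*N}\<times>{..<2*N}. (Re (P (fst x) (snd x)) / (2 * N * (2 * N) * N^2)) *\<^sub>R (?e (fst x) s * ?e (snd x) t))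
      = (\<Sum>j<2*N. \<Sum>k<2*N. P j k * (?e j s * ?e k t)) / (of_nat (2*N) * of_nat (2*N) * of_nat N ^ 2)"
      unfolding sum_divide_distrib sum.cartesian_product
      by (intro sum.cong refl) (auto simp: scaleR_conv_of_real Pr(1))
    also have "\<dots> = of_nat (N - nat \<bar>s\<bar>) * of_nat (N - nat \<bar>t\<bar>) / of_nat N ^ 2 * c s t"
      unfolding * using N by simp
    finally show "(\<Sum>x\<in>{..<2*N}\<times>{..<2*N}. (Re (P (fst x) (snd x)) / (2 * N * (2 * N) * N^2)) *\<^sub>R (?e (fst x) s * ?e (snd x) t))
      = of_nat (N - nat \<bar>s\<bar>) * of_nat (N - nat \<bar>t\<bar>) / of_nat N ^ 2 * c s t" .
  qed
qed

text \<open>The theorem of Herglotz and Bochner for \<int> x \<int>. The discrete Fejer measures are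
  lifted to [0,4] along the covering curve, so they are tight; a weak limit exists by Helly
  selection, and the characters, being bounded and continuous along the curve, pass to the limit.
  The measure stays on the line, with \<open>Z\<close> and \<open>W\<close> as the torus
  coordinates.\<close>

theorem trigonometric_moments_torus:
  fixes c :: "int \<Rightarrow> int \<Rightarrow> complex"
  assumes pd: "\<And>N \<gamma>. (\<Sum>a<N. \<Sum>b<N. \<Sum>a'<N. \<Sum>b'<N.
      \<gamma> a b * cnj (\<gamma> a' b') * c (int a - int a') (int b - int b')) \<in> \<real>\<^sub>\<ge>\<^sub>0"
    and c0: "c 0 0 = 1"
  obtains \<nu> :: "real measure" and Z W :: "real \<Rightarrow> complex"
  where "prob_space \<nu>" "sets \<nu> = sets borel" "continuous_on UNIV Z" "continuous_on UNIV W"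
    "\<And>x. norm (Z x) = 1" "\<And>x. norm (W x) = 1"
    "\<And>s t. (\<integral>x. Z x powi s * W x powi t \<partial>\<nu>) = c s t"
proof -
  obtain \<phi> :: "real \<Rightarrow> real \<times> real"
    where \<phi>: "continuous_on UNIV \<phi>" "\<And>z. z \<in> {0..<1} \<times> {0..<1} \<Longrightarrow> \<exists>t\<in>{0..4}. \<phi> t = z"
    using continuous_cover_unit_square by blast
  define Z where "Z x = cis (2 * pi * fst (\<phi> x))" for x
  define W where "W x = cis (2 * pi * snd (\<phi> x))" for x
  define \<tau> where "\<tau> z = (SOME t. t \<in> {0..4} \<and> \<phi> t = z)" for z
  have \<tau>: "\<tau> z \<in> {0..4}" "\<phi> (\<tau> z) = z" if "z \<in> {0..<1} \<times> {0..<1}" for z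
  proof -
    have "\<exists>t. t \<in> {0..4} \<and> \<phi> t = z" using \<phi>(2)[OF that] by blast
    from someI_ex[OF this] show "\<tau> z \<in> {0..4}" "\<phi> (\<tau> z) = z" unfolding \<tau>_def by blast+
  qed
  define E where "E s t x = Z x powi s * W x powi t" for s t x
  have E: "E s t x = cis (2 * pi * (of_int s * fst (\<phi> x) + of_int t * snd (\<phi> x)))" for s t x
    unfolding E_def Z_def W_def cis_power_int cis_mult by (simp add: algebra_simps)
  have contE: "continuous_on UNIV (E s t)" for s t
    unfolding E by (intro continuous_intros \<phi>(1))
  have "\<exists>M. real_distribution M \<and> measure M {-1<..4} = 1 \<and> (\<forall>s t. \<bar>s\<bar> \<le> int N \<longrightarrow> \<bar>t\<bar> \<le> int N \<longrightarrow>
     integral\<^sup>L M (E s t) = of_nat (N - nat \<bar>s\<bar>) * of_nat (N - nat \<bar>t\<bar>) / of_nat N ^ 2 * c s t)"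
    if N: "N > 0" for N :: nat
  proof -
    obtain p :: "nat \<times> nat \<Rightarrow> real" where p: "\<And>x. 0 \<le> p x"
    "\<And>s t. \<bar>s\<bar> \<le> int N \<Longrightarrow> \<bar>t\<bar> \<le> int N \<Longrightarrow>
      (\<Sum>x\<in>{..<2*N}\<times>{..<2*N}. p x *\<^sub>R (cis (2 * pi * real (fst x) * of_int s / (2*N)) * cis (2 * pi * real (snd x) * of_int t / (2*N))))
       = of_nat (N - nat \<bar>s\<bar>) * of_nat (N - nat \<bar>t\<bar>) / of_nat N ^ 2 * c s t"
      using fejer_weights[OF pd N] by blast
    let ?A = "{..<2*N} \<times> {..<2*N}"
    let ?q = "\<lambda>x. (real (fst x) / (2*N), real (snd x) / (2*N))"
    have q: "?q x \<in> {0..<1} \<times> {0..<1}" if "x \<in> ?A" for x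
      using that N by (auto simp: divide_simps simp flip: of_nat_mult)
    let ?D = "point_measure ?A (\<lambda>x. ennreal (p x))"
    define M where "M = distr ?D borel (\<lambda>x. \<tau> (?q x))"
    \<comment> \<open>Although \<open>\<tau>\<close> is a choice function, every map out of a finite
      point measure is measurable.\<close>
    have meas: "(\<lambda>x. \<tau> (?q x)) \<in> measurable ?D borel" by simp
    have "(\<Sum>x\<in>?A. p x) = 1"
    proof -
      have "complex_of_real (\<Sum>x\<in>?A. p x) = 1"
        using p(2)[of 0 0] N c0 by (simp add: scaleR_conv_of_real power2_eq_square)
      then show ?thesis using of_real_eq_1_iff by blast
    qed
    then have "emeasure ?D (space ?D) = 1"
      by (simp add: space_point_measure emeasure_point_measure_finite sum_ennreal p(1))
    then interpret D: prob_space ?D by (rule prob_spaceI)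
    interpret M: prob_space M unfolding M_def by (rule D.prob_space_distr[OF meas])
    have "real_distribution M"
      unfolding real_distribution_def real_distribution_axioms_def
      using M.prob_space_axioms by (intro conjI) (simp_all add: M_def)
    \<comment> \<open>Tightness is phrased with intervals open on the left, hence the endpoint -1 to
      include the value 0.\<close>
    moreover have "measure M {-1<..4} = 1"
    proof -
      have "measure M {-1<..4} = measure ?D ((\<lambda>x. \<tau> (?q x)) -` {-1<..4} \<inter> space ?D)"
        unfolding M_def by (rule measure_distr[OF meas]) simp
      also have "(\<lambda>x. \<tau> (?q x)) -` {-1<..4} \<inter> space ?D = space ?D"
        using \<tau>(1)[OF q] by (fastforce simp: space_point_measure)
      finally show ?thesis by (simp add: D.prob_space)
    qed
    moreover have "integral\<^sup>L M (E s t) = of_nat (N - nat \<bar>s\<bar>) * of_nat (N - nat \<bar>t\<bar>) / of_nat N ^ 2 * c s t"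
      if "\<bar>s\<bar> \<le> int N" "\<bar>t\<bar> \<le> int N" for s t
    proof -
      have "integral\<^sup>L M (E s t) = (\<integral>x. E s t (\<tau> (?q x)) \<partial>?D)"
        unfolding M_def by (rule integral_distr[OF meas]) (rule borel_measurable_continuous_onI[OF contE])
      also have "\<dots> = (\<Sum>x\<in>?A. p x *\<^sub>R E s t (\<tau> (?q x)))"
        by (rule lebesgue_integral_point_measure_finite) (auto simp: p)
      also have "\<dots> = (\<Sum>x\<in>?A. p x *\<^sub>R (cis (2 * pi * real (fst x) * of_int s / (2*N)) * cis (2 * pi * real (snd x) * of_int t / (2*N))))"
      proof (intro sum.cong refl)
        fix x assume "x \<in> ?A"
        from \<tau>(2)[OF q[OF this]] show "p x *\<^sub>R E s t (\<tau> (?q x)) = p x *\<^sub>R (cis (2 * pi * real (fst x) * of_int s / (2*N)) * cis (2 * pi * real (snd x) * of_int t / (2*N)))"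
          unfolding E by (simp add: cis_mult algebra_simps)
      qed
      finally show ?thesis using p(2)[OF that] by simp
    qed
    ultimately show ?thesis by blast
  qed
  then have "\<forall>N. \<exists>M. real_distribution M \<and> measure M {-1<..4} = 1 \<and> (\<forall>s t. \<bar>s\<bar> \<le> int (Suc N) \<longrightarrow> \<bar>t\<bar> \<le> int (Suc N) \<longrightarrow>
     integral\<^sup>L M (E s t) = of_nat (Suc N - nat \<bar>s\<bar>) * of_nat (Suc N - nat \<bar>t\<bar>) / of_nat (Suc N) ^ 2 * c s t)"
    by (meson zero_less_Suc)
  then obtain \<mu> where \<mu>: "\<And>N. real_distribution (\<mu> N)" "\<And>N. measure (\<mu> N) {-1<..4} = 1"
    "\<And>N s t. \<bar>s\<bar> \<le> int (Suc N) \<Longrightarrow> \<bar>t\<bar> \<le> int (Suc N) \<Longrightarrow>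
     integral\<^sup>L (\<mu> N) (E s t) = of_nat (Suc N - nat \<bar>s\<bar>) * of_nat (Suc N - nat \<bar>t\<bar>) / of_nat (Suc N) ^ 2 * c s t"
    by metis
  have "tight \<mu>" unfolding tight_def
  proof (intro conjI allI impI)
    fix \<epsilon> :: real assume "0 < \<epsilon>"
    then show "\<exists>a b. a < b \<and> (\<forall>n. 1 - \<epsilon> < measure (\<mu> n) {a<..b})"
      using \<mu>(2) by (intro exI[of _ "-1"] exI[of _ 4]) simp
  qed (fact \<mu>(1))
  then obtain r \<nu> where r: "strict_mono (r::nat\<Rightarrow>nat)" "real_distribution \<nu>" "weak_conv_m (\<mu> \<circ> id \<circ> r) \<nu>"
    using tight_imp_convergent_subsubsequence[of \<mu> id] by (auto simp: strict_mono_id)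
  interpret \<nu>: real_distribution \<nu> by fact
  show ?thesis
  proof (rule that)
    show "prob_space \<nu>" by unfold_locales
    show "sets \<nu> = sets borel" by simp
    show "continuous_on UNIV Z" "continuous_on UNIV W"
      unfolding Z_def W_def by (intro continuous_intros \<phi>(1))+
    show "norm (Z x) = 1" "norm (W x) = 1" for x by (simp_all add: Z_def W_def)
    fix s t :: int
    have 1: "(\<lambda>n. integral\<^sup>L ((\<mu> \<circ> id \<circ> r) n) (E s t)) \<longlonglongrightarrow> integral\<^sup>L \<nu> (E s t)"
    proof (rule weak_conv_imp_integral_bdd_continuous_conv)
      show "real_distribution ((\<mu> \<circ> id \<circ> r) n)" for n by (simp add: \<mu>(1))
      show "real_distribution \<nu>" by fact
      show "weak_conv_m (\<mu> \<circ> id \<circ> r) \<nu>" by (fact r(3))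
      show "isCont (E s t) x" for x
        using contE by (simp add: continuous_on_eq_continuous_at)
      show "norm (E s t x) \<le> 1" for x by (simp add: E)
    qed
    have 2: "(\<lambda>n. integral\<^sup>L (\<mu> n) (E s t)) \<longlonglongrightarrow> c s t"
    proof -
      have "(\<lambda>n. complex_of_real ((real (Suc n) - of_int \<bar>s\<bar>) * (real (Suc n) - of_int \<bar>t\<bar>) / real (Suc n) ^ 2) * c s t) \<longlonglongrightarrow> of_real 1 * c s t"
        by (intro tendsto_intros) real_asymp
      \<comment> \<open>The truncated subtractions in the Fejer factors agree with real ones once n
        is at least |s| + |t|.\<close>
      moreover have "eventually (\<lambda>n. complex_of_real ((real (Suc n) - of_int \<bar>s\<bar>) * (real (Suc n) - of_int \<bar>t\<bar>) / real (Suc n) ^ 2) * c s t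
         = integral\<^sup>L (\<mu> n) (E s t)) sequentially"
        using eventually_ge_at_top[of "nat (\<bar>s\<bar> + \<bar>t\<bar>)"]
      proof eventually_elim
        case (elim n)
        then have b: "\<bar>s\<bar> \<le> int (Suc n)" "\<bar>t\<bar> \<le> int (Suc n)" by auto
        then have "real (Suc n - nat \<bar>s\<bar>) = real (Suc n) - of_int \<bar>s\<bar>" "real (Suc n - nat \<bar>t\<bar>) = real (Suc n) - of_int \<bar>t\<bar>"
          by (subst of_nat_diff; force)+
        then show ?case unfolding \<mu>(3)[OF b] by (metis of_real_divide of_real_mult of_real_of_nat_eq of_real_power)
      qed
      ultimately have "(\<lambda>n. integral\<^sup>L (\<mu> n) (E s t)) \<longlonglongrightarrow> of_real 1 * c s t"
        by (rule Lim_transform_eventually)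
      then show ?thesis by simp
    qed
    have "(\<lambda>n. integral\<^sup>L ((\<mu> \<circ> id \<circ> r) n) (E s t)) \<longlonglongrightarrow> c s t"
      using LIMSEQ_subseq_LIMSEQ[OF 2 r(1)] by (simp add: o_def)
    with 1 have "integral\<^sup>L \<nu> (E s t) = c s t" by (rule LIMSEQ_unique)
    then show "(\<integral>x. Z x powi s * W x powi t \<partial>\<nu>) = c s t" by (simp add: E_def[abs_def])
  qed
qed

section \<open>Complex Hilbert spaces\<close>

lemma cinner_add_right: "cinner x (y + z) = cinner x y + cinner (x::'h::chilbert_space) z"
  by (metis cinner_add_left cinner_commute complex_cnj_add)

lemma cinner_scaleC_right: "cinner x (c *\<^sub>C y) = cnj c * cinner (x::'h::chilbert_space) y"
  by (metis cinner_scaleC_left cinner_commute complex_cnj_mult)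

lemma Re_cinner_commute: "Re (cinner x y) = Re (cinner y (x::'h::chilbert_space))"
  by (metis cinner_commute cnj.simps(1))

lemma cinner_scaleR_left: "cinner (r *\<^sub>R x) y = r *\<^sub>R cinner (x::'h::chilbert_space) y"
  by (metis cinner_scaleC_left scaleC_of_real scaleR_conv_of_real)

lemma cinner_scaleR_right: "cinner x (r *\<^sub>R y) = r *\<^sub>R cinner (x::'h::chilbert_space) y"
  by (metis cinner_scaleC_right scaleC_of_real scaleR_conv_of_real complex_cnj_complex_of_real)

lemma cinner_eq_zero_commute: "cinner x y = 0 \<longleftrightarrow> cinner y (x::'h::chilbert_space) = 0"
  by (metis cinner_commute complex_cnj_zero)

lemma additive_cinner_left: "Modules.additive (\<lambda>x::'h::chilbert_space. cinner x y)"
  by (simp add: Modules.additive_def cinner_add_left)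

lemma additive_cinner_right: "Modules.additive (\<lambda>y::'h::chilbert_space. cinner x y)"
  by (simp add: Modules.additive_def cinner_add_right)

lemmas cinner_zero_left [simp] = Modules.additive.zero[OF additive_cinner_left]
lemmas cinner_zero_right [simp] = Modules.additive.zero[OF additive_cinner_right]
lemmas cinner_diff_left = Modules.additive.diff[OF additive_cinner_left]
lemmas cinner_diff_right = Modules.additive.diff[OF additive_cinner_right]
lemmas cinner_minus_right = Modules.additive.minus[OF additive_cinner_right]
lemmas cinner_sum_left = Modules.additive.sum[OF additive_cinner_left]
lemmas cinner_sum_right = Modules.additive.sum[OF additive_cinner_right]

lemma cnj_mult_self: "cnj z * z = of_real ((cmod z)\<^sup>2)"
  by (metis complex_norm_square mult.commute)

lemma norm_scaleC [simp]: "norm (c *\<^sub>C (x::'h::chilbert_space)) = cmod c * norm x"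
proof -
  have "complex_of_real ((norm (c *\<^sub>C x))\<^sup>2) = c * cnj c * complex_of_real ((norm x)\<^sup>2)"
    by (simp only: cinner_self[symmetric]) (simp add: cinner_scaleC_left cinner_scaleC_right)
  then have "complex_of_real ((norm (c *\<^sub>C x))\<^sup>2) = complex_of_real ((cmod c * norm x)\<^sup>2)"
    by (simp only: power_mult_distrib of_real_mult complex_norm_square)
  then show ?thesis
    by (metis mult_nonneg_nonneg norm_ge_zero of_real_eq_iff power2_eq_imp_eq)
qed

lemma norm_add_square:
  "(norm (x + y))\<^sup>2 = (norm (x::'h::chilbert_space))\<^sup>2 + 2 * Re (cinner x y) + (norm y)\<^sup>2"
proof -
  have "complex_of_real ((norm (x + y))\<^sup>2) = cinner x x + cinner y y + (cinner x y + cnj (cinner x y))"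
    by (simp only: cinner_self[symmetric] cinner_add_left cinner_add_right cinner_commute[symmetric]) simp
  then have "Re (complex_of_real ((norm (x + y))\<^sup>2)) = Re (cinner x x + cinner y y + (cinner x y + cnj (cinner x y)))"
    by simp
  then show ?thesis by (simp add: cinner_self)
qed

lemma norm_add_square_orthogonal:
  "cinner x y = 0 \<Longrightarrow> (norm (x + y))\<^sup>2 = (norm (x::'h::chilbert_space))\<^sup>2 + (norm y)\<^sup>2"
  by (simp add: norm_add_square)

lemma cinner_Cauchy_Schwarz: "cmod (cinner x y) \<le> norm x * norm (y::'h::chilbert_space)"
proof (cases "y = 0")
  case False
  let ?c = "cinner x y"
  \<comment> \<open>This is (norm y)^2 times the component of x orthogonal to y, which avoids a
    division.\<close>
  let ?v = "(norm y)\<^sup>2 *\<^sub>R x + (- ?c) *\<^sub>C y"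
  have "0 \<le> (norm ?v)\<^sup>2" by simp
  also have "\<dots> = (norm ((norm y)\<^sup>2 *\<^sub>R x))\<^sup>2 + 2 * Re (cinner ((norm y)\<^sup>2 *\<^sub>R x) ((- ?c) *\<^sub>C y)) + (norm ((- ?c) *\<^sub>C y))\<^sup>2"
    by (rule norm_add_square)
  also have "cinner ((norm y)\<^sup>2 *\<^sub>R x) ((- ?c) *\<^sub>C y) = (norm y)\<^sup>2 *\<^sub>R (- (cnj ?c * ?c))"
    by (simp add: cinner_scaleR_left cinner_scaleC_right cinner_minus_right)
  also have "\<dots> = of_real (- ((norm y)\<^sup>2 * (cmod ?c)\<^sup>2))"
    by (simp only: cnj_mult_self scaleR_conv_of_real of_real_mult of_real_minus mult_minus_right)
  finally have "0 \<le> (norm y)\<^sup>2 * ((norm x)\<^sup>2 * (norm y)\<^sup>2 - (cmod ?c)\<^sup>2)"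
    by (simp add: algebra_simps power_mult_distrib power2_eq_square)
  then have "(cmod ?c)\<^sup>2 \<le> (norm x * norm y)\<^sup>2"
    using False by (simp add: zero_le_mult_iff power_mult_distrib)
  then show ?thesis by (simp add: power2_le_iff_abs_le)
qed simp

lemma bounded_bilinear_cinner: "bounded_bilinear (cinner :: 'h::chilbert_space \<Rightarrow> 'h \<Rightarrow> complex)"
proof
  show "\<exists>K. \<forall>(a::'h) b. norm (cinner a b) \<le> norm a * norm b * K"
    by (rule exI[of _ 1]) (simp add: cinner_Cauchy_Schwarz)
qed (simp_all add: cinner_add_left cinner_add_right cinner_scaleR_left cinner_scaleR_right)

lemmas tendsto_cinner = bounded_bilinear.tendsto[OF bounded_bilinear_cinner]
lemmas bounded_linear_cinner_left = bounded_bilinear.bounded_linear_left[OF bounded_bilinear_cinner]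

lemma orthogonal_cspan:
  assumes "\<And>x. x \<in> S \<Longrightarrow> cinner x (v::'h::chilbert_space) = 0" "y \<in> cspan S"
  shows "cinner y v = 0"
  using assms(2)
proof (induction rule: complex_vector.span_induct_alt)
  case (step c x y)
  then show ?case using assms(1) by (simp add: cinner_add_left cinner_scaleC_left)
qed simp

text \<open>\<open>V\<close> need not be closed: the representing vector is the limit of a minimizing sequence in \<open>V\<close> for
  \<open>\<parallel>x\<parallel>\<^sup>2 - 2 Re (\<phi> x)\<close>.\<close>

lemma Riesz_representation_bounded:
  fixes V :: "'h::chilbert_space set" and \<phi> :: "'h \<Rightarrow> complex"
  assumes V: "csubspace V"
    and add: "\<And>x y. x \<in> V \<Longrightarrow> y \<in> V \<Longrightarrow> \<phi> (x + y) = \<phi> x + \<phi> y"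
    and scale: "\<And>c x. x \<in> V \<Longrightarrow> \<phi> (c *\<^sub>C x) = c * \<phi> x"
    and bound: "\<And>x. x \<in> V \<Longrightarrow> cmod (\<phi> x) \<le> C * norm x" and "C \<ge> 0"
  obtains y where "\<And>x. x \<in> V \<Longrightarrow> \<phi> x = cinner x y" "norm y \<le> C"
proof -
  define J where "J x = (norm x)\<^sup>2 - 2 * Re (\<phi> x)" for x
  have V0: "0 \<in> V" and Vadd: "\<And>x y. x \<in> V \<Longrightarrow> y \<in> V \<Longrightarrow> x + y \<in> V"
    and Vscale: "\<And>c x. x \<in> V \<Longrightarrow> c *\<^sub>C x \<in> V"
    using V by (auto simp: complex_vector.subspace_def)
  have VscaleR: "r *\<^sub>R x \<in> V" "\<phi> (r *\<^sub>R x) = r *\<^sub>R \<phi> x" if "x \<in> V" for r x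
    using Vscale[OF that, of "of_real r"] scale[OF that, of "of_real r"]
    by (simp_all add: scaleC_of_real scaleR_conv_of_real)
  have Jge: "J x \<ge> - C\<^sup>2" if "x \<in> V" for x
  proof -
    have "Re (\<phi> x) \<le> C * norm x" using bound[OF that] complex_Re_le_cmod order_trans by blast
    then have "J x \<ge> (norm x - C)\<^sup>2 - C\<^sup>2" by (simp add: J_def power2_diff mult.commute)
    then show ?thesis using zero_le_power2[of "norm x - C"] by linarith
  qed
  define I where "I = Inf (J ` V)"
  have bdd: "bdd_below (J ` V)" using Jge by (auto intro!: bdd_belowI)
  have I: "I \<le> J x" if "x \<in> V" for x unfolding I_def using that bdd by (simp add: cInf_lower)
  have "\<exists>x\<in>V. J x < I + inverse (real (Suc n))" for n
  proof -
    have "\<exists>j\<in>J ` V. j < I + inverse (real (Suc n))"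
      using V0 bdd cInf_lessD[of "J ` V" "I + inverse (real (Suc n))"] unfolding I_def by fastforce
    then show ?thesis by blast
  qed
  then obtain x where x: "\<And>n. x n \<in> V" "\<And>n. J (x n) < I + inverse (real (Suc n))" by metis
  \<comment> \<open>Parallelogram law: the squared distance equals 2 J (x m) + 2 J (x n) - 4 J
    (midpoint), and \<open>J\<close> at the midpoint is at least \<open>I\<close>.\<close>
  have par: "(norm (x m - x n))\<^sup>2 \<le> 2 * inverse (real (Suc m)) + 2 * inverse (real (Suc n))" for m n
  proof -
    let ?a = "(1/2) *\<^sub>R (x m + x n)"
    have "?a \<in> V" using x Vadd VscaleR by blast
    then have "I \<le> J ?a" by (rule I)
    moreover have "J ?a = (norm (x m + x n))\<^sup>2 / 4 - Re (\<phi> (x m)) - Re (\<phi> (x n))"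
      unfolding J_def using x Vadd by (simp add: VscaleR add power_divide add_divide_distrib)
    moreover have "(norm (x m - x n))\<^sup>2 = 2 * (norm (x m))\<^sup>2 + 2 * (norm (x n))\<^sup>2 - (norm (x m + x n))\<^sup>2"
      using norm_add_square[of "x m" "x n"] norm_add_square[of "x m" "(-1) *\<^sub>R x n"]
      by (simp only: cinner_scaleR_right) simp
    ultimately show ?thesis using x(2)[of m] x(2)[of n] unfolding J_def by linarith
  qed
  have "Cauchy x"
  proof (rule CauchyI)
    fix e :: real assume "e > 0"
    then obtain M where M: "inverse (real (Suc M)) < e\<^sup>2 / 4"
      using reals_Archimedean[of "e\<^sup>2 / 4"] by auto
    show "\<exists>M. \<forall>m\<ge>M. \<forall>n\<ge>M. norm (x m - x n) < e"
    proof (intro exI allI impI)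
      fix m n assume "m \<ge> M" "n \<ge> M"
      then have "inverse (real (Suc m)) \<le> inverse (real (Suc M))" "inverse (real (Suc n)) \<le> inverse (real (Suc M))"
        by (simp_all add: field_simps)
      then have "(norm (x m - x n))\<^sup>2 < e\<^sup>2" using par[of m n] M by linarith
      then show "norm (x m - x n) < e" using \<open>e > 0\<close> by (simp add: power_less_imp_less_base)
    qed
  qed
  then obtain y where y: "x \<longlonglongrightarrow> y" using Cauchy_convergent_iff convergent_def by blast
  have lim0: "(\<lambda>n. I + inverse (real (Suc n))) \<longlonglongrightarrow> I"
    using tendsto_add[OF tendsto_const LIMSEQ_inverse_real_of_nat, of I] by simp
  have JI: "(\<lambda>n. J (x n)) \<longlonglongrightarrow> I"
  proof (rule real_tendsto_sandwich[OF _ _ tendsto_const lim0])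
    show "eventually (\<lambda>n. I \<le> J (x n)) sequentially" using I x(1) by simp
    show "eventually (\<lambda>n. J (x n) \<le> I + inverse (real (Suc n))) sequentially"
      by (intro always_eventually allI less_imp_le x(2))
  qed
  have re: "Re (cinner v y) = Re (\<phi> v)" if v: "v \<in> V" for v
  proof -
    define b where "b = Re (cinner v y) - Re (\<phi> v)"
    \<comment> \<open>First variation: \<open>J (x n + t v)\<close> is at least \<open>I\<close> for
      every n, and the limit leaves a quadratic in t without constant term. Its minimum lies at t =
      -b / (norm v)^2, which forces b = 0.\<close>
    have ge: "2 * t * b + t\<^sup>2 * (norm v)\<^sup>2 \<ge> 0" for t
    proof -
      have lim: "(\<lambda>n. J (x n) + 2 * t * (Re (cinner v (x n)) - Re (\<phi> v)) + t\<^sup>2 * (norm v)\<^sup>2)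
         \<longlonglongrightarrow> I + 2 * t * (Re (cinner v y) - Re (\<phi> v)) + t\<^sup>2 * (norm v)\<^sup>2"
        by (intro tendsto_intros JI tendsto_cinner y)
      have "I \<le> J (x n) + 2 * t * (Re (cinner v (x n)) - Re (\<phi> v)) + t\<^sup>2 * (norm v)\<^sup>2" for n
      proof -
        have "I \<le> J (x n + t *\<^sub>R v)" using x v Vadd VscaleR by (intro I) blast
        also have "\<dots> = J (x n) + 2 * t * (Re (cinner v (x n)) - Re (\<phi> v)) + t\<^sup>2 * (norm v)\<^sup>2"
          unfolding J_def
          by (simp add: norm_add_square cinner_scaleR_right add x v VscaleR Re_cinner_commute[of v] power_mult_distrib algebra_simps)
        finally show ?thesis .
      qed
      then have "I \<le> I + 2 * t * (Re (cinner v y) - Re (\<phi> v)) + t\<^sup>2 * (norm v)\<^sup>2"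
        using lim by (meson LIMSEQ_le_const)
      then show ?thesis by (simp add: b_def)
    qed
    have "b = 0"
    proof (cases "norm v = 0")
      case True
      then show ?thesis using ge[of 1] ge[of "-1"] by simp
    next
      case False
      have "0 \<le> 2 * (- b / (norm v)\<^sup>2) * b + (- b / (norm v)\<^sup>2)\<^sup>2 * (norm v)\<^sup>2" by (rule ge)
      also have "\<dots> = - (b\<^sup>2 / (norm v)\<^sup>2)" using False by (simp add: field_simps power2_eq_square)
      finally show ?thesis using False by (simp add: divide_le_0_iff)
    qed
    then show ?thesis by (simp add: b_def)
  qed
  have rep: "\<phi> v = cinner v y" if v: "v \<in> V" for v
  proof -
    \<comment> \<open>Minimisation controls real parts only; the imaginary part comes from replacing
      v by i v.\<close>
    have "Re (cinner (\<i> *\<^sub>C v) y) = Re (\<phi> (\<i> *\<^sub>C v))" using Vscale[OF v] by (rule re)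
    then have "Im (cinner v y) = Im (\<phi> v)" by (simp add: cinner_scaleC_left scale[OF v])
    then show ?thesis using re[OF v] by (simp add: complex_eq_iff)
  qed
  have "norm y \<le> C"
  proof -
    \<comment> \<open>The vector y lies only in the closure of \<open>V\<close>, so the bound on the
      functional is carried along the minimizing sequence.\<close>
    have "(\<lambda>n. cmod (cinner (x n) y)) \<longlonglongrightarrow> cmod (cinner y y)"
      by (intro tendsto_intros tendsto_cinner y)
    moreover have "(\<lambda>n. C * norm (x n)) \<longlonglongrightarrow> C * norm y" by (intro tendsto_intros y)
    moreover have "cmod (cinner (x n) y) \<le> C * norm (x n)" for n
      using bound[OF x(1)[of n]] rep[OF x(1)[of n]] by simp
    ultimately have "cmod (cinner y y) \<le> C * norm y" by (meson LIMSEQ_le)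
    then have "norm y * norm y \<le> C * norm y"
      by (simp only: cinner_self norm_of_real) (simp add: power2_eq_square)
    then show ?thesis using \<open>C \<ge> 0\<close> by (cases "y = 0") auto
  qed
  with rep show ?thesis by (rule that)
qed

section \<open>Orthonormal systems\<close>

definition orthonormal_on :: "'i set \<Rightarrow> ('i \<Rightarrow> 'h::chilbert_space) \<Rightarrow> bool" where
  "orthonormal_on A g \<longleftrightarrow> (\<forall>m\<in>A. \<forall>n\<in>A. cinner (g m) (g n) = (if m = n then 1 else 0))"

lemma orthonormal_onD:
  "orthonormal_on A g \<Longrightarrow> m \<in> A \<Longrightarrow> n \<in> A \<Longrightarrow> cinner (g m) (g n) = (if m = n then 1 else 0)"
  by (simp add: orthonormal_on_def)

lemma orthonormal_cinner_sum:
  assumes "orthonormal_on A g" "finite F" "F \<subseteq> A" "m \<in> A"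
  shows "cinner (\<Sum>n\<in>F. \<alpha> n *\<^sub>C g n) (g m) = (if m \<in> F then \<alpha> m else 0)"
proof -
  have "cinner (\<Sum>n\<in>F. \<alpha> n *\<^sub>C g n) (g m) = (\<Sum>n\<in>F. if n = m then \<alpha> n else 0)"
    unfolding cinner_sum_left cinner_scaleC_left
    by (intro sum.cong refl) (use assms in \<open>auto simp: orthonormal_onD subsetD\<close>)
  then show ?thesis using assms(2) by simp
qed

lemma orthonormal_norm_sum:
  assumes "orthonormal_on A g" "finite F" "F \<subseteq> A"
  shows "(norm (\<Sum>n\<in>F. \<alpha> n *\<^sub>C g n))\<^sup>2 = (\<Sum>n\<in>F. (cmod (\<alpha> n))\<^sup>2)"
proof -
  let ?v = "\<Sum>n\<in>F. \<alpha> n *\<^sub>C g n"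
  have "cinner ?v ?v = (\<Sum>m\<in>F. cnj (\<alpha> m) * cinner ?v (g m))"
    by (subst cinner_sum_right) (simp add: cinner_scaleC_right)
  also have "\<dots> = (\<Sum>m\<in>F. cnj (\<alpha> m) * \<alpha> m)"
    by (intro sum.cong refl) (use assms in \<open>auto simp: orthonormal_cinner_sum subsetD\<close>)
  also have "\<dots> = complex_of_real (\<Sum>n\<in>F. (cmod (\<alpha> n))\<^sup>2)"
    by (simp only: cnj_mult_self of_real_sum)
  finally show ?thesis by (metis cinner_self of_real_eq_iff)
qed

lemma Bessel_finite:
  assumes "orthonormal_on A g" "finite F" "F \<subseteq> A"
  shows "(\<Sum>n\<in>F. (cmod (cinner y (g n)))\<^sup>2) \<le> (norm y)\<^sup>2"
proof -
  let ?v = "\<Sum>n\<in>F. cinner y (g n) *\<^sub>C g n"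
  have "cinner (y - ?v) ?v = (\<Sum>m\<in>F. cnj (cinner y (g m)) * cinner (y - ?v) (g m))"
    by (subst cinner_sum_right) (simp add: cinner_scaleC_right)
  also have "\<dots> = 0"
    by (intro sum.neutral ballI) (use assms in \<open>auto simp: orthonormal_cinner_sum[OF assms] cinner_diff_left\<close>)
  finally have "(norm ((y - ?v) + ?v))\<^sup>2 = (norm (y - ?v))\<^sup>2 + (norm ?v)\<^sup>2"
    by (rule norm_add_square_orthogonal)
  then show ?thesis using orthonormal_norm_sum[OF assms, of "\<lambda>n. cinner y (g n)"] by simp
qed

text \<open>Cauchy criterion along the net of finite subsets. Two sums over arbitrary finite sets
  are each compared with the sum over a common smaller set, because for nested sets orthonormality
  turns the norm of the difference into a difference of scalar partial sums.\<close>

lemma orthonormal_summable: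
  fixes g :: "'i \<Rightarrow> 'h::chilbert_space"
  assumes on: "orthonormal_on A g" and sm: "(\<lambda>n. (cmod (\<alpha> n))\<^sup>2) summable_on A"
  shows "(\<lambda>n. \<alpha> n *\<^sub>C g n) summable_on A"
proof -
  let ?f = "\<lambda>n. \<alpha> n *\<^sub>C g n"
  from sm obtain L where lim: "(sum (\<lambda>n. (cmod (\<alpha> n))\<^sup>2) \<longlongrightarrow> L) (finite_subsets_at_top A)"
    unfolding summable_on_def has_sum_def by blast
  then have *: "cauchy_filter (filtermap (sum (\<lambda>n. (cmod (\<alpha> n))\<^sup>2)) (finite_subsets_at_top A))"
    by (auto intro!: nhds_imp_cauchy_filter simp: filterlim_def)
  have "\<exists>P. eventually P (finite_subsets_at_top A) \<and> (\<forall>F F'. P F \<and> P F' \<longrightarrow> dist (sum ?f F) (sum ?f F') < e)"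
    if "e > 0" for e
  proof -
    obtain P where evP: "eventually P (finite_subsets_at_top A)"
      and P: "\<And>F F'. P F \<Longrightarrow> P F' \<Longrightarrow> dist (sum (\<lambda>n. (cmod (\<alpha> n))\<^sup>2) F) (sum (\<lambda>n. (cmod (\<alpha> n))\<^sup>2) F') < (e/2)\<^sup>2"
    proof -
      have "(e/2)\<^sup>2 > 0" using \<open>e > 0\<close> by simp
      from *[unfolded cauchy_filter_metric_filtermap, rule_format, OF this] that show ?thesis by metis
    qed
    from evP obtain S where S: "finite S" "S \<subseteq> A" "\<And>F. finite F \<Longrightarrow> S \<subseteq> F \<Longrightarrow> F \<subseteq> A \<Longrightarrow> P F"
      by (auto simp: eventually_finite_subsets_at_top)
    define Q where "Q F \<longleftrightarrow> finite F \<and> S \<subseteq> F \<and> F \<subseteq> A" for F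
    have evQ: "eventually Q (finite_subsets_at_top A)"
      using S by (auto simp: eventually_finite_subsets_at_top Q_def)
    have near: "norm (sum ?f F - sum ?f S) < e / 2" if "Q F" for F
    proof -
      have F: "finite F" "S \<subseteq> F" "F \<subseteq> A" using that by (auto simp: Q_def)
      have d: "sum ?f F - sum ?f S = sum ?f (F - S)"
        "sum (\<lambda>n. (cmod (\<alpha> n))\<^sup>2) F - sum (\<lambda>n. (cmod (\<alpha> n))\<^sup>2) S = sum (\<lambda>n. (cmod (\<alpha> n))\<^sup>2) (F - S)"
        using F by (simp_all add: sum_diff S)
      have "(norm (sum ?f (F - S)))\<^sup>2 = sum (\<lambda>n. (cmod (\<alpha> n))\<^sup>2) (F - S)"
        by (rule orthonormal_norm_sum[OF on]) (use F in auto)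
      also have "\<dots> < (e/2)\<^sup>2"
        using P[of F S] S F by (simp add: dist_real_def d(2))
      finally have "norm (sum ?f (F - S)) < e / 2"
        by (rule power_less_imp_less_base) (use \<open>e > 0\<close> in simp)
      then show ?thesis by (simp only: d(1))
    qed
    have "dist (sum ?f F) (sum ?f F') < e" if "Q F" "Q F'" for F F'
      using near[OF that(1)] near[OF that(2)]
      by (metis dist_norm dist_triangle_half_l)
    then show ?thesis using evQ by blast
  qed
  then have "cauchy_filter (filtermap (sum ?f) (finite_subsets_at_top A))"
    unfolding cauchy_filter_metric_filtermap by blast
  moreover note complete_UNIV[where 'a='h]
  ultimately obtain L' where "(sum ?f \<longlongrightarrow> L') (finite_subsets_at_top A)"
    using complete_uniform[where S=UNIV] by (force simp add: filterlim_def)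
  then show ?thesis using summable_on_def has_sum_def by blast
qed

lemma orthonormal_infsum_norm:
  assumes on: "orthonormal_on A g" and sm: "(\<lambda>n. (cmod (\<alpha> n))\<^sup>2) summable_on A"
  shows "(norm (\<Sum>\<^sub>\<infinity>n\<in>A. \<alpha> n *\<^sub>C g n))\<^sup>2 = (\<Sum>\<^sub>\<infinity>n\<in>A. (cmod (\<alpha> n))\<^sup>2)"
proof -
  have "(sum (\<lambda>n. \<alpha> n *\<^sub>C g n) \<longlongrightarrow> (\<Sum>\<^sub>\<infinity>n\<in>A. \<alpha> n *\<^sub>C g n)) (finite_subsets_at_top A)"
    using orthonormal_summable[OF assms] has_sum_def summable_iff_has_sum_infsum by blast
  then have "((\<lambda>F. (norm (sum (\<lambda>n. \<alpha> n *\<^sub>C g n) F))\<^sup>2) \<longlongrightarrow> (norm (\<Sum>\<^sub>\<infinity>n\<in>A. \<alpha> n *\<^sub>C g n))\<^sup>2) (finite_subsets_at_top A)"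
    by (intro tendsto_intros)
  moreover have "eventually (\<lambda>F. (norm (sum (\<lambda>n. \<alpha> n *\<^sub>C g n) F))\<^sup>2 = sum (\<lambda>n. (cmod (\<alpha> n))\<^sup>2) F) (finite_subsets_at_top A)"
    by (rule eventually_finite_subsets_at_top_weakI) (rule orthonormal_norm_sum[OF on])
  ultimately have "(sum (\<lambda>n. (cmod (\<alpha> n))\<^sup>2) \<longlongrightarrow> (norm (\<Sum>\<^sub>\<infinity>n\<in>A. \<alpha> n *\<^sub>C g n))\<^sup>2) (finite_subsets_at_top A)"
    using tendsto_cong by fastforce
  then show ?thesis by (simp add: has_sum_def infsumI)
qed

lemma cinner_infsum:
  assumes "(\<lambda>n. f n) summable_on A"
  shows "cinner (\<Sum>\<^sub>\<infinity>n\<in>A. f n) (v::'h::chilbert_space) = (\<Sum>\<^sub>\<infinity>n\<in>A. cinner (f n) v)"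
  using infsumI[OF has_sum_bounded_linear[OF bounded_linear_cinner_left has_sum_infsum[OF assms]], of v] by (simp add: o_def)

lemma orthonormal_cinner_infsum:
  assumes on: "orthonormal_on A g" and sm: "(\<lambda>n. (cmod (\<alpha> n))\<^sup>2) summable_on A" and "m \<in> A"
  shows "cinner (\<Sum>\<^sub>\<infinity>n\<in>A. \<alpha> n *\<^sub>C g n) (g m) = \<alpha> m"
proof -
  have "cinner (\<Sum>\<^sub>\<infinity>n\<in>A. \<alpha> n *\<^sub>C g n) (g m) = (\<Sum>\<^sub>\<infinity>n\<in>A. \<alpha> n * cinner (g n) (g m))"
    by (simp add: cinner_infsum[OF orthonormal_summable[OF on sm]] cinner_scaleC_left)
  also have "\<dots> = (\<Sum>\<^sub>\<infinity>n\<in>{m}. \<alpha> n * cinner (g n) (g m))"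
    by (rule infsum_cong_neutral) (use assms in \<open>auto simp: orthonormal_onD\<close>)
  also have "\<dots> = \<alpha> m" using assms by (simp add: orthonormal_onD)
  finally show ?thesis .
qed

lemma orthogonal_infsum:
  assumes "(\<lambda>n. \<alpha> n *\<^sub>C g n) summable_on A" "\<And>n. n \<in> A \<Longrightarrow> cinner (g n) (v::'h::chilbert_space) = 0"
  shows "cinner (\<Sum>\<^sub>\<infinity>n\<in>A. \<alpha> n *\<^sub>C g n) v = 0"
  unfolding cinner_infsum[OF assms(1)]
  by (rule infsum_0) (simp add: cinner_scaleC_left assms(2))

section \<open>The Gram--Schmidt process\<close>

lemma gram_schmidt_raw_cases: "norm (gram_schmidt_raw x i) = 1 \<or> gram_schmidt_raw x i = 0"
  by (subst (1 2) gram_schmidt_raw.simps) (auto simp: norm_sgn)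

lemma gram_schmidt_raw_orthogonal_less:
  "k < i \<Longrightarrow> cinner (gram_schmidt_raw x i) (gram_schmidt_raw x k) = 0"
proof (induction i arbitrary: k rule: less_induct)
  case (less i)
  let ?G = "gram_schmidt_raw x"
  let ?u = "x i - (\<Sum>j\<in>{..<i}. cinner (x i) (?G j) *\<^sub>C ?G j)"
  have orth: "cinner (?G j) (?G k) = 0" if "j < i" "j \<noteq> k" for j
  proof (cases "j < k")
    case True
    then show ?thesis using less.IH[of k j] less.prems by (subst cinner_eq_zero_commute) simp
  next
    case False
    then show ?thesis using less.IH[of j k] that by simp
  qed
  have "cinner ?u (?G k) = cinner (x i) (?G k) - (\<Sum>j\<in>{..<i}. cinner (x i) (?G j) * cinner (?G j) (?G k))"
    by (simp add: cinner_diff_left cinner_sum_left cinner_scaleC_left)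
  also have "(\<Sum>j\<in>{..<i}. cinner (x i) (?G j) * cinner (?G j) (?G k))
      = (\<Sum>j\<in>{..<i}. if j = k then cinner (x i) (?G k) * cinner (?G k) (?G k) else 0)"
    by (intro sum.cong refl) (use orth in auto)
  also have "\<dots> = cinner (x i) (?G k) * cinner (?G k) (?G k)" using less.prems by simp
  \<comment> \<open>An entry is either a unit vector, and the two terms cancel, or the zero left by
    a dependent vector, and both vanish.\<close>
  finally have "cinner ?u (?G k) = 0"
    using gram_schmidt_raw_cases[of x k] by (auto simp: cinner_self)
  then have "cinner (sgn ?u) (?G k) = 0"
    by (simp add: sgn_div_norm cinner_scaleR_left)
  then show ?case by (subst gram_schmidt_raw.simps) simp
qed

lemma gram_schmidt_raw_orthogonal:
  "k \<noteq> i \<Longrightarrow> cinner (gram_schmidt_raw x i) (gram_schmidt_raw x k) = 0"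
  using gram_schmidt_raw_orthogonal_less cinner_eq_zero_commute by (metis linorder_neqE_nat)

lemma gram_schmidt_raw_in_span: "gram_schmidt_raw x i \<in> cspan (range x)"
proof (induction i rule: less_induct)
  case (less i)
  let ?u = "x i - (\<Sum>j\<in>{..<i}. cinner (x i) (gram_schmidt_raw x j) *\<^sub>C gram_schmidt_raw x j)"
  have "?u \<in> cspan (range x)"
    by (intro complex_vector.span_diff complex_vector.span_sum complex_vector.span_scale)
      (auto intro: complex_vector.span_base less)
  then have "of_real (inverse (norm ?u)) *\<^sub>C ?u \<in> cspan (range x)" by (rule complex_vector.span_scale)
  then have "sgn ?u \<in> cspan (range x)" by (simp only: scaleC_of_real sgn_div_norm)
  then show ?case by (subst gram_schmidt_raw.simps)
qed

lemma in_span_gram_schmidt_raw: "x i \<in> cspan (range (gram_schmidt_raw x))"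
proof -
  let ?S = "\<Sum>j\<in>{..<i}. cinner (x i) (gram_schmidt_raw x j) *\<^sub>C gram_schmidt_raw x j"
  have "norm (x i - ?S) *\<^sub>R sgn (x i - ?S) = x i - ?S"
    by (cases "x i - ?S = 0") (auto simp: sgn_div_norm)
  then have "x i = of_real (norm (x i - ?S)) *\<^sub>C gram_schmidt_raw x i + ?S"
    by (subst (2) gram_schmidt_raw.simps) (simp add: scaleC_of_real)
  also have "\<dots> \<in> cspan (range (gram_schmidt_raw x))"
    by (intro complex_vector.span_add complex_vector.span_sum complex_vector.span_scale complex_vector.span_base) auto
  finally show ?thesis .
qed

text \<open>The basis is numbered from 1 and \<open>enumerate\<close> from 0, which explains the
  shift.\<close>

lemma bij_betw_gs_index:
  "bij_betw (\<lambda>n. enumerate (gs_support x) (n - 1)) (gs_index x) (gs_support x)"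
proof (cases "finite (gs_support x)")
  case True
  have "bij_betw (\<lambda>n. n - 1) (gs_index x) {..<card (gs_support x)}"
    by (rule bij_betw_byWitness[where f' = Suc]) (auto simp: gs_index_def True)
  then show ?thesis
    using bij_betw_trans[OF _ finite_bij_enumerate[OF True]] by (simp add: o_def)
next
  case False
  have "bij_betw (\<lambda>n. n - 1) (gs_index x) UNIV"
    by (rule bij_betw_byWitness[where f' = Suc]) (auto simp: gs_index_def False)
  then show ?thesis
    using bij_betw_trans[OF _ bij_enumerate[OF False]] by (simp add: o_def)
qed

lemma orthonormal_gs_basis: "orthonormal_on (gs_index x) (gs_basis x)"
  unfolding orthonormal_on_def
proof (intro ballI)
  fix m n assume mn: "m \<in> gs_index x" "n \<in> gs_index x"
  let ?e = "\<lambda>n. enumerate (gs_support x) (n - 1)"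
  have "?e m \<in> gs_support x" using bij_betw_gs_index mn(1) by (rule bij_betwE[THEN bspec])
  then have "norm (gram_schmidt_raw x (?e m)) = 1"
    using gram_schmidt_raw_cases[of x "?e m"] by (auto simp: gs_support_def)
  moreover have "m \<noteq> n \<Longrightarrow> ?e m \<noteq> ?e n"
    using bij_betw_gs_index[of x] mn by (auto simp: bij_betw_def inj_on_def)
  ultimately show "cinner (gs_basis x m) (gs_basis x n) = (if m = n then 1 else 0)"
    by (auto simp: gs_basis_def cinner_self gram_schmidt_raw_orthogonal)
qed

lemma gs_basis_in_span: "gs_basis x n \<in> cspan (range x)"
  by (simp add: gs_basis_def gram_schmidt_raw_in_span)

lemma in_span_gs_basis: "x i \<in> cspan (gs_basis x ` gs_index x)"
proof -
  have "range (gram_schmidt_raw x) \<subseteq> cspan (gs_basis x ` gs_index x)"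
  proof clarify
    fix j
    show "gram_schmidt_raw x j \<in> cspan (gs_basis x ` gs_index x)"
    proof (cases "j \<in> gs_support x")
      case True
      then obtain n where "n \<in> gs_index x" "j = enumerate (gs_support x) (n - 1)"
        using bij_betw_gs_index[of x] by (auto simp: bij_betw_def)
      then show ?thesis by (auto simp: gs_basis_def intro!: complex_vector.span_base)
    qed (simp add: gs_support_def complex_vector.span_zero)
  qed
  then have "cspan (range (gram_schmidt_raw x)) \<subseteq> cspan (gs_basis x ` gs_index x)"
    by (intro complex_vector.span_minimal) simp_all
  then show ?thesis using in_span_gram_schmidt_raw by blast
qed

section \<open>Functions attached to the indices\<close>

definition rat_fun :: "nat \<Rightarrow> int \<Rightarrow> int \<Rightarrow> real \<Rightarrow> complex" where
  "rat_fun m k l x = of_real x ^ m * (of_real x + \<i>) powi k * (of_real x - \<i>) powi l"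

fun idx_fun :: "idx \<Rightarrow> real \<times> real \<Rightarrow> complex" where
  "idx_fun (m, k, l, n, r, t) z = rat_fun m k l (fst z) * rat_fun n r t (snd z)"

text \<open>The index of the function f_u times the conjugate of f_v. Conjugation exchanges x + i
  and x - i, so the exponents of the second index enter crosswise.\<close>

fun idx_mult_cnj :: "idx \<Rightarrow> idx \<Rightarrow> idx" where
  "idx_mult_cnj (m, k, l, n, r, t) (m', k', l', n', r', t') = (m + m', k + l', l + k', n + n', r + t', t + r')"

lemma of_real_add_ii_nonzero [simp]:
  "complex_of_real x + \<i> \<noteq> 0" "\<i> + complex_of_real x \<noteq> 0" "complex_of_real x \<noteq> \<i>"
  by (simp_all add: complex_eq_iff)

lemma powi_of_real_ii_add:
  "(complex_of_real x + \<i>) powi (k + l) = (of_real x + \<i>) powi k * (of_real x + \<i>) powi l"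
  "(complex_of_real x - \<i>) powi (k + l) = (of_real x - \<i>) powi k * (of_real x - \<i>) powi l"
  by (rule power_int_add, simp)+

lemma cnj_powi: "cnj (z powi k) = cnj z powi k"
  by (simp add: power_int_def)

lemma rat_fun_add: "rat_fun (m + m') (k + k') (l + l') x = rat_fun m k l x * rat_fun m' k' l' x"
  by (simp add: rat_fun_def power_add powi_of_real_ii_add)

lemma cnj_rat_fun: "cnj (rat_fun m k l x) = rat_fun m l k x"
  by (simp add: rat_fun_def cnj_powi)

lemma rat_fun_Suc:
  "rat_fun (Suc m) k l x + \<i> * rat_fun m k l x = rat_fun m (k + 1) l x"
  "rat_fun (Suc m) k l x - \<i> * rat_fun m k l x = rat_fun m k (l + 1) x"
  unfolding rat_fun_def powi_of_real_ii_add by (simp_all add: algebra_simps)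

lemma idx_fun_mult_cnj: "idx_fun u z * cnj (idx_fun v z) = idx_fun (idx_mult_cnj u v) z"
  by (cases u; cases v) (simp add: cnj_rat_fun rat_fun_add)

lemma rat_fun_measurable [measurable]: "rat_fun m k l \<in> borel_measurable borel"
proof -
  have "continuous_on UNIV (rat_fun m k l)"
    unfolding rat_fun_def by (intro continuous_intros) auto
  then show ?thesis by (rule borel_measurable_continuous_onI)
qed

lemma idx_fun_measurable [measurable]: "idx_fun u \<in> borel_measurable borel"
proof (cases u)
  case (fields m k l n r t)
  have "(\<lambda>z. rat_fun m k l (fst z) * rat_fun n r t (snd z)) \<in> borel_measurable (borel \<Otimes>\<^sub>M borel)"
    by measurable
  moreover have "idx_fun u = (\<lambda>z. rat_fun m k l (fst z) * rat_fun n r t (snd z))"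
    by (simp add: fields fun_eq_iff)
  ultimately show ?thesis by (simp only: borel_prod)
qed

text \<open>In (E5)-(E10) both sides have the same combined index, so they hold for every kernel of
  this form. Only (E1)-(E4) say something about \<open>L\<close>, and they are the four linear
  relations assumed here.\<close>

lemma eqn_holds_mult_cnj_kernel:
  assumes rel: "\<And>m k l n r t. L (m + 1, k, l, n, r, t) + \<i> * L (m, k, l, n, r, t) = L (m, k + 1, l, n, r, t)"
    "\<And>m k l n r t. L (m + 1, k, l, n, r, t) - \<i> * L (m, k, l, n, r, t) = L (m, k, l + 1, n, r, t)"
    "\<And>m k l n r t. L (m, k, l, n + 1, r, t) + \<i> * L (m, k, l, n, r, t) = L (m, k, l, n, r + 1, t)"
    "\<And>m k l n r t. L (m, k, l, n + 1, r, t) - \<i> * L (m, k, l, n, r, t) = L (m, k, l, n, r, t + 1)"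
    and "E \<in> equations"
  shows "eqn_holds (\<lambda>u v. L (idx_mult_cnj u v)) E"
  using \<open>E \<in> equations\<close>
proof cases
  case (E1 m k l n r t v)
  obtain m' k' l' n' r' t' where v: "v = (m', k', l', n', r', t')" by (cases v)
  show ?thesis using rel(1)[of "m + m'" "k + l'" "l + k'" "n + n'" "r + t'" "t + r'"] by (simp add: E1 v add_ac)
next
  case (E2 m k l n r t v)
  obtain m' k' l' n' r' t' where v: "v = (m', k', l', n', r', t')" by (cases v)
  show ?thesis using rel(2)[of "m + m'" "k + l'" "l + k'" "n + n'" "r + t'" "t + r'"] by (simp add: E2 v add_ac)
next
  case (E3 m k l n r t v)
  obtain m' k' l' n' r' t' where v: "v = (m', k', l', n', r', t')" by (cases v)
  show ?thesis using rel(3)[of "m + m'" "k + l'" "l + k'" "n + n'" "r + t'" "t + r'"] by (simp add: E3 v add_ac)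
next
  case (E4 m k l n r t v)
  obtain m' k' l' n' r' t' where v: "v = (m', k', l', n', r', t')" by (cases v)
  show ?thesis using rel(4)[of "m + m'" "k + l'" "l + k'" "n + n'" "r + t'" "t + r'"] by (simp add: E4 v add_ac)
qed auto

section \<open>Isometric correspondences\<close>

text \<open>A linear isometry between subspaces of a Hilbert space and of \<open>L\<^sup>2(\<mu>)\<close> is handled as a set of pairs,
  since a vector determines its function only almost everywhere.\<close>

definition isometric :: "'a measure \<Rightarrow> ('h::chilbert_space \<times> ('a \<Rightarrow> complex)) set \<Rightarrow> bool" where
  "isometric \<mu> S \<longleftrightarrow> (\<forall>(x, f)\<in>S. \<forall>(y, g)\<in>S.
     integrable \<mu> (\<lambda>z. f z * cnj (g z)) \<and> cinner x y = (\<integral>z. f z * cnj (g z) \<partial>\<mu>))"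

text \<open>The span is taken in both components at once, with functions added pointwise, so that a
  linear combination of vectors carries a definite function without passing to classes modulo null
  sets.\<close>

inductive_set pair_span :: "('h::chilbert_space \<times> ('a \<Rightarrow> complex)) set \<Rightarrow> ('h \<times> ('a \<Rightarrow> complex)) set"
  for S where
  zero: "(0, \<lambda>_. 0) \<in> pair_span S"
| step: "(x, f) \<in> S \<Longrightarrow> (y, g) \<in> pair_span S \<Longrightarrow> (c *\<^sub>C x + y, \<lambda>z. c * f z + g z) \<in> pair_span S"

lemma pair_span_base: "(x, f) \<in> S \<Longrightarrow> (x, f) \<in> pair_span S"
  using pair_span.step[OF _ pair_span.zero, of x f S 1] by (simp add: scaleC_one)

lemma pair_span_add:
  "(x, f) \<in> pair_span S \<Longrightarrow> (y, g) \<in> pair_span S \<Longrightarrow> (x + y, \<lambda>z. f z + g z) \<in> pair_span S"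
proof (induction rule: pair_span.induct)
  case (step x f y g c)
  from pair_span.step[OF step(1) step(3)[OF step(4)], of c] show ?case by (simp add: add.assoc)
qed simp

lemma pair_span_scale: "(x, f) \<in> pair_span S \<Longrightarrow> (c *\<^sub>C x, \<lambda>z. c * f z) \<in> pair_span S"
proof (induction rule: pair_span.induct)
  case (step x f y g d)
  from pair_span.step[OF step(1) step(3), of "c * d"] show ?case
    by (simp add: scaleC_add_right scaleC_scaleC algebra_simps)
qed (simp add: pair_span.zero)

lemma pair_span_diff:
  assumes "(x, f) \<in> pair_span S" "(y, g) \<in> pair_span S"
  shows "(x - y, \<lambda>z. f z - g z) \<in> pair_span S"
  using pair_span_add[OF assms(1) pair_span_scale[OF assms(2), of "-1"]] by simp

lemma pair_span_sum:
  assumes "\<And>i. i \<in> I \<Longrightarrow> (x i, f i) \<in> pair_span S"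
  shows "(\<Sum>i\<in>I. x i, \<lambda>z. \<Sum>i\<in>I. f i z) \<in> pair_span S"
  using assms by (induction I rule: infinite_finite_induct) (auto intro: pair_span.zero pair_span_add)

lemma isometric_subset: "isometric \<mu> T \<Longrightarrow> S \<subseteq> T \<Longrightarrow> isometric \<mu> S"
  unfolding isometric_def by blast

lemma isometricD:
  assumes "isometric \<mu> S" "(x, f) \<in> S" "(y, g) \<in> S"
  shows "integrable \<mu> (\<lambda>z. f z * cnj (g z))" "cinner x y = (\<integral>z. f z * cnj (g z) \<partial>\<mu>)"
  using assms unfolding isometric_def by blast+

lemma isometric_pair_span:
  assumes "isometric \<mu> S" shows "isometric \<mu> (pair_span S)"
proof -
  have 1: "integrable \<mu> (\<lambda>z. f z * cnj (g z)) \<and> cinner x y = (\<integral>z. f z * cnj (g z) \<partial>\<mu>)"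
    if "(x, f) \<in> pair_span S" "(y, g) \<in> S" for x f y g
    using that(1)
  proof induction
    case (step x' f' y' g' c)
    note 2 = isometricD[OF assms step(1) that(2)]
    have "integrable \<mu> (\<lambda>z. c * (f' z * cnj (g z)) + g' z * cnj (g z))"
      using 2 step.IH by (intro Bochner_Integration.integrable_add integrable_mult_right) auto
    moreover have "(\<integral>z. c * (f' z * cnj (g z)) + g' z * cnj (g z) \<partial>\<mu>) = c * cinner x' y + cinner y' y"
      using 2 step.IH by (simp add: Bochner_Integration.integral_add)
    ultimately show ?case by (simp add: algebra_simps cinner_add_left cinner_scaleC_left)
  qed simp
  have "integrable \<mu> (\<lambda>z. f z * cnj (g z)) \<and> cinner x y = (\<integral>z. f z * cnj (g z) \<partial>\<mu>)"
    if "(y, g) \<in> pair_span S" "(x, f) \<in> pair_span S" for x f y g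
    using that(1)
  proof induction
    case (step x' f' y' g' c)
    note 2 = 1[OF that(2) step(1)]
    have "integrable \<mu> (\<lambda>z. cnj c * (f z * cnj (f' z)) + f z * cnj (g' z))"
      using 2 step.IH by (intro Bochner_Integration.integrable_add integrable_mult_right) auto
    moreover have "(\<integral>z. cnj c * (f z * cnj (f' z)) + f z * cnj (g' z) \<partial>\<mu>) = cnj c * cinner x x' + cinner x y'"
      using 2 step.IH by (simp add: Bochner_Integration.integral_add)
    ultimately show ?case by (simp add: algebra_simps cinner_add_right cinner_scaleC_right)
  qed simp
  then show ?thesis unfolding isometric_def by blast
qed

lemma isometric_norm:
  assumes "isometric \<mu> S" "(x, f) \<in> S"
  shows "integrable \<mu> (\<lambda>z. (cmod (f z))\<^sup>2)" "(norm x)\<^sup>2 = (\<integral>z. (cmod (f z))\<^sup>2 \<partial>\<mu>)"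
proof -
  note 1 = isometricD[OF assms assms(2)]
  have 2: "(\<lambda>z. f z * cnj (f z)) = (\<lambda>z. complex_of_real ((cmod (f z))\<^sup>2))"
    by (simp only: complex_norm_square)
  show "integrable \<mu> (\<lambda>z. (cmod (f z))\<^sup>2)"
    using 1(1) unfolding 2 complex_of_real_integrable_eq .
  have "complex_of_real ((norm x)\<^sup>2) = complex_of_real (\<integral>z. (cmod (f z))\<^sup>2 \<partial>\<mu>)"
    using 1(2) unfolding 2 integral_complex_of_real cinner_self .
  then show "(norm x)\<^sup>2 = (\<integral>z. (cmod (f z))\<^sup>2 \<partial>\<mu>)" by (simp only: of_real_eq_iff)
qed

lemma cmod_mult_cnj_le: "cmod (a * cnj b) \<le> (cmod a)\<^sup>2 + (cmod b)\<^sup>2"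
proof -
  have "2 * (cmod a * cmod b) \<le> (cmod a)\<^sup>2 + (cmod b)\<^sup>2" using sum_squares_bound[of "cmod a" "cmod b"] by simp
  then show ?thesis using mult_nonneg_nonneg[OF norm_ge_zero norm_ge_zero, of a b]
    unfolding norm_mult complex_mod_cnj by linarith
qed

lemma borel_measurable_cnj [measurable]:
  assumes "f \<in> borel_measurable M" shows "(\<lambda>x. cnj (f x)) \<in> borel_measurable M"
  by (rule measurable_compose[OF assms borel_measurable_continuous_onI[OF continuous_on_cnj[OF continuous_on_id]]])

text \<open>Square integrability of the limit function is not assumed: by Fatou it follows from the
  convergence of the vectors, whose norms are the norms of the approximating functions. After that
  the bound by 2 |f| supplies an integrable majorant for the products.\<close>

lemma isometric_limit:
  assumes iso: "isometric \<mu> S"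
    and ap: "\<And>x f. (x, f) \<in> S' \<Longrightarrow> f \<in> borel_measurable \<mu> \<and> (\<exists>X F. (\<forall>n::nat. (X n, F n) \<in> S) \<and> X \<longlonglongrightarrow> x \<and>
        (\<forall>z. (\<lambda>n. F n z) \<longlonglongrightarrow> f z) \<and> (\<forall>n z. cmod (F n z) \<le> 2 * cmod (f z)) \<and> (\<forall>n. F n \<in> borel_measurable \<mu>))"
  shows "isometric \<mu> S'"
proof -
  have sq: "integrable \<mu> (\<lambda>z. (cmod (f z))\<^sup>2)" if mem: "(x, f) \<in> S'" for x f
  proof -
    obtain X F where [measurable]: "f \<in> borel_measurable \<mu>" "\<And>n::nat. F n \<in> borel_measurable \<mu>"
      and XF: "\<And>n. (X n, F n) \<in> S" "X \<longlonglongrightarrow> x" "\<And>z. (\<lambda>n. F n z) \<longlonglongrightarrow> f z"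
      using ap[OF mem] by (elim conjE exE) blast
    have "(\<integral>\<^sup>+z. ennreal ((cmod (f z))\<^sup>2) \<partial>\<mu>) = (\<integral>\<^sup>+z. liminf (\<lambda>n. ennreal ((cmod (F n z))\<^sup>2)) \<partial>\<mu>)"
    proof (intro nn_integral_cong)
      fix z
      have "(\<lambda>n. ennreal ((cmod (F n z))\<^sup>2)) \<longlonglongrightarrow> ennreal ((cmod (f z))\<^sup>2)"
        by (intro tendsto_intros XF)
      from lim_imp_Liminf[OF sequentially_bot this]
      show "ennreal ((cmod (f z))\<^sup>2) = liminf (\<lambda>n. ennreal ((cmod (F n z))\<^sup>2))" ..
    qed
    also have "\<dots> \<le> liminf (\<lambda>n. \<integral>\<^sup>+z. ennreal ((cmod (F n z))\<^sup>2) \<partial>\<mu>)"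
      by (intro nn_integral_liminf) measurable
    also have "\<dots> = liminf (\<lambda>n. ennreal ((norm (X n))\<^sup>2))"
      using isometric_norm[OF iso XF(1)] by (simp add: nn_integral_eq_integral)
    also have "\<dots> = ennreal ((norm x)\<^sup>2)"
      by (intro lim_imp_Liminf) (auto intro!: tendsto_intros XF)
    also have "\<dots> < \<infinity>" by simp
    finally show ?thesis by (simp add: integrable_iff_bounded)
  qed
  have "integrable \<mu> (\<lambda>z. f z * cnj (g z)) \<and> cinner x y = (\<integral>z. f z * cnj (g z) \<partial>\<mu>)"
    if xf: "(x, f) \<in> S'" and yg: "(y, g) \<in> S'" for x f y g
  proof -
    obtain X F where [measurable]: "f \<in> borel_measurable \<mu>" "\<And>n::nat. F n \<in> borel_measurable \<mu>"
      and XF: "\<And>n. (X n, F n) \<in> S" "X \<longlonglongrightarrow> x" "\<And>z. (\<lambda>n. F n z) \<longlonglongrightarrow> f z" "\<And>n z. cmod (F n z) \<le> 2 * cmod (f z)"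
      using ap[OF xf] by (elim conjE exE) blast
    obtain Y G where [measurable]: "g \<in> borel_measurable \<mu>" "\<And>n::nat. G n \<in> borel_measurable \<mu>"
      and YG: "\<And>n. (Y n, G n) \<in> S" "Y \<longlonglongrightarrow> y" "\<And>z. (\<lambda>n. G n z) \<longlonglongrightarrow> g z" "\<And>n z. cmod (G n z) \<le> 2 * cmod (g z)"
      using ap[OF yg] by (elim conjE exE) blast
    let ?w = "\<lambda>z. 4 * ((cmod (f z))\<^sup>2 + (cmod (g z))\<^sup>2)"
    have w: "integrable \<mu> ?w" using sq[OF xf] sq[OF yg] by simp
    have dom: "cmod (F n z * cnj (G n z)) \<le> ?w z" for n z
    proof -
      have "(cmod (F n z))\<^sup>2 \<le> (2 * cmod (f z))\<^sup>2" "(cmod (G n z))\<^sup>2 \<le> (2 * cmod (g z))\<^sup>2"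
        by (intro power_mono XF YG norm_ge_zero)+
      then show ?thesis using cmod_mult_cnj_le[of "F n z" "G n z"] by (simp add: power_mult_distrib)
    qed
    have lim: "(\<lambda>n. F n z * cnj (G n z)) \<longlonglongrightarrow> f z * cnj (g z)" for z
      by (intro tendsto_intros XF YG)
    have int: "integrable \<mu> (\<lambda>z. f z * cnj (g z))"
    proof (rule Bochner_Integration.integrable_bound[OF w])
      show "AE z in \<mu>. cmod (f z * cnj (g z)) \<le> norm (?w z)"
        using cmod_mult_cnj_le order_trans by (intro always_eventually allI) (smt (verit) norm_ge_zero real_norm_def zero_le_power2)
    qed measurable
    have "(\<lambda>n. \<integral>z. F n z * cnj (G n z) \<partial>\<mu>) \<longlonglongrightarrow> (\<integral>z. f z * cnj (g z) \<partial>\<mu>)"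
      by (rule integral_dominated_convergence[where w = ?w]) (use w dom lim in auto)
    moreover have "(\<lambda>n. \<integral>z. F n z * cnj (G n z) \<partial>\<mu>) = (\<lambda>n. cinner (X n) (Y n))"
      using isometricD(2)[OF iso XF(1) YG(1)] by simp
    moreover have "(\<lambda>n. cinner (X n) (Y n)) \<longlonglongrightarrow> cinner x y" by (intro tendsto_cinner XF YG)
    ultimately show ?thesis using int LIMSEQ_unique by metis
  qed
  then show ?thesis unfolding isometric_def by blast
qed

section \<open>From the family of vectors to a measure\<close>

text \<open>The equations in solved form: (E1)-(E4) become identities between vectors, and
  (E5)-(E10) become the single statement that a scalar product depends only on the combined
  index.\<close>

locale gram_family =
  fixes H :: "idx \<Rightarrow> 'h::chilbert_space"
  assumes rel1: "H (m + 1, k, l, n, r, t) + \<i> *\<^sub>C H (m, k, l, n, r, t) = H (m, k + 1, l, n, r, t)"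
    and rel2: "H (m + 1, k, l, n, r, t) - \<i> *\<^sub>C H (m, k, l, n, r, t) = H (m, k, l + 1, n, r, t)"
    and rel3: "H (m, k, l, n + 1, r, t) + \<i> *\<^sub>C H (m, k, l, n, r, t) = H (m, k, l, n, r + 1, t)"
    and rel4: "H (m, k, l, n + 1, r, t) - \<i> *\<^sub>C H (m, k, l, n, r, t) = H (m, k, l, n, r, t + 1)"
    and gram: "cinner (H u) (H v) = cinner (H (idx_mult_cnj u v)) (H (0, 0, 0, 0, 0, 0))"

text \<open>The equations (E1)-(E4) are tested only against the vectors of the family, but both
  sides lie in their span, so the difference is orthogonal to itself. For \<open>gram\<close>, each
  of (E5)-(E10) moves one exponent of the second index over to the first until the second index is
  zero.\<close>

lemma gram_familyI:
  fixes H :: "idx \<Rightarrow> 'h::chilbert_space"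
  assumes eqs: "\<And>E. E \<in> equations \<Longrightarrow> eqn_holds (\<lambda>u v. cinner (H u) (H v)) E"
  shows "gram_family H"
proof
  have 0: "x = y" if "\<And>v. cinner x (H v) = cinner y (H v)" and "x \<in> cspan (range H)" "y \<in> cspan (range H)" for x y
  proof -
    have "x - y \<in> cspan (range H)" using that by (simp add: complex_vector.span_diff)
    moreover have "cinner z (x - y) = 0" if "z \<in> range H" for z
      using that \<open>\<And>v. cinner x (H v) = cinner y (H v)\<close>
      by (subst cinner_eq_zero_commute) (auto simp: cinner_diff_left)
    ultimately have "cinner (x - y) (x - y) = 0" by (rule orthogonal_cspan[rotated])
    then show ?thesis by (simp add: cinner_self)
  qed
  have span: "H u \<in> cspan (range H)" for u by (simp add: complex_vector.span_base)
  note sp = span complex_vector.span_add complex_vector.span_diff complex_vector.span_scale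
  fix m k l n r t
  show "H (m + 1, k, l, n, r, t) + \<i> *\<^sub>C H (m, k, l, n, r, t) = H (m, k + 1, l, n, r, t)"
    by (rule 0) (use eqs[OF equations.E1[of m k l n r t]] in \<open>auto simp: cinner_add_left cinner_scaleC_left intro: sp\<close>)
  show "H (m + 1, k, l, n, r, t) - \<i> *\<^sub>C H (m, k, l, n, r, t) = H (m, k, l + 1, n, r, t)"
    by (rule 0) (use eqs[OF equations.E2[of m k l n r t]] in \<open>auto simp: cinner_diff_left cinner_scaleC_left intro: sp\<close>)
  show "H (m, k, l, n + 1, r, t) + \<i> *\<^sub>C H (m, k, l, n, r, t) = H (m, k, l, n, r + 1, t)"
    by (rule 0) (use eqs[OF equations.E3[of m k l n r t]] in \<open>auto simp: cinner_add_left cinner_scaleC_left intro: sp\<close>)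
  show "H (m, k, l, n + 1, r, t) - \<i> *\<^sub>C H (m, k, l, n, r, t) = H (m, k, l, n, r, t + 1)"
    by (rule 0) (use eqs[OF equations.E4[of m k l n r t]] in \<open>auto simp: cinner_diff_left cinner_scaleC_left intro: sp\<close>)
next
  fix u v :: idx
  obtain m k l n r t where u: "u = (m, k, l, n, r, t)" by (cases u)
  obtain m' k' l' n' r' t' where v: "v = (m', k', l', n', r', t')" by (cases v)
  have "cinner (H (m, k, l, n, r, t)) (H (m', k', l', n', r', t'))
      = cinner (H (m + m', k, l, n, r, t)) (H (0, k', l', n', r', t'))"
    using eqs[OF equations.E5[of m m' "m + m'" 0]] by simp
  also have "\<dots> = cinner (H (m + m', k + l', l, n, r, t)) (H (0, k', 0, n', r', t'))"
    using eqs[OF equations.E6[of k l' "k + l'" 0]] by simp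
  also have "\<dots> = cinner (H (m + m', k + l', l + k', n, r, t)) (H (0, 0, 0, n', r', t'))"
    using eqs[OF equations.E7[of l k' "l + k'" 0]] by simp
  also have "\<dots> = cinner (H (m + m', k + l', l + k', n + n', r, t)) (H (0, 0, 0, 0, r', t'))"
    using eqs[OF equations.E8[of n n' "n + n'" 0]] by simp
  also have "\<dots> = cinner (H (m + m', k + l', l + k', n + n', r + t', t)) (H (0, 0, 0, 0, r', 0))"
    using eqs[OF equations.E9[of r t' "r + t'" 0]] by simp
  also have "\<dots> = cinner (H (m + m', k + l', l + k', n + n', r + t', t + r')) (H (0, 0, 0, 0, 0, 0))"
    using eqs[OF equations.E10[of t r' "t + r'" 0]] by simp
  finally show "cinner (H u) (H v) = cinner (H (idx_mult_cnj u v)) (H (0, 0, 0, 0, 0, 0))"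
    by (simp add: u v)
qed

section \<open>Cesaro means and the mean ergodic argument\<close>

lemma cmod_inverse_Suc: "cmod (1 / of_nat (Suc N)) = inverse (real (Suc N))"
  by (simp only: norm_divide norm_one norm_of_nat inverse_eq_divide)

lemma telescoping_average_tendsto:
  fixes v :: "nat \<Rightarrow> 'h::chilbert_space"
  assumes "\<And>j. norm (v j) \<le> C"
  shows "(\<lambda>N. (1 / of_nat (Suc N)) *\<^sub>C (\<Sum>j<Suc N. v j - v (Suc j))) \<longlonglongrightarrow> 0"
proof (rule Lim_null_comparison)
  show "\<forall>\<^sub>F N in sequentially. norm ((1 / of_nat (Suc N)) *\<^sub>C (\<Sum>j<Suc N. v j - v (Suc j))) \<le> (2 * C) * inverse (real (Suc N))"
  proof (intro always_eventually allI)
    fix N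
    have "norm (\<Sum>j<Suc N. v j - v (Suc j)) = norm (v 0 - v (Suc N))"
      by (simp only: sum_lessThan_telescope')
    also have "\<dots> \<le> 2 * C" using norm_triangle_ineq4[of "v 0" "v (Suc N)"] assms[of 0] assms[of "Suc N"] by linarith
    finally show "norm ((1 / of_nat (Suc N)) *\<^sub>C (\<Sum>j<Suc N. v j - v (Suc j))) \<le> (2 * C) * inverse (real (Suc N))"
      unfolding norm_scaleC cmod_inverse_Suc mult.commute[of "2 * C"] by (rule mult_left_mono) simp
  qed
  show "(\<lambda>N. (2 * C) * inverse (real (Suc N))) \<longlonglongrightarrow> 0"
    by (intro tendsto_mult_right_zero LIMSEQ_inverse_real_of_nat)
qed

lemma geometric_average_tendsto:
  fixes z :: complex
  assumes "cmod z = 1" "z \<noteq> 1"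
  shows "(\<lambda>N. (1 / of_nat (Suc N)) * (\<Sum>j<Suc N. z ^ j)) \<longlonglongrightarrow> 0"
proof (rule Lim_null_comparison)
  show "\<forall>\<^sub>F N in sequentially. norm ((1 / of_nat (Suc N)) * (\<Sum>j<Suc N. z ^ j)) \<le> (2 / cmod (z - 1)) * inverse (real (Suc N))"
  proof (intro always_eventually allI)
    fix N
    have "cmod (\<Sum>j<Suc N. z ^ j) = cmod (z ^ Suc N - 1) / cmod (z - 1)"
      by (subst geometric_sum[OF assms(2)]) (rule norm_divide)
    also have "\<dots> \<le> 2 / cmod (z - 1)"
      using norm_triangle_ineq4[of "z ^ Suc N" 1] assms by (intro divide_right_mono) (auto simp: norm_power simp del: power_Suc)
    finally show "norm ((1 / of_nat (Suc N)) * (\<Sum>j<Suc N. z ^ j)) \<le> (2 / cmod (z - 1)) * inverse (real (Suc N))"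
      unfolding norm_mult cmod_inverse_Suc mult.commute[of "2 / cmod (z - 1)"] by (rule mult_left_mono) simp
  qed
  show "(\<lambda>N. (2 / cmod (z - 1)) * inverse (real (Suc N))) \<longlonglongrightarrow> 0"
    by (intro tendsto_mult_right_zero LIMSEQ_inverse_real_of_nat)
qed

lemma geometric_average_bound:
  fixes z :: complex
  assumes "cmod z = 1"
  shows "cmod ((1 / of_nat (Suc N)) * (\<Sum>j<Suc N. z ^ j)) \<le> 1"
proof -
  have "cmod (\<Sum>j<Suc N. z ^ j) \<le> (\<Sum>j<Suc N. cmod (z ^ j))" by (rule norm_sum)
  also have "\<dots> = real (Suc N)" using assms by (simp add: norm_power)
  finally have "inverse (real (Suc N)) * cmod (\<Sum>j<Suc N. z ^ j) \<le> inverse (real (Suc N)) * real (Suc N)"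
    by (rule mult_left_mono) simp
  then show ?thesis unfolding norm_mult cmod_inverse_Suc by simp
qed

text \<open>The mean ergodic argument: the Cesaro means of \<open>z^j\<close> tend to zero pointwise, those of the
  corresponding vectors in norm, since they telescope.\<close>

lemma isometric_ergodic_extension:
  assumes iso: "isometric \<mu> S"
    and ext: "\<And>x f. (x, f) \<in> S' \<Longrightarrow> f \<in> borel_measurable \<mu> \<and> (\<exists>z v C. z \<in> borel_measurable \<mu> \<and>
       (\<forall>\<omega>. cmod (z \<omega>) = 1 \<and> z \<omega> \<noteq> 1) \<and> (\<forall>j::nat. norm (v j) \<le> C) \<and> x = v 0 - v 1 \<and>
       (\<forall>j. ((v j - v (Suc j)) - (v (Suc j) - v (Suc (Suc j))), \<lambda>\<omega>. f \<omega> * z \<omega> ^ j - f \<omega> * z \<omega> ^ Suc j) \<in> pair_span S))"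
  shows "isometric \<mu> S'"
proof (rule isometric_limit[OF isometric_pair_span[OF iso]])
  fix x f assume xf: "(x, f) \<in> S'"
  from ext[OF xf] obtain z v C where [measurable]: "f \<in> borel_measurable \<mu>" "z \<in> borel_measurable \<mu>"
    and z: "\<And>\<omega>. cmod (z \<omega>) = 1" "\<And>\<omega>. z \<omega> \<noteq> 1" and v: "\<And>j::nat. norm (v j) \<le> C" "x = v 0 - v 1"
    and sp: "\<And>j. ((v j - v (Suc j)) - (v (Suc j) - v (Suc (Suc j))), \<lambda>\<omega>. f \<omega> * z \<omega> ^ j - f \<omega> * z \<omega> ^ Suc j) \<in> pair_span S"
    by (elim conjE exE) blast
  define X where "X N = x - (1 / of_nat (Suc N)) *\<^sub>C (\<Sum>j<Suc N. v j - v (Suc j))" for N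
  define F where "F N \<omega> = f \<omega> - f \<omega> * ((1 / of_nat (Suc N)) * (\<Sum>j<Suc N. z \<omega> ^ j))" for N \<omega>
  \<comment> \<open>The differences v_j - v_(j+1) play the role of the vectors U^j x. The vector x
    need not be in the span, but x - U^j x is, as a sum of second differences of v. Averaging over j
    gives \<open>X N\<close>, which falls short of x only by a telescoping mean.\<close>
  have d: "(x - (v j - v (Suc j)), \<lambda>\<omega>. f \<omega> - f \<omega> * z \<omega> ^ j) \<in> pair_span S" for j
  proof (induction j)
    case 0
    then show ?case by (simp add: v pair_span.zero)
  next
    case (Suc j)
    from pair_span_add[OF Suc sp[of j]] show ?case by (simp add: algebra_simps)
  qed
  have "(X N, F N) \<in> pair_span S" for N
  proof -
    have "((1 / of_nat (Suc N)) *\<^sub>C (\<Sum>j<Suc N. x - (v j - v (Suc j))),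
        \<lambda>\<omega>. (1 / of_nat (Suc N)) * (\<Sum>j<Suc N. f \<omega> - f \<omega> * z \<omega> ^ j)) \<in> pair_span S"
      by (intro pair_span_scale pair_span_sum d)
    moreover have "(1 / of_nat (Suc N)) *\<^sub>C (\<Sum>j<Suc N. x - (v j - v (Suc j))) = X N"
    proof -
      have "(\<Sum>j<Suc N. x) = of_nat (Suc N) *\<^sub>C x"
        by (simp add: sum_constant_scaleR scaleC_of_real[symmetric] del: sum.lessThan_Suc)
      then show ?thesis unfolding X_def sum_subtractf[of "\<lambda>_. x"] complex_vector.scale_right_diff_distrib
        by (simp add: scaleC_scaleC scaleC_one del: sum.lessThan_Suc of_nat_Suc)
    qed
    moreover have "(1 / of_nat (Suc N)) * (\<Sum>j<Suc N. f \<omega> - f \<omega> * z \<omega> ^ j) = F N \<omega>" for \<omega>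
      unfolding F_def sum_subtractf[of "\<lambda>_. f \<omega>"] right_diff_distrib
      by (simp add: sum_distrib_left[symmetric] mult.left_commute del: sum.lessThan_Suc of_nat_Suc)
    ultimately show ?thesis by (simp only:)
  qed
  moreover have "X \<longlonglongrightarrow> x"
    using tendsto_diff[OF tendsto_const telescoping_average_tendsto[of v C, OF v(1)], of x] by (simp add: X_def[abs_def])
  moreover have "(\<lambda>n. F n \<omega>) \<longlonglongrightarrow> f \<omega>" for \<omega>
    using tendsto_diff[OF tendsto_const tendsto_mult_right_zero[OF geometric_average_tendsto[OF z(1) z(2)]], of "f \<omega>" "f \<omega>"]
    by (simp add: F_def[abs_def])
  moreover have "cmod (F n \<omega>) \<le> 2 * cmod (f \<omega>)" for n \<omega>
  proof -
    have "cmod (F n \<omega>) \<le> cmod (f \<omega>) + cmod (f \<omega>) * cmod ((1 / of_nat (Suc n)) * (\<Sum>j<Suc n. z \<omega> ^ j))"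
      unfolding F_def norm_mult[of "f \<omega>", symmetric] by (rule norm_triangle_ineq4)
    also have "\<dots> \<le> cmod (f \<omega>) + cmod (f \<omega>) * 1"
      by (intro add_left_mono mult_left_mono geometric_average_bound z) simp
    finally show ?thesis by simp
  qed
  moreover have "F n \<in> borel_measurable \<mu>" for n unfolding F_def by measurable
  ultimately show "f \<in> borel_measurable \<mu> \<and> (\<exists>X F. (\<forall>n::nat. (X n, F n) \<in> pair_span S) \<and> X \<longlonglongrightarrow> x \<and>
        (\<forall>z. (\<lambda>n. F n z) \<longlonglongrightarrow> f z) \<and> (\<forall>n z. cmod (F n z) \<le> 2 * cmod (f z)) \<and> (\<forall>n. F n \<in> borel_measurable \<mu>))"
    using \<open>f \<in> borel_measurable \<mu>\<close> by blast
qed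

text \<open>Induction on the defect -(m + k + l), and at defect 0 on m. The rules \<open>up\<close>
  and \<open>down\<close> have the same premises because x f and f are both combinations of (x + i)
  f and (x - i) f; \<open>up\<close> keeps the degree of its premises and \<open>down\<close> lowers
  it by one.\<close>

lemma order_induct:
  fixes Q :: "nat \<Rightarrow> int \<Rightarrow> int \<Rightarrow> bool"
  assumes base: "\<And>l. Q 0 (- l) l"
    and up: "\<And>m k l. Q m (k + 1) l \<Longrightarrow> Q m k (l + 1) \<Longrightarrow> Q (Suc m) k l"
    and down: "\<And>m k l. Q m (k + 1) l \<Longrightarrow> Q m k (l + 1) \<Longrightarrow> Q m k l"
    and "int m + k + l \<le> 0"
  shows "Q m k l"
  using assms(4)
proof (induction "nat (- (int m + k + l))" arbitrary: k l)
  case 0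
  then have "int m + k + l = 0" by simp
  then show ?case
  proof (induction m arbitrary: k l)
    case 0
    then have "k = - l" by simp
    then show ?case using base by simp
  next
    case (Suc m)
    then show ?case by (intro up) simp_all
  qed
next
  case (Suc d)
  then have d: "d = nat (- (int m + (k + 1) + l))" "d = nat (- (int m + k + (l + 1)))"
    "int m + (k + 1) + l \<le> 0" "int m + k + (l + 1) \<le> 0" by linarith+
  show ?case by (rule down; rule Suc.hyps(1)) (use d in auto)
qed

section \<open>Cayley transforms of the coordinates\<close>

lemma rat_fun_shift: "rat_fun m (k - int j) (l + int j) x = rat_fun m k l x * ((of_real x - \<i>) / (of_real x + \<i>)) ^ j"
proof -
  have "rat_fun 0 (- int j) (int j) x = ((of_real x - \<i>) / (of_real x + \<i>)) ^ j"
    by (simp add: rat_fun_def power_int_minus divide_inverse power_mult_distrib power_inverse mult.commute)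
  then show ?thesis using rat_fun_add[of m 0 k "- int j" l "int j" x] by simp
qed

text \<open>Supplies the data for the ergodic extension in one coordinate \<open>p\<close>, the
  other being frozen in the factor \<open>g\<close>; with abstract \<open>Hx\<close> and
  \<open>Fx\<close> it serves both coordinates. The orbit v_j belongs to (x + i) f z^j / (2i). The
  pairs required in \<open>S\<close> have degree one less than the new pair, since 1 - z = 2i / (x +
  i).\<close>

lemma cayley_extension:
  fixes Hx :: "nat \<Rightarrow> int \<Rightarrow> int \<Rightarrow> 'h::chilbert_space"
  assumes dH: "\<And>m k l. Hx m (k + 1) l - Hx m k (l + 1) = (2 * \<i>) *\<^sub>C Hx m k l"
    and nH: "\<And>j. norm (Hx m (k + 1 - int j) (l + int j)) \<le> C"
    and F: "\<And>m k l \<omega>. Fx m k l \<omega> = rat_fun m k l (p \<omega>) * g \<omega>"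
    and meas [measurable]: "Fx m k l \<in> borel_measurable \<mu>" "p \<in> borel_measurable \<mu>"
    and S: "\<And>j. (Hx m (k - 1 - int j) (l + int j), Fx m (k - 1 - int j) (l + int j)) \<in> S"
  shows "Fx m k l \<in> borel_measurable \<mu> \<and> (\<exists>z v C. z \<in> borel_measurable \<mu> \<and>
       (\<forall>\<omega>. cmod (z \<omega>) = 1 \<and> z \<omega> \<noteq> 1) \<and> (\<forall>j::nat. norm (v j) \<le> C) \<and> Hx m k l = v 0 - v 1 \<and>
       (\<forall>j. ((v j - v (Suc j)) - (v (Suc j) - v (Suc (Suc j))), \<lambda>\<omega>. Fx m k l \<omega> * z \<omega> ^ j - Fx m k l \<omega> * z \<omega> ^ Suc j) \<in> pair_span S))"
proof -
  define z where "z \<omega> = (of_real (p \<omega>) - \<i>) / (of_real (p \<omega>) + \<i>)" for \<omega>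
  define v where "v j = (1 / (2 * \<i>)) *\<^sub>C Hx m (k + 1 - int j) (l + int j)" for j
  have dv: "v j - v (Suc j) = Hx m (k - int j) (l + int j)" for j
  proof -
    have "v j - v (Suc j) = (1 / (2 * \<i>)) *\<^sub>C (Hx m (k - int j + 1) (l + int j) - Hx m (k - int j) (l + int j + 1))"
      by (simp add: v_def complex_vector.scale_right_diff_distrib algebra_simps)
    then show ?thesis unfolding dH by (simp add: scaleC_scaleC scaleC_one)
  qed
  have ne: "z \<omega> \<noteq> 1" for \<omega>
  proof
    assume "z \<omega> = 1"
    then have "complex_of_real (p \<omega>) - \<i> = of_real (p \<omega>) + \<i>" unfolding z_def divide_eq_1_iff by blast
    then show False by (simp add: complex_eq_iff)
  qed
  have nz: "cmod (z \<omega>) = 1" for \<omega>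
  proof -
    have "cmod (of_real (p \<omega>) - \<i>) = cmod (of_real (p \<omega>) + \<i>)" by (simp add: cmod_def)
    then show ?thesis unfolding z_def norm_divide by simp
  qed
  have Fz: "Fx m k l \<omega> * z \<omega> ^ j = Fx m (k - int j) (l + int j) \<omega>" for j \<omega>
    unfolding F rat_fun_shift z_def by simp
  have "(v j - v (Suc j) - (v (Suc j) - v (Suc (Suc j))), \<lambda>\<omega>. Fx m k l \<omega> * z \<omega> ^ j - Fx m k l \<omega> * z \<omega> ^ Suc j) \<in> pair_span S" for j
  proof -
    from pair_span_scale[OF pair_span_base[OF S[of j]], of "2 * \<i>"]
    have "((2 * \<i>) *\<^sub>C Hx m (k - 1 - int j) (l + int j), \<lambda>\<omega>. 2 * \<i> * Fx m (k - 1 - int j) (l + int j) \<omega>) \<in> pair_span S" .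
    moreover have "(2 * \<i>) *\<^sub>C Hx m (k - 1 - int j) (l + int j) = v j - v (Suc j) - (v (Suc j) - v (Suc (Suc j)))"
      unfolding dv dH[symmetric] by (simp add: algebra_simps)
    moreover have "2 * \<i> * Fx m (k - 1 - int j) (l + int j) \<omega> = Fx m k l \<omega> * z \<omega> ^ j - Fx m k l \<omega> * z \<omega> ^ Suc j" for \<omega>
    proof -
      have "rat_fun m (k - int j) (l + int j) x - rat_fun m (k - int (Suc j)) (l + int (Suc j)) x
          = 2 * \<i> * rat_fun m (k - 1 - int j) (l + int j) x" for x
        using rat_fun_Suc(1)[of m "k - 1 - int j" "l + int j" x] rat_fun_Suc(2)[of m "k - 1 - int j" "l + int j" x]
        by (simp add: algebra_simps)
      note this[of "p \<omega>"]
      then show ?thesis unfolding Fz unfolding F left_diff_distrib[symmetric] by (simp only: mult.assoc)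
    qed
    ultimately show ?thesis by (simp only:)
  qed
  moreover have "norm (v j) \<le> C / 2" for j
    unfolding v_def norm_scaleC using nH[of j] by (simp add: norm_divide norm_mult)
  moreover have "Hx m k l = v 0 - v 1" using dv[of 0] by simp
  moreover have "z \<in> borel_measurable \<mu>" unfolding z_def by measurable
  ultimately show ?thesis using meas(1) ne nz by blast
qed

text \<open>The Cesaro means of Z^j converge pointwise to the indicator of Z = 1, while the vectors
  paired with them telescope to 0. By the isometry the indicator has integral 0.\<close>

lemma AE_ne_1:
  fixes Z :: "'a \<Rightarrow> complex"
  assumes "finite_measure \<mu>" and iso: "isometric \<mu> S"
    and [measurable]: "Z \<in> borel_measurable \<mu>" and Z: "\<And>\<omega>. cmod (Z \<omega>) = 1"
    and v: "\<And>j. (v j - v (Suc j), \<lambda>\<omega>. Z \<omega> ^ j) \<in> S" "\<And>j::nat. norm (v j) \<le> C"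
  shows "AE \<omega> in \<mu>. Z \<omega> \<noteq> 1"
proof -
  interpret finite_measure \<mu> by fact
  let ?X = "\<lambda>N. (1 / of_nat (Suc N)) *\<^sub>C (\<Sum>j<Suc N. v j - v (Suc j))"
  let ?A = "\<lambda>N \<omega>. (1 / of_nat (Suc N)) * (\<Sum>j<Suc N. Z \<omega> ^ j)"
  have mem: "(?X N, ?A N) \<in> pair_span S" for N
    by (intro pair_span_scale pair_span_sum pair_span_base v)
  have [measurable]: "{\<omega>\<in>space \<mu>. Z \<omega> = 1} \<in> sets \<mu>" by measurable
  have "(\<lambda>N. (norm (?X N))\<^sup>2) \<longlonglongrightarrow> 0"
    using tendsto_power[OF tendsto_norm[OF telescoping_average_tendsto[of v C, OF v(2)]], of 2] by simp
  then have 1: "(\<lambda>N. \<integral>\<omega>. (cmod (?A N \<omega>))\<^sup>2 \<partial>\<mu>) \<longlonglongrightarrow> 0"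
    unfolding isometric_norm(2)[OF isometric_pair_span[OF iso] mem] .
  have 2: "(\<lambda>N. \<integral>\<omega>. (cmod (?A N \<omega>))\<^sup>2 \<partial>\<mu>) \<longlonglongrightarrow> (\<integral>\<omega>. indicator {\<omega>\<in>space \<mu>. Z \<omega> = 1} \<omega> \<partial>\<mu>)"
  proof (rule integral_dominated_convergence[where w = "\<lambda>_. 1"])
    show "AE \<omega> in \<mu>. (\<lambda>N. (cmod (?A N \<omega>))\<^sup>2) \<longlonglongrightarrow> indicator {\<omega>\<in>space \<mu>. Z \<omega> = 1} \<omega>"
    proof (rule AE_I2)
      fix \<omega> assume \<omega>: "\<omega> \<in> space \<mu>"
      show "(\<lambda>N. (cmod (?A N \<omega>))\<^sup>2) \<longlonglongrightarrow> indicator {\<omega>\<in>space \<mu>. Z \<omega> = 1} \<omega>"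
      proof (cases "Z \<omega> = 1")
        case True
        then have "?A N \<omega> = 1" for N by (simp del: of_nat_Suc)
        then show ?thesis using True \<omega> by simp
      next
        case False
        then show ?thesis
          using tendsto_power[OF tendsto_norm[OF geometric_average_tendsto[OF Z False]], of 2] by simp
      qed
    qed
    show "AE \<omega> in \<mu>. norm ((cmod (?A N \<omega>))\<^sup>2) \<le> 1" for N
    proof (rule AE_I2)
      fix \<omega>
      have "(cmod (?A N \<omega>))\<^sup>2 \<le> 1\<^sup>2" by (intro power_mono geometric_average_bound Z) simp
      then show "norm ((cmod (?A N \<omega>))\<^sup>2) \<le> 1" by simp
    qed
  qed simp_all
  have "measure \<mu> {\<omega>\<in>space \<mu>. Z \<omega> = 1} = 0"
    using LIMSEQ_unique[OF 1 2] by simp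
  then have "AE \<omega> in \<mu>. \<omega> \<notin> {\<omega>\<in>space \<mu>. Z \<omega> = 1}"
    by (intro AE_not_in) (simp add: null_sets_def emeasure_eq_measure)
  then show ?thesis using AE_space by eventually_elim simp
qed

text \<open>The inverse of x \<mapsto> (x - i)/(x + i). On the unit circle without the point 1 the
  quotient is already real; taking \<open>Re\<close> only gives it a real type.\<close>

definition inverse_cayley :: "complex \<Rightarrow> real" where
  "inverse_cayley z = Re (\<i> * (1 + z) / (1 - z))"

lemma inverse_cayley:
  assumes "cmod z = 1" "z \<noteq> 1"
  shows "rat_fun 0 (- a) a (inverse_cayley z) = z powi a"
proof -
  have zz: "z * cnj z = 1" using assms(1) by (metis complex_norm_square of_real_1 power_one)
  have z0: "z \<noteq> 0" using assms by auto
  \<comment> \<open>On the circle conjugation is inversion, and the quotient is invariant under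
    it.\<close>
  have "cnj (\<i> * (1 + z) / (1 - z)) = \<i> * (1 + z) / (1 - z)"
  proof -
    have c: "cnj z = 1 / z" using zz z0 by (simp add: field_simps)
    show ?thesis using assms(2) z0 by (simp add: c divide_simps) (simp add: algebra_simps)
  qed
  then have "\<i> * (1 + z) / (1 - z) \<in> \<real>" by (simp add: complex_cnj_cancel_iff Reals_cnj_iff)
  then have x: "complex_of_real (inverse_cayley z) = \<i> * (1 + z) / (1 - z)"
    by (simp add: inverse_cayley_def of_real_Re)
  have 1: "complex_of_real (inverse_cayley z) + \<i> = 2 * \<i> / (1 - z)"
    "complex_of_real (inverse_cayley z) - \<i> = z * (2 * \<i> / (1 - z))"
    unfolding x using assms(2) by (simp_all add: divide_simps) (simp_all add: algebra_simps)
  have "rat_fun 0 (- a) a (inverse_cayley z) = (2 * \<i> / (1 - z)) powi (- a) * (z powi a * (2 * \<i> / (1 - z)) powi a)"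
    unfolding rat_fun_def 1 by (simp only: power_int_mult_distrib) simp
  also have "\<dots> = z powi a" using assms(2) by (simp add: power_int_minus)
  finally show ?thesis .
qed

lemma isometric_rangeI:
  assumes "\<And>i j. integrable \<mu> (\<lambda>z. f i z * cnj (f j z)) \<and> cinner (x i) (x j) = (\<integral>z. f i z * cnj (f j z) \<partial>\<mu>)"
  shows "isometric \<mu> (range (\<lambda>i. (x i, f i)))"
  unfolding isometric_def using assms by blast

section \<open>The representing measure of a Gram family\<close>

context gram_family
begin

abbreviation "x0 \<equiv> H (0, 0, 0, 0, 0, 0)"

lemma diff1: "H (m, k + 1, l, n, r, t) - H (m, k, l + 1, n, r, t) = (2 * \<i>) *\<^sub>C H (m, k, l, n, r, t)"
  unfolding rel1[symmetric] rel2[symmetric] by (simp add: complex_vector.scale_left_distrib[symmetric])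

lemma diff2: "H (m, k, l, n, r + 1, t) - H (m, k, l, n, r, t + 1) = (2 * \<i>) *\<^sub>C H (m, k, l, n, r, t)"
  unfolding rel3[symmetric] rel4[symmetric] by (simp add: complex_vector.scale_left_distrib[symmetric])

text \<open>The shift corresponds to multiplication by a power of the unimodular function z. In
  terms of indices, u combined with itself contains k + l only as a sum.\<close>

lemma norm_shift:
  "norm (H (m, k - j, l + j, n, r, t)) = norm (H (m, k, l, n, r, t))"
  "norm (H (m, k, l, n, r - j, t + j)) = norm (H (m, k, l, n, r, t))"
proof -
  have "norm (H u) = norm (H v)" if "idx_mult_cnj u u = idx_mult_cnj v v" for u v
  proof -
    have "cinner (H u) (H u) = cinner (H v) (H v)" by (simp only: gram[of u u] gram[of v v] that)
    then show ?thesis by (simp add: cinner_self del: of_real_power)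
  qed
  then show "norm (H (m, k - j, l + j, n, r, t)) = norm (H (m, k, l, n, r, t))"
    "norm (H (m, k, l, n, r - j, t + j)) = norm (H (m, k, l, n, r, t))" by simp_all
qed

text \<open>The vectors indexed by Cayley monomials have a Gram matrix depending on differences
  only, hence give a positive definite function. Dividing by R, the squared norm of
  \<open>x0\<close>, makes its value at 0 equal to 1, and the resulting probability measure is
  scaled back by R.\<close>

lemma torus_measure:
  assumes "x0 \<noteq> 0"
  obtains \<nu> :: "real measure" and Z W :: "real \<Rightarrow> complex"
  where "finite_measure \<nu>" "sets \<nu> = sets borel" "Z \<in> borel_measurable borel" "W \<in> borel_measurable borel"
    "\<And>x. cmod (Z x) = 1" "\<And>x. cmod (W x) = 1"
    "\<And>a b. (\<integral>x. Z x powi a * W x powi b \<partial>\<nu>) = cinner (H (0, - a, a, 0, - b, b)) x0"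
proof -
  define R where "R = (norm x0)\<^sup>2"
  have R: "R > 0" using assms by (simp add: R_def)
  define c where "c a b = cinner (H (0, - a, a, 0, - b, b)) x0 / of_real R" for a b
  have gr: "cinner (H (0, - a, a, 0, - b, b)) (H (0, - a', a', 0, - b', b')) = of_real R * c (a - a') (b - b')" for a b a' b'
    using R unfolding c_def by (subst gram) (simp add: algebra_simps)
  have "(\<Sum>a<N. \<Sum>b<N. \<Sum>a'<N. \<Sum>b'<N. \<gamma> a b * cnj (\<gamma> a' b') * c (int a - int a') (int b - int b')) \<in> \<real>\<^sub>\<ge>\<^sub>0" for N \<gamma>
  proof -
    let ?y = "\<Sum>a<N. \<Sum>b<N. \<gamma> a b *\<^sub>C H (0, - int a, int a, 0, - int b, int b)"
    have "cinner ?y ?y = (\<Sum>a<N. \<Sum>b<N. \<gamma> a b * cinner (H (0, - int a, int a, 0, - int b, int b)) ?y)"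
      by (simp only: cinner_sum_left cinner_scaleC_left)
    also have "\<dots> = (\<Sum>a<N. \<Sum>b<N. \<gamma> a b * (\<Sum>a'<N. \<Sum>b'<N. cnj (\<gamma> a' b') * (of_real R * c (int a - int a') (int b - int b'))))"
      by (simp only: cinner_sum_right cinner_scaleC_right gr)
    also have "\<dots> = of_real R * (\<Sum>a<N. \<Sum>b<N. \<Sum>a'<N. \<Sum>b'<N. \<gamma> a b * cnj (\<gamma> a' b') * c (int a - int a') (int b - int b'))"
      unfolding sum_distrib_left by (intro sum.cong refl) (simp only: mult_ac)
    finally have "(\<Sum>a<N. \<Sum>b<N. \<Sum>a'<N. \<Sum>b'<N. \<gamma> a b * cnj (\<gamma> a' b') * c (int a - int a') (int b - int b')) = of_real ((norm ?y)\<^sup>2 / R)"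
      using R by (simp only: cinner_self of_real_divide) (simp add: field_simps)
    then show ?thesis using R by (simp del: of_real_divide)
  qed
  moreover have "c 0 0 = 1" using R unfolding c_def R_def by (simp add: cinner_self)
  ultimately obtain \<nu> :: "real measure" and Z W where \<nu>: "prob_space \<nu>" "sets \<nu> = sets borel" "continuous_on UNIV Z" "continuous_on UNIV W"
    "\<And>x. cmod (Z x) = 1" "\<And>x. cmod (W x) = 1"
    "\<And>s t. (\<integral>x. Z x powi s * W x powi t \<partial>\<nu>) = c s t"
    by (rule trigonometric_moments_torus) blast
  have [measurable]: "Z \<in> borel_measurable borel" "W \<in> borel_measurable borel"
    using \<nu>(3,4) by (auto intro: borel_measurable_continuous_onI)
  interpret prob_space \<nu> by fact
  let ?\<nu> = "density \<nu> (\<lambda>_. ennreal R)"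
  show ?thesis
  proof (rule that)
    show "finite_measure ?\<nu>"
      by (rule finite_measureI) (simp add: emeasure_density emeasure_space_1 ennreal_mult_eq_top_iff)
    show "sets ?\<nu> = sets borel" using \<nu>(2) by simp
    fix a b :: int
    have "(\<lambda>x. Z x powi a * W x powi b) \<in> borel_measurable \<nu>"
    proof -
      have "continuous_on UNIV (\<lambda>x. Z x powi a * W x powi b)"
        using \<nu>(5,6) by (intro continuous_intros \<nu>(3,4)) (metis norm_zero zero_neq_one)+
      then show ?thesis using \<nu>(2) by (simp add: borel_measurable_continuous_onI cong: measurable_cong_sets)
    qed
    then have "(\<integral>x. Z x powi a * W x powi b \<partial>?\<nu>) = (\<integral>x. R *\<^sub>R (Z x powi a * W x powi b) \<partial>\<nu>)"
      using R by (intro integral_density) auto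
    also have "\<dots> = of_real R * c a b" using \<nu>(7)[of a b] by (simp add: scaleR_conv_of_real)
    also have "\<dots> = cinner (H (0, - a, a, 0, - b, b)) x0" using R by (simp add: c_def)
    finally show "(\<integral>x. Z x powi a * W x powi b \<partial>?\<nu>) = cinner (H (0, - a, a, 0, - b, b)) x0" .
  qed (use \<nu>(5,6) in auto)
qed

text \<open>A filtration by degree in each variable. At level 0 the functions are bounded and
  spanned by monomials in the Cayley transforms; each ergodic extension raises one of the two bounds
  by 1.\<close>

definition order_pairs :: "int \<Rightarrow> int \<Rightarrow> ('h \<times> (real \<times> real \<Rightarrow> complex)) set" where
  "order_pairs A B = {(H (m, k, l, n, r, t), idx_fun (m, k, l, n, r, t)) | m k l n r t.
     int m + k + l \<le> A \<and> int n + r + t \<le> B}"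

lemma order_pairsI:
  "int m + k + l \<le> A \<Longrightarrow> int n + r + t \<le> B \<Longrightarrow> (H (m, k, l, n, r, t), idx_fun (m, k, l, n, r, t)) \<in> order_pairs A B"
  unfolding order_pairs_def by blast

lemma order_pairs_step1:
  assumes \<mu>: "sets \<mu> = sets borel" and iso: "isometric \<mu> (order_pairs A B)"
  shows "isometric \<mu> (order_pairs (A + 1) B)"
proof (rule isometric_ergodic_extension[OF iso])
  fix x f assume "(x, f) \<in> order_pairs (A + 1) B"
  then obtain m k l n r t where xf: "x = H (m, k, l, n, r, t)" "f = idx_fun (m, k, l, n, r, t)"
    and o: "int m + k + l \<le> A + 1" "int n + r + t \<le> B" unfolding order_pairs_def by blast
  note [measurable_cong] = \<mu>
  show "f \<in> borel_measurable \<mu> \<and> (\<exists>z v C. z \<in> borel_measurable \<mu> \<and>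
       (\<forall>\<omega>. cmod (z \<omega>) = 1 \<and> z \<omega> \<noteq> 1) \<and> (\<forall>j::nat. norm (v j) \<le> C) \<and> x = v 0 - v 1 \<and>
       (\<forall>j. ((v j - v (Suc j)) - (v (Suc j) - v (Suc (Suc j))), \<lambda>\<omega>. f \<omega> * z \<omega> ^ j - f \<omega> * z \<omega> ^ Suc j) \<in> pair_span (order_pairs A B)))"
    unfolding xf
  proof (rule cayley_extension[where Hx = "\<lambda>m k l. H (m, k, l, n, r, t)" and Fx = "\<lambda>m k l. idx_fun (m, k, l, n, r, t)"
        and p = fst and g = "\<lambda>z. rat_fun n r t (snd z)" and C = "norm (H (m, k + 1, l, n, r, t))"])
    show "(fst :: real \<times> real \<Rightarrow> real) \<in> borel_measurable \<mu>"
      unfolding measurable_cong_sets[OF \<mu> refl] borel_prod[symmetric] by measurable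
    show "idx_fun (m, k, l, n, r, t) \<omega> = rat_fun m k l (fst \<omega>) * rat_fun n r t (snd \<omega>)" for m k l \<omega>
      by simp
  qed (use o in \<open>auto simp: diff1 norm_shift simp del: idx_fun.simps intro!: order_pairsI\<close>)
qed

lemma order_pairs_step2:
  assumes \<mu>: "sets \<mu> = sets borel" and iso: "isometric \<mu> (order_pairs A B)"
  shows "isometric \<mu> (order_pairs A (B + 1))"
proof (rule isometric_ergodic_extension[OF iso])
  fix x f assume "(x, f) \<in> order_pairs A (B + 1)"
  then obtain m k l n r t where xf: "x = H (m, k, l, n, r, t)" "f = idx_fun (m, k, l, n, r, t)"
    and o: "int m + k + l \<le> A" "int n + r + t \<le> B + 1" unfolding order_pairs_def by blast
  note [measurable_cong] = \<mu>
  show "f \<in> borel_measurable \<mu> \<and> (\<exists>z v C. z \<in> borel_measurable \<mu> \<and>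
       (\<forall>\<omega>. cmod (z \<omega>) = 1 \<and> z \<omega> \<noteq> 1) \<and> (\<forall>j::nat. norm (v j) \<le> C) \<and> x = v 0 - v 1 \<and>
       (\<forall>j. ((v j - v (Suc j)) - (v (Suc j) - v (Suc (Suc j))), \<lambda>\<omega>. f \<omega> * z \<omega> ^ j - f \<omega> * z \<omega> ^ Suc j) \<in> pair_span (order_pairs A B)))"
    unfolding xf
  proof (rule cayley_extension[where Hx = "\<lambda>n r t. H (m, k, l, n, r, t)" and Fx = "\<lambda>n r t. idx_fun (m, k, l, n, r, t)"
        and p = snd and g = "\<lambda>z. rat_fun m k l (fst z)" and C = "norm (H (m, k, l, n, r + 1, t))"])
    show "(snd :: real \<times> real \<Rightarrow> real) \<in> borel_measurable \<mu>"
      unfolding measurable_cong_sets[OF \<mu> refl] borel_prod[symmetric] by measurable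
    show "idx_fun (m, k, l, n, r, t) \<omega> = rat_fun n r t (snd \<omega>) * rat_fun m k l (fst \<omega>)" for n r t \<omega>
      by simp
  qed (use o in \<open>auto simp: diff2 norm_shift simp del: idx_fun.simps intro!: order_pairsI\<close>)
qed

text \<open>Half the sum of x + i and x - i is x, and their difference divided by 2i is 1; the same
  holds on the side of the vectors. These are the rules \<open>up\<close> and \<open>down\<close> of
  \<open>order_induct\<close>.\<close>

lemma pair_span_mean1:
  assumes "(H (m, k + 1, l, n, r, t), idx_fun (m, k + 1, l, n, r, t)) \<in> pair_span S"
    "(H (m, k, l + 1, n, r, t), idx_fun (m, k, l + 1, n, r, t)) \<in> pair_span S"
  shows "(H (Suc m, k, l, n, r, t), idx_fun (Suc m, k, l, n, r, t)) \<in> pair_span S"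
    "(H (m, k, l, n, r, t), idx_fun (m, k, l, n, r, t)) \<in> pair_span S"
proof -
  have "(1 / 2) *\<^sub>C (H (m, k + 1, l, n, r, t) + H (m, k, l + 1, n, r, t)) = H (Suc m, k, l, n, r, t)"
  proof -
    have "H (m, k + 1, l, n, r, t) + H (m, k, l + 1, n, r, t) = (1 + 1) *\<^sub>C H (Suc m, k, l, n, r, t)"
      unfolding rel1[symmetric] rel2[symmetric] scaleC_add_left by (simp add: scaleC_one)
    then show ?thesis by (simp add: scaleC_scaleC scaleC_one)
  qed
  moreover have "(1 / 2) * (idx_fun (m, k + 1, l, n, r, t) z + idx_fun (m, k, l + 1, n, r, t) z) = idx_fun (Suc m, k, l, n, r, t) z" for z
    by (simp only: idx_fun.simps fst_conv snd_conv rat_fun_Suc[symmetric]) (simp add: algebra_simps)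
  ultimately show "(H (Suc m, k, l, n, r, t), idx_fun (Suc m, k, l, n, r, t)) \<in> pair_span S"
    using pair_span_scale[OF pair_span_add[OF assms], of "1 / 2"] by (simp only:)
  have "(1 / (2 * \<i>)) *\<^sub>C (H (m, k + 1, l, n, r, t) - H (m, k, l + 1, n, r, t)) = H (m, k, l, n, r, t)"
    unfolding diff1 by (simp add: scaleC_scaleC scaleC_one)
  moreover have "(1 / (2 * \<i>)) * (idx_fun (m, k + 1, l, n, r, t) z - idx_fun (m, k, l + 1, n, r, t) z) = idx_fun (m, k, l, n, r, t) z" for z
    by (simp only: idx_fun.simps fst_conv snd_conv rat_fun_Suc[symmetric]) (simp add: algebra_simps)
  ultimately show "(H (m, k, l, n, r, t), idx_fun (m, k, l, n, r, t)) \<in> pair_span S"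
    using pair_span_scale[OF pair_span_diff[OF assms], of "1 / (2 * \<i>)"] by (simp only:)
qed

lemma pair_span_mean2:
  assumes "(H (m, k, l, n, r + 1, t), idx_fun (m, k, l, n, r + 1, t)) \<in> pair_span S"
    "(H (m, k, l, n, r, t + 1), idx_fun (m, k, l, n, r, t + 1)) \<in> pair_span S"
  shows "(H (m, k, l, Suc n, r, t), idx_fun (m, k, l, Suc n, r, t)) \<in> pair_span S"
    "(H (m, k, l, n, r, t), idx_fun (m, k, l, n, r, t)) \<in> pair_span S"
proof -
  have "(1 / 2) *\<^sub>C (H (m, k, l, n, r + 1, t) + H (m, k, l, n, r, t + 1)) = H (m, k, l, Suc n, r, t)"
  proof -
    have "H (m, k, l, n, r + 1, t) + H (m, k, l, n, r, t + 1) = (1 + 1) *\<^sub>C H (m, k, l, Suc n, r, t)"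
      unfolding rel3[symmetric] rel4[symmetric] scaleC_add_left by (simp add: scaleC_one)
    then show ?thesis by (simp add: scaleC_scaleC scaleC_one)
  qed
  moreover have "(1 / 2) * (idx_fun (m, k, l, n, r + 1, t) z + idx_fun (m, k, l, n, r, t + 1) z) = idx_fun (m, k, l, Suc n, r, t) z" for z
    by (simp only: idx_fun.simps fst_conv snd_conv rat_fun_Suc[symmetric]) (simp add: algebra_simps)
  ultimately show "(H (m, k, l, Suc n, r, t), idx_fun (m, k, l, Suc n, r, t)) \<in> pair_span S"
    using pair_span_scale[OF pair_span_add[OF assms], of "1 / 2"] by (simp only:)
  have "(1 / (2 * \<i>)) *\<^sub>C (H (m, k, l, n, r + 1, t) - H (m, k, l, n, r, t + 1)) = H (m, k, l, n, r, t)"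
    unfolding diff2 by (simp add: scaleC_scaleC scaleC_one)
  moreover have "(1 / (2 * \<i>)) * (idx_fun (m, k, l, n, r + 1, t) z - idx_fun (m, k, l, n, r, t + 1) z) = idx_fun (m, k, l, n, r, t) z" for z
    by (simp only: idx_fun.simps fst_conv snd_conv rat_fun_Suc[symmetric]) (simp add: algebra_simps)
  ultimately show "(H (m, k, l, n, r, t), idx_fun (m, k, l, n, r, t)) \<in> pair_span S"
    using pair_span_scale[OF pair_span_diff[OF assms], of "1 / (2 * \<i>)"] by (simp only:)
qed

text \<open>The induction on the degree is run in the first variable while the second carries a
  Cayley monomial, and then in the second variable with the first index arbitrary.\<close>

lemma order_pairs_0:
  assumes "\<And>a b. (H (0, - a, a, 0, - b, b), idx_fun (0, - a, a, 0, - b, b)) \<in> S"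
  shows "order_pairs 0 0 \<subseteq> pair_span S"
proof -
  have 1: "(H (m, k, l, 0, - b, b), idx_fun (m, k, l, 0, - b, b)) \<in> pair_span S" if "int m + k + l \<le> 0" for m k l b
    using that by (rule order_induct[rotated 3]) (rule pair_span_base[OF assms] pair_span_mean1; assumption)+
  have "(H (m, k, l, n, r, t), idx_fun (m, k, l, n, r, t)) \<in> pair_span S" if "int n + r + t \<le> 0" "int m + k + l \<le> 0" for m k l n r t
    using that(1) by (rule order_induct[rotated 3]) (rule 1[OF that(2)] pair_span_mean2; assumption)+
  then show ?thesis unfolding order_pairs_def by blast
qed

text \<open>On the torus conjugation is inversion, so a product of one monomial with the conjugate
  of another is again a monomial, and \<open>mom\<close> determines all scalar products.\<close>

lemma isometric_torus:
  assumes "finite_measure \<mu>" and [measurable]: "Z \<in> borel_measurable \<mu>" "W \<in> borel_measurable \<mu>"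
    and unimodular: "\<And>x. cmod (Z x) = 1" "\<And>x. cmod (W x) = 1"
    and mom: "\<And>a b. (\<integral>x. Z x powi a * W x powi b \<partial>\<mu>) = cinner (H (0, - a, a, 0, - b, b)) x0"
  shows "isometric \<mu> (range (\<lambda>i. (H (0, - fst i, fst i, 0, - snd i, snd i), \<lambda>x. Z x powi fst i * W x powi snd i)))"
proof -
  interpret finite_measure \<mu> by fact
  have pw: "(\<lambda>x. V x powi a) \<in> borel_measurable \<mu>" if [measurable]: "V \<in> borel_measurable \<mu>" for V :: "_ \<Rightarrow> complex" and a
    by (cases a rule: int_cases2) (simp_all add: power_int_minus)
  have cn: "cnj z = inverse z" if "cmod z = 1" for z
    using that by (metis complex_norm_square inverse_unique mult.commute of_real_1 power_one)
  have nz: "Z x \<noteq> 0" "W x \<noteq> 0" for x using unimodular by (metis norm_zero zero_neq_one)+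
  have mult: "Z x powi a * W x powi b * cnj (Z x powi a' * W x powi b') = Z x powi (a - a') * W x powi (b - b')" for x a b a' b'
    by (simp add: cnj_powi cn unimodular power_int_diff nz power_int_inverse divide_inverse mult_ac)
  have int: "integrable \<mu> (\<lambda>x. Z x powi a * W x powi b)" for a b
  proof (rule integrable_const_bound[where B = 1])
    show "AE x in \<mu>. cmod (Z x powi a * W x powi b) \<le> 1"
      by (simp add: norm_mult norm_power_int unimodular)
    show "(\<lambda>x. Z x powi a * W x powi b) \<in> borel_measurable \<mu>"
      by (intro borel_measurable_times pw) measurable
  qed
  have "cinner (H (0, - a, a, 0, - b, b)) (H (0, - a', a', 0, - b', b')) = cinner (H (0, - (a - a'), a - a', 0, - (b - b'), b - b')) x0" for a b a' b'
    by (subst gram) (simp add: algebra_simps)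
  then show ?thesis by (intro isometric_rangeI) (simp only: mult int mom simp_thms)
qed

theorem representing_measure:
  obtains \<mu> where "sets \<mu> = sets borel"
    "\<And>u. integrable \<mu> (idx_fun u)" "\<And>u. (\<integral>z. idx_fun u z \<partial>\<mu>) = cinner (H u) x0"
proof (cases "x0 = 0")
  case True
  \<comment> \<open>The torus measure was normalised by the norm of \<open>x0\<close>; when that is
    zero, all prescribed integrals vanish.\<close>
  then show ?thesis by (intro that[of "null_measure borel"]) (auto simp: integrable_iff_bounded)
next
  case False
  then obtain \<nu> :: "real measure" and Z W where \<nu>: "finite_measure \<nu>" "sets \<nu> = sets borel"
    and ZW: "Z \<in> borel_measurable borel" "W \<in> borel_measurable borel"
    and unimodular: "\<And>x. cmod (Z x) = 1" "\<And>x. cmod (W x) = 1"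
    and mom: "\<And>a b. (\<integral>x. Z x powi a * W x powi b \<partial>\<nu>) = cinner (H (0, - a, a, 0, - b, b)) x0"
    by (rule torus_measure) blast
  interpret \<nu>: finite_measure \<nu> by fact
  note [measurable_cong] = \<nu>(2)
  have [measurable]: "Z \<in> borel_measurable \<nu>" "W \<in> borel_measurable \<nu>"
    using ZW by (simp_all add: measurable_cong_sets[OF \<nu>(2) refl])
  let ?S0 = "range (\<lambda>i. (H (0, - fst i, fst i, 0, - snd i, snd i), \<lambda>x. Z x powi fst i * W x powi snd i))"
  have iso0: "isometric \<nu> ?S0"
    by (rule isometric_torus[OF \<nu>(1) _ _ unimodular mom]; measurable)
  have neZ: "AE x in \<nu>. Z x \<noteq> 1"
  proof (rule AE_ne_1[OF \<nu>(1) iso0 _ unimodular(1)])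
    \<comment> \<open>\<open>H (0, 1, 0, 0, 0, 0)\<close> belongs to x1 + i, so \<open>?v 0\<close>
      belongs to (x1 + i)/(2i), the solution v of (1 - z) v = 1; \<open>?v j\<close> is its j-th
      shift.\<close>
    let ?v = "\<lambda>j. (1 / (2 * \<i>)) *\<^sub>C H (0, 1 - int j, int j, 0, 0, 0)"
    show "(?v j - ?v (Suc j), \<lambda>x. Z x ^ j) \<in> ?S0" for j
    proof -
      have "?v j - ?v (Suc j) = (1 / (2 * \<i>)) *\<^sub>C (H (0, - int j + 1, int j, 0, 0, 0) - H (0, - int j, int j + 1, 0, 0, 0))"
        by (simp add: complex_vector.scale_right_diff_distrib algebra_simps)
      then have "?v j - ?v (Suc j) = H (0, - int j, int j, 0, - 0, 0)" unfolding diff1 by (simp add: scaleC_scaleC scaleC_one)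
      moreover have "(\<lambda>x. Z x ^ j) = (\<lambda>x. Z x powi int j * W x powi 0)" by simp
      ultimately show ?thesis by (intro image_eqI[of _ _ "(int j, 0)"]) auto
    qed
    show "norm (?v j) \<le> norm (H (0, 1, 0, 0, 0, 0))" for j
      unfolding norm_scaleC using norm_shift(1)[of 0 1 "int j" 0 0 0 0] by (simp add: norm_divide norm_mult)
  qed measurable
  have neW: "AE x in \<nu>. W x \<noteq> 1"
  proof (rule AE_ne_1[OF \<nu>(1) iso0 _ unimodular(2)])
    let ?v = "\<lambda>j. (1 / (2 * \<i>)) *\<^sub>C H (0, 0, 0, 0, 1 - int j, int j)"
    show "(?v j - ?v (Suc j), \<lambda>x. W x ^ j) \<in> ?S0" for j
    proof -
      have "?v j - ?v (Suc j) = (1 / (2 * \<i>)) *\<^sub>C (H (0, 0, 0, 0, - int j + 1, int j) - H (0, 0, 0, 0, - int j, int j + 1))"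
        by (simp add: complex_vector.scale_right_diff_distrib algebra_simps)
      then have "?v j - ?v (Suc j) = H (0, - 0, 0, 0, - int j, int j)" unfolding diff2 by (simp add: scaleC_scaleC scaleC_one)
      moreover have "(\<lambda>x. W x ^ j) = (\<lambda>x. Z x powi 0 * W x powi int j)" by simp
      ultimately show ?thesis by (intro image_eqI[of _ _ "(0, int j)"]) auto
    qed
    show "norm (?v j) \<le> norm (H (0, 0, 0, 0, 1, 0))" for j
      unfolding norm_scaleC using norm_shift(2)[of 0 0 0 0 1 "int j" 0] by (simp add: norm_divide norm_mult)
  qed measurable
  define \<tau> where "\<tau> x = (inverse_cayley (Z x), inverse_cayley (W x))" for x
  define \<mu> where "\<mu> = distr \<nu> borel \<tau>"
  have \<tau> [measurable]: "\<tau> \<in> \<nu> \<rightarrow>\<^sub>M borel"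
    unfolding \<tau>_def inverse_cayley_def by (intro borel_measurable_Pair) measurable
  have \<mu>: "sets \<mu> = sets borel" by (simp add: \<mu>_def)
  interpret \<mu>: finite_measure \<mu> unfolding \<mu>_def by (rule \<nu>.finite_measure_distr[OF \<tau>])
  \<comment> \<open>The exceptional sets Z = 1 and W = 1, where the inverse Cayley transform is
    meaningless, have just been shown to be null.\<close>
  have mom': "(\<integral>z. idx_fun (0, - a, a, 0, - b, b) z \<partial>\<mu>) = cinner (H (0, - a, a, 0, - b, b)) x0" for a b
  proof -
    have "(\<integral>z. idx_fun (0, - a, a, 0, - b, b) z \<partial>\<mu>) = (\<integral>x. idx_fun (0, - a, a, 0, - b, b) (\<tau> x) \<partial>\<nu>)"
      unfolding \<mu>_def by (rule integral_distr[OF \<tau> idx_fun_measurable])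
    also have "\<dots> = (\<integral>x. Z x powi a * W x powi b \<partial>\<nu>)"
    proof (rule integral_cong_AE)
      show "AE x in \<nu>. idx_fun (0, - a, a, 0, - b, b) (\<tau> x) = Z x powi a * W x powi b"
        using neZ neW by eventually_elim (simp add: \<tau>_def inverse_cayley unimodular)
      have "(Z x powi a * W x powi b) = (Z x powi a * W x powi b) * cnj (Z x powi 0 * W x powi 0)" for x by simp
      then show "(\<lambda>x. Z x powi a * W x powi b) \<in> borel_measurable \<nu>"
        using isometricD(1)[OF iso0 rangeI[of _ "(a, b)", simplified] rangeI[of _ "(0, 0)", simplified]]
        by (simp add: borel_measurable_integrable)
    qed measurable
    finally show ?thesis using mom by simp
  qed
  let ?S = "range (\<lambda>i. (H (0, - fst i, fst i, 0, - snd i, snd i), idx_fun (0, - fst i, fst i, 0, - snd i, snd i)))"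
  have "isometric \<mu> ?S"
  proof -
    have g: "cinner (H (0, - a, a, 0, - b, b)) (H (0, - a', a', 0, - b', b')) = cinner (H (0, - (a - a'), a - a', 0, - (b - b'), b - b')) x0" for a b a' b'
      by (subst gram) (simp add: algebra_simps)
    have m: "idx_fun (0, - a, a, 0, - b, b) z * cnj (idx_fun (0, - a', a', 0, - b', b') z) = idx_fun (0, - (a - a'), a - a', 0, - (b - b'), b - b') z" for a b a' b' z
      by (simp only: idx_fun_mult_cnj idx_mult_cnj.simps) (simp add: algebra_simps)
    have "cmod (rat_fun 0 (- a) a x) = 1" for a x
    proof -
      have "rat_fun 0 (- a) a x * cnj (rat_fun 0 (- a) a x) = 1"
        by (simp only: cnj_rat_fun rat_fun_add[symmetric]) (simp add: rat_fun_def)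
      then have "complex_of_real ((cmod (rat_fun 0 (- a) a x))\<^sup>2) = of_real 1" by (simp only: complex_norm_square of_real_1)
      then have "(cmod (rat_fun 0 (- a) a x))\<^sup>2 = 1\<^sup>2" by (simp only: of_real_eq_iff power_one)
      then show ?thesis by (rule power2_eq_imp_eq) simp_all
    qed
    then have "integrable \<mu> (idx_fun (0, - a, a, 0, - b, b))" for a b
      by (intro \<mu>.integrable_const_bound[where B = 1]) (simp_all add: norm_mult measurable_cong_sets[OF \<mu> refl] idx_fun_measurable del: idx_fun.simps, simp add: norm_mult)
    then show ?thesis by (intro isometric_rangeI) (simp only: m g mom' simp_thms)
  qed
  then have "isometric \<mu> (order_pairs 0 0)"
    by (rule isometric_subset[OF isometric_pair_span order_pairs_0]) (rule range_eqI[of _ _ "(a, b)" for a b], simp only: fst_conv snd_conv)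
  then have "isometric \<mu> (order_pairs (int A) 0)" for A
  proof (induction A)
    case (Suc A)
    from order_pairs_step1[OF \<mu> this(1)[OF this(2)]] show ?case by (simp add: add.commute)
  qed simp
  then have *: "isometric \<mu> (order_pairs (int A) (int B))" for A B
  proof (induction B)
    case (Suc B)
    from order_pairs_step2[OF \<mu> this(1)[OF this(2)]] show ?case by (simp add: add.commute)
  qed simp
  have "integrable \<mu> (idx_fun u) \<and> (\<integral>z. idx_fun u z \<partial>\<mu>) = cinner (H u) x0" for u
  proof -
    obtain m k l n r t where u: "u = (m, k, l, n, r, t)" by (cases u)
    \<comment> \<open>Truncation at 0 by \<open>nat\<close> puts the constant function, paired with
      \<open>x0\<close>, at the same level as u. The scalar product with \<open>x0\<close> is then
      the integral of \<open>idx_fun u\<close>.\<close>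
    let ?A = "nat (int m + k + l)" and ?B = "nat (int n + r + t)"
    have 1: "(H u, idx_fun u) \<in> order_pairs (int ?A) (int ?B)" "(x0, idx_fun (0, 0, 0, 0, 0, 0)) \<in> order_pairs (int ?A) (int ?B)"
      unfolding u by (rule order_pairsI; simp)+
    have eq: "(\<lambda>z. idx_fun u z * cnj (idx_fun (0, 0, 0, 0, 0, 0) z)) = idx_fun u"
      by (simp only: idx_fun_mult_cnj u idx_mult_cnj.simps add.right_neutral)
    show ?thesis using isometricD[OF * 1] unfolding eq by (simp only: simp_thms)
  qed
  then show ?thesis by (intro that[OF \<mu>]) blast+
qed

end

section \<open>The algorithm\<close>

lemma eqn_holds_cong:
  assumes "\<And>u v. u \<in> eqn_vectors E \<Longrightarrow> v \<in> eqn_vectors E \<Longrightarrow> sp u v = sp' u v"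
  shows "eqn_holds sp E \<longleftrightarrow> eqn_holds sp' E"
proof (cases E)
  case (Eqn us v us' v')
  have eq: "(\<Sum>(c, u)\<leftarrow>xs. c * sp u x) = (\<Sum>(c, u)\<leftarrow>xs. c * sp' u x)"
    if "snd ` set xs \<subseteq> eqn_vectors E" "x \<in> eqn_vectors E" for xs x
  proof -
    have "map (\<lambda>(c, u). c * sp u x) xs = map (\<lambda>(c, u). c * sp' u x) xs"
    proof (rule map_cong[OF refl], clarify)
      fix c u assume "(c, u) \<in> set xs"
      then have "u \<in> eqn_vectors E" using that(1) by force
      then show "c * sp u x = c * sp' u x" using assms that(2) by metis
    qed
    then show ?thesis by (rule arg_cong[of _ _ sum_list])
  qed
  have "(\<Sum>(c, u)\<leftarrow>us. c * sp u v) = (\<Sum>(c, u)\<leftarrow>us. c * sp' u v)" by (rule eq) (auto simp: Eqn)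
  moreover have "(\<Sum>(c, u)\<leftarrow>us'. c * sp u v') = (\<Sum>(c, u)\<leftarrow>us'. c * sp' u v')" by (rule eq) (auto simp: Eqn)
  ultimately show ?thesis unfolding Eqn by simp
qed

lemma finite_eqn_vectors: "finite (eqn_vectors E)"
  by (cases E) simp

locale algorithm =
  fixes s :: "nat \<Rightarrow> nat \<Rightarrow> complex" and w :: "nat \<Rightarrow> idx" and M :: "nat \<Rightarrow> real" and p :: "nat \<Rightarrow> nat \<times> nat"
    and H0 :: "'h::chilbert_space set" and Hs :: "nat \<Rightarrow> 'h set" and h :: "nat \<Rightarrow> nat \<Rightarrow> 'h" and e :: "nat \<Rightarrow> 'h"
  assumes w: "bij_betw w {1..} Omega'" and p: "bij p" and model: "model_space s H0 Hs h e"
begin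

abbreviation "I \<equiv> gs_index (h_sequence h p)"
abbreviation "g \<equiv> gs_basis (h_sequence h p)"
abbreviation "known q \<equiv> Omega0 \<union> w ` {1..q}"

lemma the_inv_w: "1 \<le> i \<Longrightarrow> the_inv_into {1..} w (w i) = i"
  using w by (intro the_inv_into_f_f) (auto simp: bij_betw_def)

lemma w_notin_Omega0: "1 \<le> i \<Longrightarrow> w i \<notin> Omega0"
  using w by (auto simp: bij_betw_def Omega'_def)

lemma w_eq_iff: "1 \<le> i \<Longrightarrow> 1 \<le> j \<Longrightarrow> w i = w j \<longleftrightarrow> i = j"
  using w by (auto simp: bij_betw_def inj_on_def)

lemma algorithm_vec_w: "1 \<le> i \<Longrightarrow> algorithm_vec w h hs (w i) = hs i"
  using w_notin_Omega0[of i] the_inv_w[of i] by (simp add: algorithm_vec_def)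

lemma algorithm_vec_Omega0: "u \<in> Omega0 \<Longrightarrow> algorithm_vec w h hs u = initial_vec h u"
  by (simp add: algorithm_vec_def)

lemma range_h_sequence: "range (h_sequence h p) = {h m n | m n. True}"
proof -
  have "h m n \<in> range (h_sequence h p)" for m n
    using p by (intro range_eqI[of _ _ "inv p (m, n)"]) (simp add: h_sequence_def bij_is_surj surj_f_inv_f)
  then show ?thesis by (auto simp: h_sequence_def split_def)
qed

lemma cinner_h: "cinner (h m n) (h m' n') = s (m + m') (n + n')"
  using model unfolding model_space_def by blast

lemma g_in_H0: "g n \<in> H0"
  using gs_basis_in_span[of "h_sequence h p" n] model
  unfolding model_space_def range_h_sequence by (auto intro!: closure_subset[THEN subsetD])

lemma cinner_H0_e: "x \<in> H0 \<Longrightarrow> 1 \<le> j \<Longrightarrow> cinner x (e j) = 0"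
  using model unfolding model_space_def by blast

lemma orthonormal_e: "orthonormal_on {1..} e"
proof -
  have "cinner (e j) (e j) = 1" if "1 \<le> j" for j
    using model that unfolding model_space_def by (simp add: cinner_self)
  moreover have "cinner (e i) (e j) = 0" if "1 \<le> i" "1 \<le> j" "i \<noteq> j" for i j
    using model that unfolding model_space_def by blast
  ultimately show ?thesis by (simp add: orthonormal_on_def)
qed

lemma norm_e: "1 \<le> j \<Longrightarrow> norm (e j) = 1"
  using model unfolding model_space_def by blast

lemma cinner_e: "1 \<le> i \<Longrightarrow> 1 \<le> j \<Longrightarrow> cinner (e i) (e j) = (if i = j then 1 else 0)"
  using orthonormal_onD[OF orthonormal_e] by simp

lemma cinner_g_e: "1 \<le> j \<Longrightarrow> cinner (g n) (e j) = 0"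
  by (rule cinner_H0_e[OF g_in_H0])

lemma h_in_span_g: "h m n \<in> cspan (g ` I)"
proof -
  obtain i where "h m n = h_sequence h p i" using range_h_sequence by blast
  then show ?thesis using in_span_gs_basis by metis
qed

lemma initial_vec_cases: "\<exists>m n. initial_vec h u = h m n"
  by (cases u) auto

lemma partial_vec_props:
  assumes sm: "(\<lambda>n. (cmod (\<alpha> n))\<^sup>2) summable_on I" and q: "1 \<le> q"
  shows "(norm (partial_vec h p e q \<alpha> \<beta>))\<^sup>2 = coeff_norm2 h p q \<alpha> \<beta>"
    and "n \<in> I \<Longrightarrow> cinner (partial_vec h p e q \<alpha> \<beta>) (g n) = \<alpha> n"
    and "1 \<le> j \<Longrightarrow> cinner (partial_vec h p e q \<alpha> \<beta>) (e j) = (if j < q then \<beta> j else 0)"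
    and "(\<And>n. n \<in> I \<Longrightarrow> cinner (g n) z = 0) \<Longrightarrow> (\<And>j. 1 \<le> j \<Longrightarrow> j < q \<Longrightarrow> cinner (e j) z = 0) \<Longrightarrow>
       cinner (partial_vec h p e q \<alpha> \<beta>) z = 0"
proof -
  let ?a = "\<Sum>\<^sub>\<infinity>n\<in>I. \<alpha> n *\<^sub>C g n" and ?b = "\<Sum>j\<in>{1..<q}. \<beta> j *\<^sub>C e j"
  note on = orthonormal_gs_basis[of "h_sequence h p"]
  note sg = orthonormal_summable[OF on sm]
  have ae: "cinner ?a (e j) = 0" if "1 \<le> j" for j
    using that by (intro orthogonal_infsum[OF sg] cinner_g_e)
  have bg: "cinner ?b (g n) = 0" for n
    unfolding cinner_sum_left cinner_scaleC_left
    by (rule sum.neutral) (simp add: cinner_eq_zero_commute[of "e _"] cinner_g_e)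
  have ab: "cinner ?a ?b = 0"
    unfolding cinner_sum_right cinner_scaleC_right by (rule sum.neutral) (simp add: ae)
  show "(norm (partial_vec h p e q \<alpha> \<beta>))\<^sup>2 = coeff_norm2 h p q \<alpha> \<beta>"
    unfolding partial_vec_def coeff_norm2_def norm_add_square_orthogonal[OF ab] orthonormal_infsum_norm[OF on sm]
    by (subst orthonormal_norm_sum[OF orthonormal_e]) auto
  show "cinner (partial_vec h p e q \<alpha> \<beta>) (g n) = \<alpha> n" if "n \<in> I"
    unfolding partial_vec_def cinner_add_left bg using orthonormal_cinner_infsum[OF on sm that] by simp
  show "cinner (partial_vec h p e q \<alpha> \<beta>) (e j) = (if j < q then \<beta> j else 0)" if "1 \<le> j"
    unfolding partial_vec_def cinner_add_left ae[OF that]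
    by (subst orthonormal_cinner_sum[OF orthonormal_e]) (use that in auto)
  show "cinner (partial_vec h p e q \<alpha> \<beta>) z = 0"
    if "\<And>n. n \<in> I \<Longrightarrow> cinner (g n) z = 0" "\<And>j. 1 \<le> j \<Longrightarrow> j < q \<Longrightarrow> cinner (e j) z = 0"
  proof -
    have "cinner ?a z = 0" using that(1) by (rule orthogonal_infsum[OF sg])
    moreover have "cinner ?b z = 0"
      unfolding cinner_sum_left cinner_scaleC_left by (rule sum.neutral) (use that(2) in auto)
    ultimately show ?thesis unfolding partial_vec_def cinner_add_left by simp
  qed
qed

section \<open>Tuples produced by the algorithm and the equations they satisfy\<close>

lemma G_set_SucE:
  assumes "hs \<in> G_set w h p e M (Suc q)"
  obtains \<alpha> \<beta> d hs' where "hs' \<in> G_set w h p e M q"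
    "hs = hs'(Suc q := partial_vec h p e (Suc q) \<alpha> \<beta> + sqrt (d - coeff_norm2 h p (Suc q) \<alpha> \<beta>) *\<^sub>R e (Suc q))"
    "(\<lambda>n. (cmod (\<alpha> n))\<^sup>2) summable_on I" "coeff_norm2 h p (Suc q) \<alpha> \<beta> \<le> d" "d \<le> M (Suc q)"
    "\<And>E. E \<in> step_equations w (Suc q) \<Longrightarrow>
       eqn_holds (step_sprod w h (Suc q) hs' (partial_vec h p e (Suc q) \<alpha> \<beta>) d) E"
  using assms unfolding G_set.simps S_hat_def S_set_def by blast

lemma G_set_undefined: "hs \<in> G_set w h p e M q \<Longrightarrow> i \<notin> {1..q} \<Longrightarrow> hs i = undefined"
proof (induction q arbitrary: hs)
  case (Suc q)
  from Suc.prems(1) obtain hs' x where "hs' \<in> G_set w h p e M q" "hs = hs'(Suc q := x)"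
    by (rule G_set_SucE) blast
  then show ?case using Suc.IH[of hs'] Suc.prems(2) by auto
qed auto

text \<open>Expresses that the i-th vector is built from the g_n and e_1, ..., e_i only. Phrased
  through orthogonality, this needs no description of the closed span.\<close>

lemma G_set_orthogonal:
  assumes "hs \<in> G_set w h p e M q" "1 \<le> i" "i \<le> q"
    and "\<And>n. n \<in> I \<Longrightarrow> cinner (g n) z = 0" "\<And>j. 1 \<le> j \<Longrightarrow> j \<le> i \<Longrightarrow> cinner (e j) z = 0"
  shows "cinner (hs i) z = 0"
  using assms(1,3)
proof (induction q arbitrary: hs)
  case 0
  then show ?case using assms(2) by simp
next
  case (Suc q)
  from Suc.prems(1) obtain \<alpha> \<beta> d hs' where hs': "hs' \<in> G_set w h p e M q"
    and hs: "hs = hs'(Suc q := partial_vec h p e (Suc q) \<alpha> \<beta> + sqrt (d - coeff_norm2 h p (Suc q) \<alpha> \<beta>) *\<^sub>R e (Suc q))"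
    and sm: "(\<lambda>n. (cmod (\<alpha> n))\<^sup>2) summable_on I"
    by (rule G_set_SucE) blast
  show ?case
  proof (cases "i = Suc q")
    case True
    have "cinner (partial_vec h p e (Suc q) \<alpha> \<beta>) z = 0"
      by (rule partial_vec_props(4)[OF sm]) (use assms True in auto)
    moreover have "cinner (e (Suc q)) z = 0" using assms(5)[of "Suc q"] True by simp
    ultimately show ?thesis by (simp add: hs True cinner_add_left cinner_scaleR_left)
  next
    case False
    then show ?thesis using Suc.IH[OF hs'] Suc.prems(2) by (simp add: hs)
  qed
qed

lemma algorithm_vec_orthogonal:
  assumes "hs \<in> G_set w h p e M q" "u \<in> known q"
    and "\<And>n. n \<in> I \<Longrightarrow> cinner (g n) z = 0" "\<And>j. 1 \<le> j \<Longrightarrow> j \<le> q \<Longrightarrow> cinner (e j) z = 0"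
  shows "cinner (algorithm_vec w h hs u) z = 0"
  using assms(2)
proof
  assume "u \<in> Omega0"
  obtain m n where "initial_vec h u = h m n" using initial_vec_cases by blast
  then show ?thesis
    using orthogonal_cspan[of "g ` I" z, OF _ h_in_span_g] assms(3) \<open>u \<in> Omega0\<close>
    by (auto simp: algorithm_vec_Omega0)
next
  assume "u \<in> w ` {1..q}"
  then obtain i where i: "u = w i" "1 \<le> i" "i \<le> q" by auto
  then show ?thesis
    using G_set_orthogonal[OF assms(1) i(2,3) assms(3,4)] by (simp add: algorithm_vec_w)
qed

lemma algorithm_vec_cong:
  assumes "u \<in> known q" "\<And>i. 1 \<le> i \<Longrightarrow> i \<le> q \<Longrightarrow> hs i = hs' i"
  shows "algorithm_vec w h hs u = algorithm_vec w h hs' u"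
  using assms by (auto simp: algorithm_vec_Omega0 algorithm_vec_w)

text \<open>The equations in the unknowns are the equations for the actual vectors: the fresh axis
  \<open>e (Suc q)\<close> is orthogonal to everything chosen before, so its coefficient affects
  only the squared norm of the new vector, which it fills up to \<open>d\<close>.\<close>

lemma step_sprod_eq_cinner:
  assumes hs: "hs \<in> G_set w h p e M q" and sm: "(\<lambda>n. (cmod (\<alpha> n))\<^sup>2) summable_on I"
    and d: "coeff_norm2 h p (Suc q) \<alpha> \<beta> \<le> d" and uv: "u \<in> known (Suc q)" "v \<in> known (Suc q)"
  defines "y \<equiv> partial_vec h p e (Suc q) \<alpha> \<beta>"
  defines "hs' \<equiv> hs(Suc q := y + sqrt (d - coeff_norm2 h p (Suc q) \<alpha> \<beta>) *\<^sub>R e (Suc q))"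
  shows "step_sprod w h (Suc q) hs y d u v = cinner (algorithm_vec w h hs' u) (algorithm_vec w h hs' v)"
proof -
  let ?c = "sqrt (d - coeff_norm2 h p (Suc q) \<alpha> \<beta>)"
  let ?new = "w (Suc q)"
  have split: "u = ?new \<or> u \<in> known q" if "u \<in> known (Suc q)" for u
    using that by (auto simp: atLeastAtMostSuc_conv)
  have notin: "?new \<notin> known q" 
  proof -
    have "w (Suc q) \<noteq> w i" if "i \<in> {1..q}" for i using w_eq_iff[of "Suc q" i] that by simp
    then have "w (Suc q) \<notin> w ` {1..q}" by blast
    then show ?thesis using w_notin_Omega0[of "Suc q"] by simp
  qed
  have old: "algorithm_vec w h hs' u = algorithm_vec w h (hs(Suc q := y)) u" "cinner (algorithm_vec w h (hs(Suc q := y)) u) (e (Suc q)) = 0"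
    if "u \<in> known q" for u
  proof -
    show "algorithm_vec w h hs' u = algorithm_vec w h (hs(Suc q := y)) u"
      by (rule algorithm_vec_cong[OF that]) (simp add: hs'_def)
    have "algorithm_vec w h (hs(Suc q := y)) u = algorithm_vec w h hs u"
      by (rule algorithm_vec_cong[OF that]) simp
    then show "cinner (algorithm_vec w h (hs(Suc q := y)) u) (e (Suc q)) = 0"
      using algorithm_vec_orthogonal[OF hs that, of "e (Suc q)"] cinner_g_e cinner_e by simp
  qed
  have new: "algorithm_vec w h hs' ?new = y + ?c *\<^sub>R e (Suc q)" "algorithm_vec w h (hs(Suc q := y)) ?new = y"
    by (simp_all add: algorithm_vec_w hs'_def)
  have ye: "cinner y (e (Suc q)) = 0" unfolding y_def by (subst partial_vec_props(3)[OF sm]) auto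
  then have ey: "cinner (e (Suc q)) y = 0" by (rule cinner_eq_zero_commute[THEN iffD1])
  have "(norm (y + ?c *\<^sub>R e (Suc q)))\<^sup>2 = d"
  proof -
    have "cinner y (?c *\<^sub>R e (Suc q)) = 0" by (simp add: cinner_scaleR_right ye)
    then have "(norm (y + ?c *\<^sub>R e (Suc q)))\<^sup>2 = (norm y)\<^sup>2 + (norm (?c *\<^sub>R e (Suc q)))\<^sup>2"
      by (rule norm_add_square_orthogonal)
    then show ?thesis using d partial_vec_props(1)[OF sm, of "Suc q" \<beta>] norm_e[of "Suc q"]
      by (simp add: y_def power_mult_distrib)
  qed
  then have nn: "cinner (y + ?c *\<^sub>R e (Suc q)) (y + ?c *\<^sub>R e (Suc q)) = of_real d" by (simp only: cinner_self)
  show ?thesis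
  proof (cases "u = ?new"; cases "v = ?new")
    assume "u = ?new" "v = ?new"
    then show ?thesis by (simp add: step_sprod_def new nn)
  next
    assume "u = ?new" "v \<noteq> ?new"
    then have v: "v \<in> known q" using split uv by blast
    then have "cinner (e (Suc q)) (algorithm_vec w h (hs(Suc q := y)) v) = 0"
      using old(2) cinner_eq_zero_commute by blast
    then show ?thesis using \<open>u = ?new\<close> \<open>v \<noteq> ?new\<close>
      by (simp add: step_sprod_def new old(1)[OF v] cinner_add_left cinner_scaleR_left)
  next
    assume "u \<noteq> ?new" "v = ?new"
    then have u: "u \<in> known q" using split uv by blast
    then show ?thesis using \<open>u \<noteq> ?new\<close> \<open>v = ?new\<close>
      by (simp add: step_sprod_def new old[OF u] cinner_add_right cinner_scaleR_right)
  next
    assume "u \<noteq> ?new" "v \<noteq> ?new"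
    then have "u \<in> known q" "v \<in> known q" using split uv by blast+
    then show ?thesis using \<open>u \<noteq> ?new\<close> by (simp add: step_sprod_def old(1))
  qed
qed

lemma step_equations_vectors: "E \<in> step_equations w q \<Longrightarrow> u \<in> eqn_vectors E \<Longrightarrow> u \<in> known q"
  by (auto simp: step_equations_def)

lemma G_set_equations:
  assumes "hs \<in> G_set w h p e M (Suc q)" "E \<in> step_equations w (Suc q)"
  shows "eqn_holds (\<lambda>u v. cinner (algorithm_vec w h hs u) (algorithm_vec w h hs v)) E"
proof -
  obtain \<alpha> \<beta> d hs' where *: "hs' \<in> G_set w h p e M q"
    "hs = hs'(Suc q := partial_vec h p e (Suc q) \<alpha> \<beta> + sqrt (d - coeff_norm2 h p (Suc q) \<alpha> \<beta>) *\<^sub>R e (Suc q))"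
    "(\<lambda>n. (cmod (\<alpha> n))\<^sup>2) summable_on I" "coeff_norm2 h p (Suc q) \<alpha> \<beta> \<le> d"
    "eqn_holds (step_sprod w h (Suc q) hs' (partial_vec h p e (Suc q) \<alpha> \<beta>) d) E"
    using assms by (elim G_set_SucE) blast
  show ?thesis unfolding *(2)
    by (rule eqn_holds_cong[THEN iffD1, OF _ *(5)])
      (use step_sprod_eq_cinner[OF *(1,3,4)] step_equations_vectors[OF assms(2)] in blast)
qed

text \<open>An equation involves finitely many vectors. It was imposed at the step that introduced
  the last of them, and the prefix of \<open>v\<close> up to that step already determines whether it
  holds.\<close>

theorem bold_G_equations:
  assumes s0: "step0_check h" and v: "v \<in> bold_G w h p e M" and E: "E \<in> equations"
  shows "eqn_holds (\<lambda>u u'. cinner (algorithm_vec w h v u) (algorithm_vec w h v u')) E"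
proof (cases "eqn_vectors E \<subseteq> Omega0")
  case True
  then have "eqn_holds (\<lambda>u v. cinner (initial_vec h u) (initial_vec h v)) E"
    using s0 E by (auto simp: step0_check_def)
  then show ?thesis
    by (rule eqn_holds_cong[THEN iffD1, rotated]) (use True in \<open>auto simp: algorithm_vec_Omega0 subsetD\<close>)
next
  case False
  define Q where "Q = {i. 1 \<le> i \<and> w i \<in> eqn_vectors E}"
  have sub: "eqn_vectors E \<subseteq> Omega0 \<union> w ` Q"
  proof
    fix u assume u: "u \<in> eqn_vectors E"
    show "u \<in> Omega0 \<union> w ` Q"
    proof (cases "u \<in> Omega0")
      case False
      then have "u \<in> w ` {1..}" using w by (simp add: bij_betw_def Omega'_def)
      then show ?thesis using u by (auto simp: Q_def)
    qed simp
  qed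
  have "inj_on w Q" using w by (auto simp: bij_betw_def Q_def inj_on_def)
  moreover have "w ` Q \<subseteq> eqn_vectors E" by (auto simp: Q_def)
  ultimately have fin: "finite Q" using finite_eqn_vectors finite_subset finite_imageD by metis
  have ne: "Q \<noteq> {}" using sub False by auto
  define q where "q = Max Q"
  have q: "q \<in> Q" "\<And>i. i \<in> Q \<Longrightarrow> i \<le> q" using fin ne by (auto simp: q_def)
  have st: "E \<in> step_equations w q"
    unfolding step_equations_def using E q sub by (fastforce simp: Q_def)
  obtain q' where q': "q = Suc q'" using q(1) by (cases q) (auto simp: Q_def)
  have "v \<in> bold_G_step w h p e M q" using v q' by (auto simp: bold_G_def)
  then have "restrict v {1..q} \<in> G_set w h p e M q" by (simp add: bold_G_step_def)
  then have "eqn_holds (\<lambda>u v'. cinner (algorithm_vec w h (restrict v {1..q}) u) (algorithm_vec w h (restrict v {1..q}) v')) E"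
    using G_set_equations st unfolding q' by blast
  then show ?thesis
  proof (rule eqn_holds_cong[THEN iffD1, rotated])
    have "algorithm_vec w h (restrict v {1..q}) u = algorithm_vec w h v u" if "u \<in> eqn_vectors E" for u
      by (rule algorithm_vec_cong[OF step_equations_vectors[OF st that]]) auto
    then show "\<And>u u'. u \<in> eqn_vectors E \<Longrightarrow> u' \<in> eqn_vectors E \<Longrightarrow>
       cinner (algorithm_vec w h (restrict v {1..q}) u) (algorithm_vec w h (restrict v {1..q}) u')
       = cinner (algorithm_vec w h v u) (algorithm_vec w h v u')" by simp
  qed
qed

theorem plane_moment_solution_exists:
  assumes "step0_check h" "bold_G w h p e M \<noteq> {}"
  shows "\<exists>\<mu>. plane_moment_solution s \<mu>"
proof -
  obtain v where v: "v \<in> bold_G w h p e M" using assms(2) by blast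
  interpret gram_family "algorithm_vec w h v"
    by (rule gram_familyI) (rule bold_G_equations[OF assms(1) v])
  obtain \<mu> where \<mu>: "sets \<mu> = sets borel" "\<And>u. integrable \<mu> (idx_fun u)"
    "\<And>u. (\<integral>z. idx_fun u z \<partial>\<mu>) = cinner (algorithm_vec w h v u) x0"
    using representing_measure by blast
  have eq: "idx_fun (m, 0, 0, n, 0, 0) = (\<lambda>z. complex_of_real (case z of (x1, x2) \<Rightarrow> x1 ^ m * x2 ^ n))" for m n
    by (auto simp: rat_fun_def)
  have "integrable \<mu> (\<lambda>(x1, x2). x1 ^ m * x2 ^ n)" for m n
    using \<mu>(2)[of "(m, 0, 0, n, 0, 0)"] unfolding eq complex_of_real_integrable_eq .
  moreover have "complex_of_real (\<integral>(x1, x2). x1 ^ m * x2 ^ n \<partial>\<mu>) = s m n" for m n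
  proof -
    have "complex_of_real (\<integral>(x1, x2). x1 ^ m * x2 ^ n \<partial>\<mu>) = cinner (algorithm_vec w h v (m, 0, 0, n, 0, 0)) x0"
      using \<mu>(3)[of "(m, 0, 0, n, 0, 0)"] unfolding eq integral_complex_of_real .
    then show ?thesis by (simp add: algorithm_vec_def Omega0_def cinner_h)
  qed
  ultimately show ?thesis using \<mu>(1) unfolding plane_moment_solution_def by blast
qed

end

section \<open>Vectors obtained from a measure\<close>

lemma integral_mult_cnj_eq_0:
  assumes "integrable \<mu> (\<lambda>z. (cmod (f z))\<^sup>2)" "(\<integral>z. (cmod (f z))\<^sup>2 \<partial>\<mu>) = 0"
  shows "(\<integral>z. f z * cnj (g z) \<partial>\<mu>) = 0"
proof -
  have "AE z in \<mu>. (cmod (f z))\<^sup>2 = 0"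
    using integral_nonneg_eq_0_iff_AE[OF assms(1)] assms(2) by simp
  then have "AE z in \<mu>. f z * cnj (g z) = 0" by eventually_elim simp
  then show ?thesis by (rule integral_eq_zero_AE)
qed

lemma integral_Cauchy_Schwarz:
  fixes f g :: "'a \<Rightarrow> complex"
  assumes f: "integrable \<mu> (\<lambda>z. (cmod (f z))\<^sup>2)" and g: "integrable \<mu> (\<lambda>z. (cmod (g z))\<^sup>2)"
    and fg: "integrable \<mu> (\<lambda>z. f z * cnj (g z))"
  shows "(cmod (\<integral>z. f z * cnj (g z) \<partial>\<mu>))\<^sup>2 \<le> (\<integral>z. (cmod (f z))\<^sup>2 \<partial>\<mu>) * (\<integral>z. (cmod (g z))\<^sup>2 \<partial>\<mu>)"
proof -
  define A where "A = (\<integral>z. (cmod (f z))\<^sup>2 \<partial>\<mu>)"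
  define B where "B = (\<integral>z. (cmod (g z))\<^sup>2 \<partial>\<mu>)"
  define c where "c = (\<integral>z. f z * cnj (g z) \<partial>\<mu>)"
  have B0: "B \<ge> 0" unfolding B_def by simp
  show ?thesis
  proof (cases "B = 0")
    \<comment> \<open>Here g vanishes almost everywhere; the argument for B > 0 ends with a
      cancellation of B.\<close>
    case True
    then have "(\<integral>z. g z * cnj (f z) \<partial>\<mu>) = 0" using g unfolding B_def by (intro integral_mult_cnj_eq_0)
    moreover have "c = cnj (\<integral>z. g z * cnj (f z) \<partial>\<mu>)"
      unfolding c_def by (subst Bochner_Integration.integral_cnj[symmetric]) (simp only: complex_cnj_mult complex_cnj_cnj mult.commute)
    ultimately have "c = 0" by simp
    then show ?thesis by (simp add: c_def)
  next
    case False
    let ?r = "\<lambda>z. Re (cnj c * (f z * cnj (g z)))"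
    \<comment> \<open>The function B f - c g is B times the component of f orthogonal to g.\<close>
    have eq: "(cmod (of_real B * f z - c * g z))\<^sup>2 = B\<^sup>2 * (cmod (f z))\<^sup>2 - 2 * B * ?r z + (cmod c)\<^sup>2 * (cmod (g z))\<^sup>2" for z
      unfolding cmod_power2 by (simp add: power2_eq_square algebra_simps)
    have r: "integrable \<mu> ?r" using fg by (intro integrable_Re integrable_mult_right)
    have "(\<integral>z. ?r z \<partial>\<mu>) = Re (cnj c * c)"
      unfolding c_def using fg by (subst integral_Re) auto
    also have "\<dots> = (cmod c)\<^sup>2" unfolding cnj_mult_self by simp
    finally have ri: "(\<integral>z. ?r z \<partial>\<mu>) = (cmod c)\<^sup>2" .
    have "0 \<le> (\<integral>z. (cmod (of_real B * f z - c * g z))\<^sup>2 \<partial>\<mu>)" by simp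
    also have "\<dots> = B\<^sup>2 * A - 2 * B * (cmod c)\<^sup>2 + (cmod c)\<^sup>2 * B"
    proof -
      have lin: "(\<integral>z. b * F z - b' * R z + k * G z \<partial>\<mu>) = b * (\<integral>z. F z \<partial>\<mu>) - b' * (\<integral>z. R z \<partial>\<mu>) + k * (\<integral>z. G z \<partial>\<mu>)"
        if "integrable \<mu> F" "integrable \<mu> R" "integrable \<mu> G" for b b' k :: real and F R G
        using that by simp
      show ?thesis unfolding eq lin[OF f r g] ri A_def[symmetric] B_def[symmetric] ..
    qed
    finally have "0 \<le> B * (A * B - (cmod c)\<^sup>2)" by (simp add: algebra_simps power2_eq_square)
    then have "(cmod c)\<^sup>2 \<le> A * B" using B0 False by (simp add: zero_le_mult_iff)
    then show ?thesis by (simp add: A_def B_def c_def)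
  qed
qed

text \<open>The vector y stands in for the projection of \<open>b\<close> onto the span of the given
  functions, hence only an inequality for the norm. The functional is read off from a chosen
  function belonging to x. It does not depend on the choice: the difference of two such functions is
  paired with the vector 0, and Cauchy-Schwarz makes its integral against \<open>b\<close>
  vanish.\<close>

lemma isometric_representation:
  fixes S :: "('h::chilbert_space \<times> ('a \<Rightarrow> complex)) set"
  assumes iso: "isometric \<mu> S" and b: "integrable \<mu> (\<lambda>z. (cmod (b z))\<^sup>2)"
    and Sb: "\<And>x f. (x, f) \<in> S \<Longrightarrow> integrable \<mu> (\<lambda>z. f z * cnj (b z))"
  obtains y where "\<And>x f. (x, f) \<in> S \<Longrightarrow> cinner x y = (\<integral>z. f z * cnj (b z) \<partial>\<mu>)"
    "(norm y)\<^sup>2 \<le> (\<integral>z. (cmod (b z))\<^sup>2 \<partial>\<mu>)"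
proof -
  let ?P = "pair_span S"
  note isoP = isometric_pair_span[OF iso]
  define C where "C = sqrt (\<integral>z. (cmod (b z))\<^sup>2 \<partial>\<mu>)"
  have C0: "C \<ge> 0" by (simp add: C_def)
  define \<phi> where "\<phi> x = (\<integral>z. (SOME f. (x, f) \<in> ?P) z * cnj (b z) \<partial>\<mu>)" for x
  have int: "integrable \<mu> (\<lambda>z. f z * cnj (b z))" if "(x, f) \<in> ?P" for x f
    using that
  proof induction
    case (step x f y g c)
    have "integrable \<mu> (\<lambda>z. c * (f z * cnj (b z)) + g z * cnj (b z))"
      using Sb[OF step(1)] step(3) by (intro Bochner_Integration.integrable_add integrable_mult_right)
    then show ?case by (simp add: algebra_simps)
  qed simp
  have bound: "cmod (\<integral>z. f z * cnj (b z) \<partial>\<mu>) \<le> C * norm x" if "(x, f) \<in> ?P" for x f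
  proof -
    have "(cmod (\<integral>z. f z * cnj (b z) \<partial>\<mu>))\<^sup>2 \<le> (norm x)\<^sup>2 * (\<integral>z. (cmod (b z))\<^sup>2 \<partial>\<mu>)"
      unfolding isometric_norm(2)[OF isoP that]
      by (rule integral_Cauchy_Schwarz[OF isometric_norm(1)[OF isoP that] b int[OF that]])
    also have "\<dots> = (C * norm x)\<^sup>2" by (simp add: C_def power_mult_distrib)
    finally show ?thesis by (rule power2_le_imp_le) (simp add: C0)
  qed
  have \<phi>: "\<phi> x = (\<integral>z. f z * cnj (b z) \<partial>\<mu>)" if xf: "(x, f) \<in> ?P" for x f
  proof -
    let ?f = "SOME f. (x, f) \<in> ?P"
    have xf': "(x, ?f) \<in> ?P" using someI[of "\<lambda>f. (x, f) \<in> ?P", OF xf] .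
    have "cmod (\<integral>z. (?f z - f z) * cnj (b z) \<partial>\<mu>) \<le> C * norm (x - x)"
      by (rule bound[OF pair_span_diff[OF xf' xf]])
    moreover have "(\<integral>z. (?f z - f z) * cnj (b z) \<partial>\<mu>) = \<phi> x - (\<integral>z. f z * cnj (b z) \<partial>\<mu>)"
      unfolding \<phi>_def left_diff_distrib using int[OF xf'] int[OF xf] by (rule Bochner_Integration.integral_diff)
    ultimately show ?thesis by simp
  qed
  have "csubspace (fst ` ?P)"
    unfolding complex_vector.subspace_def
  proof (intro conjI ballI allI)
    show "0 \<in> fst ` ?P" using pair_span.zero by force
    show "x + y \<in> fst ` ?P" if "x \<in> fst ` ?P" "y \<in> fst ` ?P" for x y
      using that pair_span_add by force
    show "c *\<^sub>C x \<in> fst ` ?P" if "x \<in> fst ` ?P" for c x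
      using that pair_span_scale by force
  qed
  then obtain y where y: "\<And>x. x \<in> fst ` ?P \<Longrightarrow> \<phi> x = cinner x y" "norm y \<le> C"
  proof (rule Riesz_representation_bounded)
    show "\<phi> (x + y) = \<phi> x + \<phi> y" if xy: "x \<in> fst ` ?P" "y \<in> fst ` ?P" for x y
    proof -
      obtain f g where fg: "(x, f) \<in> ?P" "(y, g) \<in> ?P" using xy by auto
      have "(\<integral>z. (f z + g z) * cnj (b z) \<partial>\<mu>) = \<phi> x + \<phi> y"
        unfolding \<phi>[OF fg(1)] \<phi>[OF fg(2)] distrib_right using int[OF fg(1)] int[OF fg(2)]
        by (rule Bochner_Integration.integral_add)
      then show ?thesis using \<phi>[OF pair_span_add[OF fg]] by simp
    qed
    show "\<phi> (c *\<^sub>C x) = c * \<phi> x" if x: "x \<in> fst ` ?P" for c x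
    proof -
      obtain f where f: "(x, f) \<in> ?P" using x by auto
      show ?thesis unfolding \<phi>[OF pair_span_scale[OF f]] \<phi>[OF f] mult.assoc
        by (intro Bochner_Integration.integral_mult_right int[OF f])
    qed
    show "cmod (\<phi> x) \<le> C * norm x" if "x \<in> fst ` ?P" for x
      using that bound \<phi> by auto
  qed (use C0 in auto)
  show ?thesis
  proof
    show "cinner x y = (\<integral>z. f z * cnj (b z) \<partial>\<mu>)" if "(x, f) \<in> S" for x f
      using y(1)[of x] \<phi>[OF pair_span_base[OF that]] pair_span_base[OF that] by force
    have "(norm y)\<^sup>2 \<le> C\<^sup>2" by (rule power_mono[OF y(2)]) simp
    then show "(norm y)\<^sup>2 \<le> (\<integral>z. (cmod (b z))\<^sup>2 \<partial>\<mu>)" by (simp add: C_def)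
  qed
qed

section \<open>Moduli and growth of the index functions\<close>

lemma cmod_of_real_ii: "cmod (of_real x + \<i>) = sqrt (x\<^sup>2 + 1)" "cmod (of_real x - \<i>) = sqrt (x\<^sup>2 + 1)"
  by (simp_all add: cmod_def)

lemma cmod_rat_fun_square: "(cmod (rat_fun m k l x))\<^sup>2 = x ^ (2 * m) * (x\<^sup>2 + 1) powi (k + l)"
proof -
  have p: "x\<^sup>2 + 1 > 0" by (simp add: add_nonneg_pos)
  have "(sqrt (x\<^sup>2 + 1) powi k)\<^sup>2 = (x\<^sup>2 + 1) powi k" for k
  proof -
    have "(sqrt (x\<^sup>2 + 1) powi k)\<^sup>2 = ((sqrt (x\<^sup>2 + 1))\<^sup>2) powi k"
      by (simp only: power_int_power power_int_power' mult.commute)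
    then show ?thesis using p by simp
  qed
  then show ?thesis
    using p by (simp add: rat_fun_def norm_mult norm_power norm_power_int cmod_of_real_ii power_mult_distrib power_int_add power_mult[symmetric] power_even_abs mult.commute)
qed

text \<open>A crude bound, chosen to be a polynomial in x^2: factors with negative exponent are at
  most 1, and the others grow no faster than powers of 1 + x^2.\<close>

lemma cmod_rat_fun_le: "cmod (rat_fun m k l x) \<le> (1 + x\<^sup>2) ^ (m + nat \<bar>k\<bar> + nat \<bar>l\<bar>)"
proof -
  have s1: "1 \<le> sqrt (x\<^sup>2 + 1)" by simp
  have s2: "sqrt (x\<^sup>2 + 1) \<le> 1 + x\<^sup>2"
    by (rule real_le_lsqrt) (use self_le_power[of "1 + x\<^sup>2" 2] in auto)
  have q: "sqrt (x\<^sup>2 + 1) powi k \<le> (1 + x\<^sup>2) ^ nat \<bar>k\<bar>" for k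
  proof (cases "k \<ge> 0")
    case True
    then show ?thesis using s1 s2 by (simp add: power_int_def power_mono)
  next
    case False
    have "inverse (sqrt (x\<^sup>2 + 1)) ^ nat (- k) \<le> 1 ^ nat (- k)"
      using s1 by (intro power_mono) (simp_all add: inverse_le_1_iff)
    also have "\<dots> \<le> (1 + x\<^sup>2) ^ nat \<bar>k\<bar>" by simp
    finally show ?thesis using False by (simp add: power_int_def)
  qed
  have "\<bar>x\<bar> \<le> sqrt (x\<^sup>2 + 1)" by (rule real_le_rsqrt) simp
  then have "\<bar>x\<bar> ^ m \<le> (1 + x\<^sup>2) ^ m" using s2 by (intro power_mono) auto
  then show ?thesis unfolding rat_fun_def norm_mult norm_power norm_power_int cmod_of_real_ii power_add
    by (intro mult_mono q) (use s1 in auto)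
qed

text \<open>The polynomial majorant expands into even monomials, each integrable because all moments
  exist.\<close>

lemma plane_moment_solution_integrable:
  assumes \<mu>: "plane_moment_solution s \<mu>"
  shows "integrable \<mu> (idx_fun u)"
proof -
  obtain m k l n r t where u: "u = (m, k, l, n, r, t)" by (cases u)
  let ?A = "m + nat \<bar>k\<bar> + nat \<bar>l\<bar>" and ?B = "n + nat \<bar>r\<bar> + nat \<bar>t\<bar>"
  have sets: "sets \<mu> = sets borel" and mom: "\<And>m n. integrable \<mu> (\<lambda>z. fst z ^ m * snd z ^ n)"
    using \<mu> unfolding plane_moment_solution_def split_def by auto
  have "integrable \<mu> (\<lambda>z. \<Sum>i\<le>?A. \<Sum>j\<le>?B. real (?A choose i) * real (?B choose j) * (fst z ^ (2 * i) * snd z ^ (2 * j)))"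
    by (intro Bochner_Integration.integrable_sum integrable_mult_right mom)
  also have "(\<lambda>z. \<Sum>i\<le>?A. \<Sum>j\<le>?B. real (?A choose i) * real (?B choose j) * (fst z ^ (2 * i) * snd z ^ (2 * j)))
     = (\<lambda>z. (1 + (fst z)\<^sup>2) ^ ?A * (1 + (snd z :: real)\<^sup>2) ^ ?B)"
    unfolding add.commute[of 1] binomial_ring sum_product
    by (intro ext sum.cong refl) (simp add: power_mult[symmetric] mult_ac)
  finally have dom: "integrable \<mu> (\<lambda>z. (1 + (fst z)\<^sup>2) ^ ?A * (1 + (snd z)\<^sup>2) ^ ?B)" .
  show ?thesis
  proof (rule Bochner_Integration.integrable_bound[OF dom])
    show "idx_fun u \<in> borel_measurable \<mu>" using idx_fun_measurable by (simp add: measurable_cong_sets[OF sets refl])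
    show "AE z in \<mu>. cmod (idx_fun u z) \<le> norm ((1 + (fst z)\<^sup>2) ^ ?A * (1 + (snd z)\<^sup>2) ^ ?B)"
    proof (rule AE_I2)
      fix z
      have "cmod (idx_fun u z) \<le> (1 + (fst z)\<^sup>2) ^ ?A * (1 + (snd z)\<^sup>2) ^ ?B"
        unfolding u idx_fun.simps norm_mult by (intro mult_mono cmod_rat_fun_le) auto
      then show "cmod (idx_fun u z) \<le> norm ((1 + (fst z)\<^sup>2) ^ ?A * (1 + (snd z)\<^sup>2) ^ ?B)"
        by (simp add: abs_mult)
    qed
  qed
qed

section \<open>Running the algorithm on a given solution of the plane problem\<close>

context algorithm
begin

context
  fixes \<mu> assumes \<mu>: "plane_moment_solution s \<mu>" and M: "moment_bounds s w M"
begin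

definition kernel :: "idx \<Rightarrow> idx \<Rightarrow> complex" where
  "kernel u v = (\<integral>z. idx_fun u z * cnj (idx_fun v z) \<partial>\<mu>)"

lemmas int_idx_fun = plane_moment_solution_integrable[OF \<mu>]

lemma int_idx_fun_mult: "integrable \<mu> (\<lambda>z. idx_fun u z * cnj (idx_fun v z))"
  unfolding idx_fun_mult_cnj using int_idx_fun .

lemma int_idx_fun_square: "integrable \<mu> (\<lambda>z. (cmod (idx_fun u z))\<^sup>2)"
proof -
  have "(\<lambda>z. idx_fun u z * cnj (idx_fun u z)) = (\<lambda>z. complex_of_real ((cmod (idx_fun u z))\<^sup>2))"
    by (simp only: complex_norm_square)
  then show ?thesis using int_idx_fun_mult[of u u] by (simp only: complex_of_real_integrable_eq)
qed

lemma kernel_self: "kernel u u = of_real (\<integral>z. (cmod (idx_fun u z))\<^sup>2 \<partial>\<mu>)"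
  unfolding kernel_def by (simp only: complex_norm_square[symmetric] integral_complex_of_real)

lemma kernel_commute: "kernel u v = cnj (kernel v u)"
  unfolding kernel_def by (subst Bochner_Integration.integral_cnj[symmetric]) (simp only: complex_cnj_mult complex_cnj_cnj mult.commute)

lemma kernel_equations: "E \<in> equations \<Longrightarrow> eqn_holds kernel E"
proof -
  assume E: "E \<in> equations"
  define L where "L u = (\<integral>z. idx_fun u z \<partial>\<mu>)" for u
  have k: "kernel = (\<lambda>u v. L (idx_mult_cnj u v))"
    unfolding kernel_def L_def idx_fun_mult_cnj ..
  have add: "L u + \<i> * L v = L x" if "\<And>z. idx_fun u z + \<i> * idx_fun v z = idx_fun x z" for u v x
  proof -
    have "L u + \<i> * L v = (\<integral>z. idx_fun u z + \<i> * idx_fun v z \<partial>\<mu>)"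
      unfolding L_def using int_idx_fun[of u] int_idx_fun[of v] by (simp add: Bochner_Integration.integral_add)
    then show ?thesis by (simp only: that L_def)
  qed
  have diff: "L u - \<i> * L v = L x" if "\<And>z. idx_fun u z - \<i> * idx_fun v z = idx_fun x z" for u v x
  proof -
    have "L u - \<i> * L v = (\<integral>z. idx_fun u z - \<i> * idx_fun v z \<partial>\<mu>)"
      unfolding L_def using int_idx_fun[of u] int_idx_fun[of v] by (simp add: Bochner_Integration.integral_diff)
    then show ?thesis by (simp only: that L_def)
  qed
  show ?thesis unfolding k
  proof (rule eqn_holds_mult_cnj_kernel[OF _ _ _ _ E])
    show "L (m + 1, k, l, n, r, t) + \<i> * L (m, k, l, n, r, t) = L (m, k + 1, l, n, r, t)" for m k l n r t
      by (rule add) (simp only: idx_fun.simps rat_fun_Suc[symmetric] Suc_eq_plus1[symmetric], simp add: algebra_simps)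
    show "L (m + 1, k, l, n, r, t) - \<i> * L (m, k, l, n, r, t) = L (m, k, l + 1, n, r, t)" for m k l n r t
      by (rule diff) (simp only: idx_fun.simps rat_fun_Suc[symmetric] Suc_eq_plus1[symmetric], simp add: algebra_simps)
    show "L (m, k, l, n + 1, r, t) + \<i> * L (m, k, l, n, r, t) = L (m, k, l, n, r + 1, t)" for m k l n r t
      by (rule add) (simp only: idx_fun.simps rat_fun_Suc[symmetric] Suc_eq_plus1[symmetric], simp add: algebra_simps)
    show "L (m, k, l, n + 1, r, t) - \<i> * L (m, k, l, n, r, t) = L (m, k, l, n, r, t + 1)" for m k l n r t
      by (rule diff) (simp only: idx_fun.simps rat_fun_Suc[symmetric] Suc_eq_plus1[symmetric], simp add: algebra_simps)
  qed
qed

lemma kernel_Omega0: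
  assumes "u \<in> Omega0" "v \<in> Omega0"
  shows "cinner (initial_vec h u) (initial_vec h v) = kernel u v"
proof -
  obtain m n m' n' where uv: "u = (m, 0, 0, n, 0, 0)" "v = (m', 0, 0, n', 0, 0)"
    using assms by (auto simp: Omega0_def)
  have eq: "idx_fun (m + m', 0, 0, n + n', 0, 0) = (\<lambda>z. complex_of_real (case z of (x1, x2) \<Rightarrow> x1 ^ (m + m') * x2 ^ (n + n')))"
    by (auto simp: rat_fun_def)
  have "kernel u v = (\<integral>z. idx_fun (m + m', 0, 0, n + n', 0, 0) z \<partial>\<mu>)"
    unfolding kernel_def idx_fun_mult_cnj uv by (simp only: idx_mult_cnj.simps add.right_neutral)
  also have "\<dots> = complex_of_real (\<integral>(x1, x2). x1 ^ (m + m') * x2 ^ (n + n') \<partial>\<mu>)"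
    unfolding eq integral_complex_of_real ..
  also have "\<dots> = s (m + m') (n + n')" using \<mu> unfolding plane_moment_solution_def by blast
  finally show ?thesis by (simp add: uv cinner_h)
qed

lemma moment_bound:
  assumes "1 \<le> j"
  shows "(\<integral>z. (cmod (idx_fun (w j) z))\<^sup>2 \<partial>\<mu>) \<le> M j"
proof -
  obtain m k l n r t where wj: "w j = (m, k, l, n, r, t)" by (cases "w j")
  have "(\<integral>\<^sup>+z. ennreal ((cmod (idx_fun (w j) z))\<^sup>2) \<partial>\<mu>)
     = (\<integral>\<^sup>+(x1, x2). ennreal (x1 ^ (2 * m) * (x1\<^sup>2 + 1) powi (k + l) *
                                x2 ^ (2 * n) * (x2\<^sup>2 + 1) powi (r + t)) \<partial>\<mu>)"
    by (intro nn_integral_cong) (simp add: wj split_def norm_mult power_mult_distrib cmod_rat_fun_square mult_ac)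
  also have "\<dots> \<le> ennreal (M j)"
    using M \<mu> assms wj unfolding moment_bounds_def by fastforce
  finally have "ennreal (\<integral>z. (cmod (idx_fun (w j) z))\<^sup>2 \<partial>\<mu>) \<le> ennreal (M j)"
    using nn_integral_eq_integral[OF int_idx_fun_square[of "w j"]] by simp
  moreover have "M j > 0" using M assms unfolding moment_bounds_def by blast
  ultimately show ?thesis by simp
qed

text \<open>The invariant of the run: an admissible tuple whose Gram matrix, together with the
  initial vectors, is that of the functions in L^2 of the fixed measure.\<close>

definition realizes :: "nat \<Rightarrow> (nat \<Rightarrow> 'h) \<Rightarrow> bool" where
  "realizes q hs \<longleftrightarrow> hs \<in> G_set w h p e M q \<and>
     (\<forall>u\<in>known q. \<forall>v\<in>known q. cinner (algorithm_vec w h hs u) (algorithm_vec w h hs v) = kernel u v)"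

text \<open>The two systems are merged over a disjoint sum of index sets so that one Bessel
  inequality bounds the coefficients \<open>\<alpha>\<close> and \<open>\<beta>\<close>
  together.\<close>

lemma orthonormal_g_e: "orthonormal_on (I <+> {1..}) (case_sum g e)"
  unfolding orthonormal_on_def
proof (intro ballI)
  fix a b :: "nat + nat" assume ab: "a \<in> I <+> {1..}" "b \<in> I <+> {1..}"
  show "cinner (case_sum g e a) (case_sum g e b) = (if a = b then 1 else 0)"
    using ab orthonormal_onD[OF orthonormal_gs_basis[of "h_sequence h p"]] cinner_e cinner_g_e
      cinner_g_e[THEN cinner_eq_zero_commute[THEN iffD1]]
    by (auto simp: Plus_def split: if_splits)
qed

text \<open>Riesz representation gives a vector \<open>y0\<close> with the required scalar products,
  possibly with components outside the directions allowed at this step. Its Fourier coefficients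
  along the g_n and the earlier e_j define \<open>y\<close>. The difference of \<open>y\<close> and
  \<open>y0\<close> is orthogonal to these directions, hence to all earlier vectors, so the scalar
  products survive. By Bessel the squared norm of \<open>y\<close> is at most d, and the deficit
  goes to the new axis.\<close>

lemma realizes_step:
  assumes hs: "realizes q hs"
  obtains x where "realizes (Suc q) (hs(Suc q := x))"
proof -
  let ?new = "w (Suc q)"
  let ?S = "(\<lambda>u. (algorithm_vec w h hs u, idx_fun u)) ` known q"
  have G: "hs \<in> G_set w h p e M q" and K: "\<And>u v. u \<in> known q \<Longrightarrow> v \<in> known q \<Longrightarrow> cinner (algorithm_vec w h hs u) (algorithm_vec w h hs v) = kernel u v"
    using hs unfolding realizes_def by blast+
  have iso: "isometric \<mu> ?S"
    unfolding isometric_def using int_idx_fun_mult K[unfolded kernel_def] by blast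
  define d where "d = (\<integral>z. (cmod (idx_fun ?new z))\<^sup>2 \<partial>\<mu>)"
  obtain y0 where y0: "\<And>x f. (x, f) \<in> ?S \<Longrightarrow> cinner x y0 = (\<integral>z. f z * cnj (idx_fun ?new z) \<partial>\<mu>)" "(norm y0)\<^sup>2 \<le> d"
    unfolding d_def by (rule isometric_representation[OF iso int_idx_fun_square]) (use int_idx_fun_mult in blast)+
  have y0K: "cinner (algorithm_vec w h hs u) y0 = kernel u ?new" if "u \<in> known q" for u
    using y0(1)[of "algorithm_vec w h hs u" "idx_fun u"] that unfolding kernel_def by blast
  define \<alpha> where "\<alpha> = (\<lambda>n\<in>I. cinner y0 (g n))"
  define \<beta> where "\<beta> = (\<lambda>j\<in>{1..<Suc q}. cinner y0 (e j))"
  have Bessel: "(\<Sum>n\<in>F. (cmod (\<alpha> n))\<^sup>2) + (\<Sum>j\<in>{1..<Suc q}. (cmod (\<beta> j))\<^sup>2) \<le> (norm y0)\<^sup>2" if F: "finite F" "F \<subseteq> I" for F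
  proof -
    have "(\<Sum>a\<in>F <+> {1..<Suc q}. (cmod (cinner y0 (case_sum g e a)))\<^sup>2) \<le> (norm y0)\<^sup>2"
      by (rule Bessel_finite[OF orthonormal_g_e]) (use F in auto)
    also have "(\<Sum>a\<in>F <+> {1..<Suc q}. (cmod (cinner y0 (case_sum g e a)))\<^sup>2)
       = (\<Sum>n\<in>F. (cmod (cinner y0 (g n)))\<^sup>2) + (\<Sum>j\<in>{1..<Suc q}. (cmod (cinner y0 (e j)))\<^sup>2)"
      using F by (subst sum.Plus) auto
    also have "(\<Sum>n\<in>F. (cmod (cinner y0 (g n)))\<^sup>2) = (\<Sum>n\<in>F. (cmod (\<alpha> n))\<^sup>2)"
      by (intro sum.cong refl) (use F in \<open>auto simp: \<alpha>_def\<close>)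
    also have "(\<Sum>j\<in>{1..<Suc q}. (cmod (cinner y0 (e j)))\<^sup>2) = (\<Sum>j\<in>{1..<Suc q}. (cmod (\<beta> j))\<^sup>2)"
      by (intro sum.cong refl) (auto simp: \<beta>_def)
    finally show ?thesis .
  qed
  have \<beta>0: "0 \<le> (\<Sum>j\<in>{1..<Suc q}. (cmod (\<beta> j))\<^sup>2)" by (rule sum_nonneg) simp
  have sm: "(\<lambda>n. (cmod (\<alpha> n))\<^sup>2) summable_on I"
  proof (rule nonneg_bdd_above_summable_on)
    show "bdd_above (sum (\<lambda>n. (cmod (\<alpha> n))\<^sup>2) ` {F. F \<subseteq> I \<and> finite F})"
    proof (rule bdd_aboveI2)
      fix F assume "F \<in> {F. F \<subseteq> I \<and> finite F}"
      then show "(\<Sum>n\<in>F. (cmod (\<alpha> n))\<^sup>2) \<le> (norm y0)\<^sup>2" using Bessel[of F] \<beta>0 by simp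
    qed
  qed simp
  have "(\<Sum>\<^sub>\<infinity>n\<in>I. (cmod (\<alpha> n))\<^sup>2) \<le> (norm y0)\<^sup>2 - (\<Sum>j\<in>{1..<Suc q}. (cmod (\<beta> j))\<^sup>2)"
    by (rule infsum_le_finite_sums[OF sm]) (use Bessel in \<open>simp add: le_diff_eq\<close>)
  then have cd: "coeff_norm2 h p (Suc q) \<alpha> \<beta> \<le> d" unfolding coeff_norm2_def using y0(2) by linarith
  define y where "y = partial_vec h p e (Suc q) \<alpha> \<beta>"
  have yK: "cinner (algorithm_vec w h hs u) y = kernel u ?new" if u: "u \<in> known q" for u
  proof -
    have "cinner (algorithm_vec w h hs u) (y - y0) = 0"
    proof (rule algorithm_vec_orthogonal[OF G u])
      fix n assume "n \<in> I"
      then have "cinner (y - y0) (g n) = 0"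
        unfolding cinner_diff_left y_def by (subst partial_vec_props(2)[OF sm]) (auto simp: \<alpha>_def)
      then show "cinner (g n) (y - y0) = 0" by (rule cinner_eq_zero_commute[THEN iffD1])
    next
      fix j :: nat assume "1 \<le> j" "j \<le> q"
      then have "cinner (y - y0) (e j) = 0"
        unfolding cinner_diff_left y_def by (subst partial_vec_props(3)[OF sm]) (auto simp: \<beta>_def)
      then show "cinner (e j) (y - y0) = 0" by (rule cinner_eq_zero_commute[THEN iffD1])
    qed
    then show ?thesis using y0K[OF u] by (simp add: cinner_diff_right)
  qed
  have notin: "?new \<notin> known q"
  proof -
    have "w (Suc q) \<noteq> w i" if "i \<in> {1..q}" for i using w_eq_iff[of "Suc q" i] that by simp
    then have "w (Suc q) \<notin> w ` {1..q}" by blast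
    then show ?thesis using w_notin_Omega0[of "Suc q"] by simp
  qed
  have sprod: "step_sprod w h (Suc q) hs y d u v = kernel u v" if uv: "u \<in> known (Suc q)" "v \<in> known (Suc q)" for u v
  proof -
    have split: "u = ?new \<or> u \<in> known q" if "u \<in> known (Suc q)" for u
      using that by (auto simp: atLeastAtMostSuc_conv)
    have old: "algorithm_vec w h (hs(Suc q := y)) u = algorithm_vec w h hs u" if "u \<in> known q" for u
      by (rule algorithm_vec_cong[OF that]) simp
    have new: "algorithm_vec w h (hs(Suc q := y)) ?new = y" by (simp add: algorithm_vec_w)
    from split[OF uv(1)] split[OF uv(2)] show ?thesis
    proof (elim disjE)
      assume "u = ?new" "v = ?new"
      then show ?thesis by (simp add: step_sprod_def kernel_self d_def)
    next
      assume u: "u = ?new" and v: "v \<in> known q"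
      have "cinner y (algorithm_vec w h hs v) = cnj (kernel v ?new)"
        unfolding yK[OF v, symmetric] by (rule cinner_commute)
      then show ?thesis using u v notin by (auto simp: step_sprod_def new old[OF v] kernel_commute[of ?new v])
    next
      assume u: "u \<in> known q" and v: "v = ?new"
      then show ?thesis using notin by (auto simp: step_sprod_def new old[OF u] yK)
    next
      assume u: "u \<in> known q" and v: "v \<in> known q"
      then show ?thesis using notin by (auto simp: step_sprod_def old K)
    qed
  qed
  define x where "x = y + sqrt (d - coeff_norm2 h p (Suc q) \<alpha> \<beta>) *\<^sub>R e (Suc q)"
  have "hs(Suc q := x) \<in> G_set w h p e M (Suc q)"
  proof -
    have "eqn_holds (step_sprod w h (Suc q) hs y d) E" if E: "E \<in> step_equations w (Suc q)" for E
    proof (rule eqn_holds_cong[THEN iffD2])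
      show "eqn_holds kernel E" using E by (intro kernel_equations) (simp add: step_equations_def)
      show "step_sprod w h (Suc q) hs y d u v = kernel u v" if "u \<in> eqn_vectors E" "v \<in> eqn_vectors E" for u v
        using sprod step_equations_vectors[OF E] that by blast
    qed
    \<comment> \<open>The bound M was required for every solution, in particular for the fixed
      measure.\<close>
    moreover have "d \<le> M (Suc q)" unfolding d_def by (rule moment_bound) simp
    moreover have "\<alpha> \<in> I \<rightarrow>\<^sub>E UNIV" "\<beta> \<in> {1..<Suc q} \<rightarrow>\<^sub>E UNIV" by (simp_all add: \<alpha>_def \<beta>_def)
    ultimately have "(\<alpha>, \<beta>, d, hs) \<in> S_hat w h p e M (Suc q) (G_set w h p e M q)"
      unfolding S_hat_def S_set_def using sm cd G unfolding y_def by simp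
    then show ?thesis unfolding G_set.simps x_def y_def by blast
  qed
  moreover have "cinner (algorithm_vec w h (hs(Suc q := x)) u) (algorithm_vec w h (hs(Suc q := x)) v) = kernel u v"
    if "u \<in> known (Suc q)" "v \<in> known (Suc q)" for u v
    using step_sprod_eq_cinner[OF G sm cd that] sprod[OF that] unfolding x_def y_def by simp
  ultimately have "realizes (Suc q) (hs(Suc q := x))" unfolding realizes_def by blast
  then show ?thesis by (rule that)
qed

theorem algorithm_succeeds: "step0_check h" "bold_G w h p e M \<noteq> {}"
proof -
  show "step0_check h"
    unfolding step0_check_def
  proof (intro ballI impI)
    fix E assume "E \<in> equations" and E0: "eqn_vectors E \<subseteq> Omega0"
    show "eqn_holds (\<lambda>u v. cinner (initial_vec h u) (initial_vec h v)) E"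
      by (rule eqn_holds_cong[THEN iffD2, OF _ kernel_equations[OF \<open>E \<in> equations\<close>]])
        (use kernel_Omega0 E0 in blast)
  qed
  have "realizes 0 (\<lambda>_. undefined)"
    unfolding realizes_def by (auto simp: algorithm_vec_Omega0 kernel_Omega0)
  \<comment> \<open>Dependent choice makes the tuples extend one another, so that their diagonal is
    a single sequence with all of them as prefixes.\<close>
  then have "\<exists>f. \<forall>q. realizes q (f q) \<and> (\<exists>x. f (Suc q) = (f q)(Suc q := x))"
    by (intro dependent_nat_choice[where P = realizes and Q = "\<lambda>q hs hs'. \<exists>x. hs' = hs(Suc q := x)"])
      (blast, metis realizes_step)
  then obtain f where f: "\<And>q. realizes q (f q)" "\<And>q. \<exists>x. f (Suc q) = (f q)(Suc q := x)"
    by blast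
  have fG: "f q \<in> G_set w h p e M q" for q using f(1) by (simp add: realizes_def)
  \<comment> \<open>Tuples and sequences start at 1; the value \<open>undefined\<close> at 0 keeps
    \<open>v\<close> extensional.\<close>
  define v where "v i = (if i \<in> {1..} then f i i else undefined)" for i
  have stable: "f q i = f i i" if "i \<le> q" for i q
    using that
  proof (induction q rule: dec_induct)
    case (step q)
    obtain x where "f (Suc q) = (f q)(Suc q := x)" using f(2) by blast
    then show ?case using step by simp
  qed simp
  have res: "restrict v {1..q} = f q" for q
  proof
    fix i show "restrict v {1..q} i = f q i"
      using stable[of i q] G_set_undefined[OF fG, of i q] by (cases "i \<in> {1..q}") (auto simp: v_def)
  qed
  have nv: "norm (v j) \<le> sqrt (M j)" if j: "1 \<le> j" for j
  proof -
    have "w j \<in> known j" using j by auto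
    then have "cinner (f j j) (f j j) = kernel (w j) (w j)"
      using f(1)[of j] j unfolding realizes_def by (metis algorithm_vec_w)
    then have "complex_of_real ((norm (v j))\<^sup>2) = of_real (\<integral>z. (cmod (idx_fun (w j) z))\<^sup>2 \<partial>\<mu>)"
      unfolding cinner_self kernel_self using j by (simp add: v_def)
    then have "(norm (v j))\<^sup>2 \<le> M j" using moment_bound[OF j] by (simp only: of_real_eq_iff)
    then show ?thesis by (rule real_le_rsqrt)
  qed
  have "v \<in> bold_H M"
    unfolding bold_H_def
  proof (intro CollectI conjI)
    show "v \<in> {1..} \<rightarrow>\<^sub>E UNIV" by (auto simp: v_def extensional_def split: if_splits)
    show "bdd_above ((\<lambda>q. M q powr (- 1 / 2) * norm (v q)) ` {1..})"
    proof (rule bdd_aboveI2)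
      fix j :: nat assume "j \<in> {1..}"
      then have j: "1 \<le> j" by simp
      have Mj: "M j > 0" using M j unfolding moment_bounds_def by blast
      have "M j powr (- 1 / 2) * norm (v j) \<le> M j powr (- 1 / 2) * sqrt (M j)"
        by (rule mult_left_mono[OF nv[OF j]]) simp
      also have "\<dots> = 1" using Mj by (simp add: powr_half_sqrt[symmetric] powr_add[symmetric])
      finally show "M j powr (- 1 / 2) * norm (v j) \<le> 1" .
    qed
  qed
  then have "v \<in> bold_G w h p e M"
    unfolding bold_G_def bold_G_step_def using res fG nv by simp
  then show "bold_G w h p e M \<noteq> {}" by blast
qed

end

end

section \<open>Real and complex coordinates\<close>

lemma Re_Im_power_expansion:
  "complex_of_real (Re z ^ m * Im z ^ n) = 1 / (2 ^ m * (2 * \<i>) ^ n) *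
     (\<Sum>k=0..m. \<Sum>j=0..n. (-1) ^ (n - j) * of_nat (m choose k) * of_nat (n choose j) *
        (z ^ (k + j) * cnj z ^ ((m - k) + (n - j))))"
proof -
  have "complex_of_real (Re z) = (z + cnj z) / 2" "complex_of_real (Im z) = (z + - cnj z) / (2 * \<i>)"
    by (simp_all add: complex_add_cnj complex_diff_cnj mult_ac)
  then have "complex_of_real (Re z ^ m * Im z ^ n) = ((z + cnj z) / 2) ^ m * ((z + - cnj z) / (2 * \<i>)) ^ n"
    by (simp only: of_real_mult of_real_power)
  also have "\<dots> = 1 / (2 ^ m * (2 * \<i>) ^ n) * ((z + cnj z) ^ m * (z + - cnj z) ^ n)"
    by (simp only: power_divide) simp
  also have "(z + cnj z) ^ m * (z + - cnj z) ^ n = (\<Sum>k=0..m. \<Sum>j=0..n. (-1) ^ (n - j) * of_nat (m choose k) * of_nat (n choose j) *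
        (z ^ (k + j) * cnj z ^ ((m - k) + (n - j))))"
    unfolding binomial_ring sum_product atLeast0AtMost
    by (intro sum.cong refl) (simp only: power_minus[of "cnj z"] power_add mult_ac)
  finally show ?thesis .
qed

lemma complex_power_expansion:
  "z ^ m * cnj z ^ n = (\<Sum>r=0..m. \<Sum>l=0..n. of_nat (m choose r) * of_nat (n choose l) *
       (-1) ^ (n - l) * \<i> ^ ((m - r) + (n - l)) * complex_of_real (Re z ^ (r + l) * Im z ^ ((m - r) + (n - l))))"
proof -
  have "z ^ m * cnj z ^ n = (of_real (Re z) + \<i> * of_real (Im z)) ^ m * (of_real (Re z) + - (\<i> * of_real (Im z))) ^ n"
  proof -
    have "of_real (Re z) + \<i> * of_real (Im z) = z" "of_real (Re z) + - (\<i> * of_real (Im z)) = cnj z"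
      by (simp_all add: complex_eq_iff)
    then show ?thesis by (simp only:)
  qed
  also have "\<dots> = (\<Sum>r=0..m. \<Sum>l=0..n. of_nat (m choose r) * of_nat (n choose l) *
       (-1) ^ (n - l) * \<i> ^ ((m - r) + (n - l)) * complex_of_real (Re z ^ (r + l) * Im z ^ ((m - r) + (n - l))))"
    unfolding binomial_ring sum_product atLeast0AtMost
    by (intro sum.cong refl)
      (simp only: power_minus[of "\<i> * of_real (Im z)"] power_add power_mult_distrib of_real_mult of_real_power mult_ac)
  finally show ?thesis .
qed

text \<open>Moves the embedding of the reals under the integral, so that the binomial expansions can
  be integrated term by term in complex form.\<close>

lemma plane_moment_solution_alt:
  "plane_moment_solution s \<mu> \<longleftrightarrow> sets \<mu> = sets borel \<and>
     (\<forall>m n. integrable \<mu> (\<lambda>z. complex_of_real (fst z ^ m * snd z ^ n)) \<and>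
        (\<integral>z. complex_of_real (fst z ^ m * snd z ^ n) \<partial>\<mu>) = s m n)"
  unfolding plane_moment_solution_def complex_of_real_integrable_eq integral_complex_of_real split_def ..

lemma Re_Im_measurable: "(\<lambda>z. (Re z, Im z)) \<in> borel \<rightarrow>\<^sub>M borel"
  by (intro borel_measurable_continuous_onI continuous_intros)

lemma Complex_measurable: "(\<lambda>z. Complex (fst z) (snd z)) \<in> borel \<rightarrow>\<^sub>M borel"
  unfolding Complex_eq by (intro borel_measurable_continuous_onI continuous_intros)

lemma plane_moment_solution_of_complex:
  assumes \<sigma>: "complex_moment_solution a \<sigma>"
  shows "plane_moment_solution (plane_moments a) (distr \<sigma> borel (\<lambda>z. (Re z, Im z)))"
proof -
  have sets: "sets \<sigma> = sets borel" and int: "\<And>m n. integrable \<sigma> (\<lambda>z. z ^ m * cnj z ^ n)"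
    and mom: "\<And>m n. (\<integral>z. z ^ m * cnj z ^ n \<partial>\<sigma>) = a m n"
    using \<sigma> unfolding complex_moment_solution_def by auto
  have meas: "(\<lambda>z. (Re z, Im z)) \<in> \<sigma> \<rightarrow>\<^sub>M borel"
    using Re_Im_measurable by (simp add: measurable_cong_sets[OF sets refl])
  have f: "(\<lambda>z::real \<times> real. complex_of_real (fst z ^ m * snd z ^ n)) \<in> borel_measurable borel" for m n
    by (intro borel_measurable_continuous_onI continuous_intros)
  show ?thesis unfolding plane_moment_solution_alt
  proof (intro conjI allI)
    fix m n
    show "integrable (distr \<sigma> borel (\<lambda>z. (Re z, Im z))) (\<lambda>z. complex_of_real (fst z ^ m * snd z ^ n))"
      unfolding integrable_distr_eq[OF meas f] fst_conv snd_conv Re_Im_power_expansion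
      by (intro integrable_mult_right Bochner_Integration.integrable_sum int)
    show "(\<integral>z. complex_of_real (fst z ^ m * snd z ^ n) \<partial>distr \<sigma> borel (\<lambda>z. (Re z, Im z))) = plane_moments a m n"
      unfolding integral_distr[OF meas f] fst_conv snd_conv Re_Im_power_expansion plane_moments_def
      by (simp add: Bochner_Integration.integral_sum int mom Bochner_Integration.integrable_sum)
  qed simp
qed

lemma integral_complex_power_plane:
  assumes \<mu>: "plane_moment_solution s \<mu>"
  shows "integrable \<mu> (\<lambda>z. Complex (fst z) (snd z) ^ m * cnj (Complex (fst z) (snd z)) ^ n)"
    and "(\<integral>z. Complex (fst z) (snd z) ^ m * cnj (Complex (fst z) (snd z)) ^ n \<partial>\<mu>)
      = (\<Sum>r=0..m. \<Sum>l=0..n. of_nat (m choose r) * of_nat (n choose l) *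
       (-1) ^ (n - l) * \<i> ^ ((m - r) + (n - l)) * s (r + l) ((m - r) + (n - l)))"
proof -
  have int: "\<And>m n. integrable \<mu> (\<lambda>z. complex_of_real (fst z ^ m * snd z ^ n))"
    and mom: "\<And>m n. (\<integral>z. complex_of_real (fst z ^ m * snd z ^ n) \<partial>\<mu>) = s m n"
    using \<mu> unfolding plane_moment_solution_alt by auto
  show "integrable \<mu> (\<lambda>z. Complex (fst z) (snd z) ^ m * cnj (Complex (fst z) (snd z)) ^ n)"
    unfolding complex_power_expansion complex.sel
    by (intro integrable_mult_right Bochner_Integration.integrable_sum int)
  show "(\<integral>z. Complex (fst z) (snd z) ^ m * cnj (Complex (fst z) (snd z)) ^ n \<partial>\<mu>)
      = (\<Sum>r=0..m. \<Sum>l=0..n. of_nat (m choose r) * of_nat (n choose l) *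
       (-1) ^ (n - l) * \<i> ^ ((m - r) + (n - l)) * s (r + l) ((m - r) + (n - l)))"
    unfolding complex_power_expansion complex.sel
    by (subst Bochner_Integration.integral_sum, intro integrable_mult_right Bochner_Integration.integrable_sum int)
      (subst Bochner_Integration.integral_sum, intro integrable_mult_right int, simp only: Bochner_Integration.integral_mult_right[OF int] mom)
qed

lemma complex_moment_solution_of_plane:
  assumes \<mu>: "plane_moment_solution s \<mu>"
    and a: "\<And>m n. a m n = (\<Sum>r=0..m. \<Sum>l=0..n. of_nat (m choose r) * of_nat (n choose l) *
       (-1) ^ (n - l) * \<i> ^ ((m - r) + (n - l)) * s (r + l) ((m - r) + (n - l)))"
  shows "complex_moment_solution a (distr \<mu> borel (\<lambda>z. Complex (fst z) (snd z)))"
proof -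
  have sets: "sets \<mu> = sets borel" using \<mu> unfolding plane_moment_solution_def by blast
  have meas: "(\<lambda>z. Complex (fst z) (snd z)) \<in> \<mu> \<rightarrow>\<^sub>M borel"
    using Complex_measurable by (simp add: measurable_cong_sets[OF sets refl])
  have f: "(\<lambda>z. z ^ m * cnj z ^ n) \<in> borel_measurable borel" for m n
    by (intro borel_measurable_continuous_onI continuous_intros)
  show ?thesis unfolding complex_moment_solution_def integrable_distr_eq[OF meas f] integral_distr[OF meas f] a
    using integral_complex_power_plane[OF \<mu>] by simp
qed

lemma positivity_of_plane_solution:
  assumes \<mu>: "plane_moment_solution s \<mu>"
  shows "positivity_condition s"
  unfolding positivity_condition_def
proof (intro allI impI)
  fix \<alpha> :: "nat \<Rightarrow> nat \<Rightarrow> complex"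
  let ?S = "{(m, n). \<alpha> m n \<noteq> 0}"
  have int: "\<And>m n. integrable \<mu> (\<lambda>z. complex_of_real (fst z ^ m * snd z ^ n))"
    and mom: "\<And>m n. (\<integral>z. complex_of_real (fst z ^ m * snd z ^ n) \<partial>\<mu>) = s m n"
    using \<mu> unfolding plane_moment_solution_alt by auto
  \<comment> \<open>The quadratic form is the integral of the squared modulus of this
    polynomial.\<close>
  define F where "F z = (\<Sum>(m, n)\<in>?S. \<alpha> m n * complex_of_real (fst z ^ m * snd z ^ n))" for z :: "real \<times> real"
  have "(\<integral>z. complex_of_real ((cmod (F z))\<^sup>2) \<partial>\<mu>) = (\<integral>z. (\<Sum>(m, n)\<in>?S. \<Sum>(m', n')\<in>?S.
      \<alpha> m n * cnj (\<alpha> m' n') * complex_of_real (fst z ^ (m + m') * snd z ^ (n + n'))) \<partial>\<mu>)"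
    unfolding complex_norm_square F_def cnj_sum sum_product
    by (intro Bochner_Integration.integral_cong refl sum.cong) (simp add: split_def power_add mult_ac)
  also have "\<dots> = (\<Sum>(m, n)\<in>?S. \<Sum>(m', n')\<in>?S. \<alpha> m n * cnj (\<alpha> m' n') * s (m + m') (n + n'))"
    unfolding split_def
    by (subst Bochner_Integration.integral_sum, intro integrable_mult_right Bochner_Integration.integrable_sum int)
      (subst Bochner_Integration.integral_sum, intro integrable_mult_right int, simp only: Bochner_Integration.integral_mult_right[OF int] mom)
  finally have eq: "(\<Sum>(m, n)\<in>?S. \<Sum>(m', n')\<in>?S. \<alpha> m n * cnj (\<alpha> m' n') * s (m + m') (n + n'))
    = complex_of_real (\<integral>z. (cmod (F z))\<^sup>2 \<partial>\<mu>)"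
    unfolding integral_complex_of_real by (rule sym)
  show "(\<Sum>(m, n)\<in>?S. \<Sum>(m', n')\<in>?S. \<alpha> m n * cnj (\<alpha> m' n') * s (m + m') (n + n')) \<in> \<real>\<^sub>\<ge>\<^sub>0"
    unfolding eq by simp
qed

theorem theorem4p1:
  fixes a s :: "nat \<Rightarrow> nat \<Rightarrow> complex"
    and w :: "nat \<Rightarrow> idx"
    and M :: "nat \<Rightarrow> real"
    and p :: "nat \<Rightarrow> nat \<times> nat"
    and H0 :: "'h::chilbert_space set"
    and Hs :: "nat \<Rightarrow> 'h set"
    and h :: "nat \<Rightarrow> nat \<Rightarrow> 'h"
    and e :: "nat \<Rightarrow> 'h"
  assumes s: "s = plane_moments a"
    and w: "bij_betw w {1..} Omega'"
    and M: "moment_bounds s w M"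
    and p: "bij p"
    and model: "positivity_condition s \<Longrightarrow> model_space s H0 Hs h e"
  shows "(\<exists>\<sigma>. complex_moment_solution a \<sigma>) \<longleftrightarrow>
    positivity_condition s \<and>
    (step0_check h \<and> bold_G w h p e M \<noteq> {}) \<and>
    (\<forall>m n. a m n = (\<Sum>r=0..m. \<Sum>l=0..n. of_nat (m choose r) * of_nat (n choose l) *
       (-1) ^ (n - l) * \<i> ^ ((m - r) + (n - l)) * s (r + l) ((m - r) + (n - l))))"
proof
  assume "\<exists>\<sigma>. complex_moment_solution a \<sigma>"
  then obtain \<sigma> where \<sigma>: "complex_moment_solution a \<sigma>" by blast
  define \<mu> where "\<mu> = distr \<sigma> borel (\<lambda>z. (Re z, Im z))"
  have \<mu>: "plane_moment_solution s \<mu>"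
    unfolding s \<mu>_def by (rule plane_moment_solution_of_complex[OF \<sigma>])
  then have pos: "positivity_condition s" by (rule positivity_of_plane_solution)
  \<comment> \<open>The model space is given only under the positivity condition, which therefore
    has to be established first.\<close>
  interpret algorithm s w M p H0 Hs h e
    by unfold_locales (fact w, fact p, rule model[OF pos])
  have "a m n = (\<Sum>r=0..m. \<Sum>l=0..n. of_nat (m choose r) * of_nat (n choose l) *
       (-1) ^ (n - l) * \<i> ^ ((m - r) + (n - l)) * s (r + l) ((m - r) + (n - l)))" for m n
  proof -
    have sets: "sets \<sigma> = sets borel" using \<sigma> unfolding complex_moment_solution_def by blast
    have meas: "(\<lambda>z. (Re z, Im z)) \<in> \<sigma> \<rightarrow>\<^sub>M borel"
      using Re_Im_measurable by (simp add: measurable_cong_sets[OF sets refl])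
    have f: "(\<lambda>z. Complex (fst z) (snd z) ^ m * cnj (Complex (fst z) (snd z)) ^ n) \<in> borel_measurable borel"
      unfolding Complex_eq by (intro borel_measurable_continuous_onI continuous_intros)
    have "a m n = (\<integral>z. z ^ m * cnj z ^ n \<partial>\<sigma>)" using \<sigma> unfolding complex_moment_solution_def by metis
    also have "\<dots> = (\<integral>z. Complex (fst z) (snd z) ^ m * cnj (Complex (fst z) (snd z)) ^ n \<partial>\<mu>)"
      unfolding \<mu>_def integral_distr[OF meas f] by simp
    finally show ?thesis unfolding integral_complex_power_plane(2)[OF \<mu>] .
  qed
  then show "positivity_condition s \<and>
    (step0_check h \<and> bold_G w h p e M \<noteq> {}) \<and>
    (\<forall>m n. a m n = (\<Sum>r=0..m. \<Sum>l=0..n. of_nat (m choose r) * of_nat (n choose l) *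
       (-1) ^ (n - l) * \<i> ^ ((m - r) + (n - l)) * s (r + l) ((m - r) + (n - l))))"
    using pos algorithm_succeeds[OF \<mu> M] by blast
next
  assume A: "positivity_condition s \<and>
    (step0_check h \<and> bold_G w h p e M \<noteq> {}) \<and>
    (\<forall>m n. a m n = (\<Sum>r=0..m. \<Sum>l=0..n. of_nat (m choose r) * of_nat (n choose l) *
       (-1) ^ (n - l) * \<i> ^ ((m - r) + (n - l)) * s (r + l) ((m - r) + (n - l))))"
  interpret algorithm s w M p H0 Hs h e
    by unfold_locales (fact w, fact p, use A model in blast)
  obtain \<mu> where "plane_moment_solution s \<mu>" using plane_moment_solution_exists A by blast
  then show "\<exists>\<sigma>. complex_moment_solution a \<sigma>"
    using complex_moment_solution_of_plane[of s \<mu> a] A by blast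
qed

end
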